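(* Let $V_0=\mathrm{Vir}_{3,4}$, $V_{1/2}$ and $V_{1/16}$ be the three irreducible modules of the Ising model vertex algebra $\mathrm{Vir}_{3,4}$. Their (unnormalized) characters are given by $$\chi_{V_0}(q)=\sum_{k_1,k_2\ge 0}\frac{q^{4k_1^2+3k_1k_2+k_2^2}}{(q)_{k_1}(q)_{k_2}}\left(1-q^{4k_1+2k_2+1}\right),$$ $$\chi_{V_{1/2}}(q)=q^{1/2}\sum_{k_1,k_2\ge 0}\frac{q^{4k_1^2+3k_1k_2+k_2^2+2k_1}}{(q)_{k_1}(q)_{k_2}}\left(1-q^{8k_1+4k_2+6}\right),$$ $$\chi_{V_{1/16}}(q)=\sum_{k_1,k_2\ge 0}\frac{q^{4k_1^2+3k_1k_2+k_2^2}}{(q)_{k_1}(q)_{k_2}}\left(q^{k_1+k_2}+q^{4k_1+k_2+1}\right).$$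
   Context: Notation: $(q)_n=\prod_{j=1}^n(1-q^j)$, $(q)_0=1$. The Virasoro Lie algebra has basis $\{L_n\}_{n\in\mathbb{Z}}\cup\{C\}$, with $C$ central and $[L_m,L_n]=(m-n)L_{m+n}+\frac{m^3-m}{12}\delta_{m,-n}C$. The Ising model $\mathrm{Vir}_{3,4}$ is the simple Virasoro vertex algebra of central charge $1/2$. Its irreducible modules are $V_h$, $h\in\{0,1/2,1/16\}$, where $V_h$ is the irreducible highest weight Virasoro module of central charge $1/2$ whose highest weight (singular) vector has $L_0$-eigenvalue $h$; $V_0=\mathrm{Vir}_{3,4}$. Normalization of characters: with $(V_h)_{h+n}$ the $L_0$-eigenspace of eigenvalue $h+n$, $\chi_{V_0}(q)=\sum_{n\ge 0}\dim (V_0)_n\,q^n$, $\chi_{V_{1/2}}(q)=\sum_{n\ge 0}\dim (V_{1/2})_{1/2+n}\,q^{1/2+n}$, and $\chi_{V_{1/16}}(q)=\sum_{n\ge 0}\dim (V_{1/16})_{1/16+n}\,q^{n}$ (no factor $q^{1/16}$). In this normalization the known expressions are $\chi_{V_0}(q)=\frac12\left(\prod_{m\ge1}(1+q^{m-1/2})+\prod_{m\ge1}(1-q^{m-1/2})\right)=\sum_{k\ge0}\frac{q^{2k^2}}{(q)_{2k}}$, $\chi_{V_{1/2}}(q)=\frac12\left(\prod_{m\ge1}(1+q^{m-1/2})-\prod_{m\ge1}(1-q^{m-1/2})\right)=q^{1/2}\sum_{k\ge1}\frac{q^{2k^2-2k}}{(q)_{2k-1}}$, $\chi_{V_{1/16}}(q)=\prod_{m\ge1}(1+q^m)=\sum_{k\ge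 0}\frac{q^{k(k+1)/2}}{(q)_k}$. *)

theory Defs
  imports
    "HOL-Analysis.Analysis"
    "HOL-Computational_Algebra.Formal_Power_Series"
begin

text \<open>
  A representation of the Virasoro Lie algebra on a complex vector space, given by the operators
  by which the basis elements act. The type \<open>'v\<close> is the whole space; \<open>smul\<close> is its scalar
  multiplication.
\<close>

locale virasoro_module = vector_space smul
  for smul :: "complex \<Rightarrow> 'v::ab_group_add \<Rightarrow> 'v" +
  fixes L :: "int \<Rightarrow> 'v \<Rightarrow> 'v" and C :: "'v \<Rightarrow> 'v"
  assumes linear_L: "Vector_Spaces.linear smul smul (L n)"
    and linear_C: "Vector_Spaces.linear smul smul C"
    and L_commutator:
      "L m (L n v) - L n (L m v) =
         smul (of_int (m - n)) (L (m + n) v)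
         + (if m = - n then smul (of_int (m ^ 3 - m) / 12) (C v) else 0)"
    and C_central: "L n (C v) = C (L n v)"
begin

definition submodule :: "'v set \<Rightarrow> bool" where
  "submodule W \<longleftrightarrow> subspace W \<and> (\<forall>n. L n ` W \<subseteq> W) \<and> C ` W \<subseteq> W"

definition irreducible_module :: bool where
  "irreducible_module \<longleftrightarrow>
     (\<exists>v::'v. v \<noteq> 0) \<and> (\<forall>W. submodule W \<longrightarrow> W = {0} \<or> W = UNIV)"

definition has_central_charge :: "complex \<Rightarrow> bool" where
  "has_central_charge c \<longleftrightarrow> (\<forall>v. C v = smul c v)"

definition highest_weight_vector :: "complex \<Rightarrow> 'v \<Rightarrow> bool" where
  "highest_weight_vector h v \<longleftrightarrow> v \<noteq> 0 \<and> L 0 v = smul h v \<and> (\<forall>n>0. L n v = 0)"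

text \<open>The \<open>L\<^sub>0\<close>-eigenspace of eigenvalue \<open>d\<close>.\<close>

definition weight_space :: "complex \<Rightarrow> 'v set" where
  "weight_space d = {v. L 0 v = smul d v}"

end

text \<open>
  That the highest weight vector generates the module is automatic from irreducibility.
\<close>

locale irreducible_highest_weight_module = virasoro_module smul L C
  for smul :: "complex \<Rightarrow> 'v::ab_group_add \<Rightarrow> 'v"
    and L :: "int \<Rightarrow> 'v \<Rightarrow> 'v" and C :: "'v \<Rightarrow> 'v" +
  fixes c h :: complex
  assumes irreducible: "irreducible_module"
    and central_charge: "has_central_charge c"
    and highest_weight: "\<exists>v. highest_weight_vector h v"

text \<open>
  The irreducible modules \<open>V\<^sub>h\<close>, \<open>h \<in> {0, 1/2, 1/16}\<close>, of the Ising model vertex algebra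
  \<open>Vir\<^sub>3\<^sub>,\<^sub>4 = V\<^sub>0\<close>, regarded as Virasoro modules; they have central charge \<open>1/2\<close>.
\<close>

definition ising_module ::
  "complex \<Rightarrow> (complex \<Rightarrow> 'v::ab_group_add \<Rightarrow> 'v) \<Rightarrow> (int \<Rightarrow> 'v \<Rightarrow> 'v) \<Rightarrow> ('v \<Rightarrow> 'v) \<Rightarrow> bool"
where
  "ising_module h smul L C \<longleftrightarrow>
     h \<in> {0, 1/2, 1/16} \<and> irreducible_highest_weight_module smul L C (1/2) h"

text \<open>
  Characters live in \<open>\<complex>[[q\<^sup>1\<^sup>/\<^sup>2]]\<close>: the variable of the formal power series is \<open>q\<^sup>1\<^sup>/\<^sup>2\<close>.
\<close>

definition sqrt_q :: "complex fps" where
  "sqrt_q = fps_X"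

definition q_var :: "complex fps" where
  "q_var = sqrt_q ^ 2"

definition qpoch :: "nat \<Rightarrow> complex fps" where
  "qpoch n = (\<Prod>j=1..n. (1 - q_var ^ j))"

text \<open>
  \<open>graded_dimension smul L h\<close> is the series \<open>\<Sum>\<^sub>n dim V\<^bsub>h+n\<^esub> q\<^sup>n\<close>. The three characters are
  normalized with leading exponents \<open>0\<close>, \<open>1/2\<close> and \<open>0\<close>: only the module of highest weight \<open>1/2\<close>
  keeps the factor \<open>q\<^sup>h\<close>. Weight spaces of highest weight modules are finite-dimensional, so the
  convention that \<open>dim\<close> is \<open>0\<close> in infinite dimension plays no role.
\<close>

definition graded_dimension ::
  "(complex \<Rightarrow> 'v::ab_group_add \<Rightarrow> 'v) \<Rightarrow> (int \<Rightarrow> 'v \<Rightarrow> 'v) \<Rightarrow> complex \<Rightarrow> complex fps"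
where
  "graded_dimension smul L h =
     fps_compose
       (Abs_fps (\<lambda>n. of_nat (vector_space.dim smul
                               (virasoro_module.weight_space smul L (h + of_nat n)))))
       q_var"

definition ising_character ::
  "complex \<Rightarrow> (complex \<Rightarrow> 'v::ab_group_add \<Rightarrow> 'v) \<Rightarrow> (int \<Rightarrow> 'v \<Rightarrow> 'v) \<Rightarrow> complex fps"
where
  "ising_character h smul L =
     (if h = 1/2 then sqrt_q else 1) * graded_dimension smul L h"

end

(*
  Characters of the modules: on a fermionic Fock space the operators
    L_n = sum_i (i/2) psi_{n-i} psi_{n+i}   (plus 1/16 for n = 0 in the Ramond case)
  represent the Virasoro algebra with central charge 1/2. The operator
  I = L_0^2 + 2 sum_{j>0} L_{-j} L_j satisfies [I, psi_s] = kappa_s psi_s with kappa_s cubic in s,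
  so a subspace stable under all L_n is stable under all products psi_a psi_b with a + b nonzero; hence
  each parity sector is irreducible. The submodule of V x Fock generated by a pair of highest
  weight vectors is then the graph of an isomorphism, and dim V_{h+n} counts occupation sets, which
  gives the characters sum_j q^{2j^2}/(q)_{2j}, sum_j q^{1/2+2j^2+2j}/(q)_{2j+1} and
  sum_j q^{2j^2-j}/(q)_{2j}.

  Double sums: write k_1 = m, k_2 = n - m and 1/(q)_{n-m} = (q^{n-m+1})_m/(q)_n, expand by the
  q-binomial theorem and sum over the other pair of indices first. The inner sums are then
  evaluated by telescoping, which leaves the same single sums.
*)

theory Submission
  imports Defs "HOL-Library.FSet"
begin

text \<open>Normal ordering the Virasoro relation or the commutator of I with a mode directly would
  mean rearranging infinite sums. Both are reduced to a defect that commutes or anticommutes with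
  every mode; such a defect is fixed by its values on ground states, where only finitely many terms
  survive. There the square 1/2 of the Ramond zero mode forces the constant 1/16. The operator I is
  needed because commuting with L_0 multiplies every term psi_{n-i} psi_{n+i} of L_n by the same
  number -n. With kappa cubic the multiplier depends on i through n i^2, which separates the terms
  exactly when n is nonzero; hence the condition on a + b. In the double sums the factors 1 - q^(4
  k_1 + 2 k_2 + 1) and 1 - q^(8 k_1 + 4 k_2 + 6) depend only on 2 k_1 + k_2 = m + n, so they pass
  through the exchange of summations. The Ramond factor is not of this form; that sum is assembled
  from two instances of the vacuum type by contiguity relations.\<close>

section \<open>Fermionic Fock space\<close>

text \<open>Coefficient functions on the sets of occupied modes; the set \<open>S\<close> has energy \<open>\<Sum>S / 2\<close>.
  Functions of infinite support are admitted.\<close>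

type_synonym fock = "nat fset \<Rightarrow> complex"

text \<open>The Jordan-Wigner sign: a mode passes all smaller occupied modes. It turns the commuting
  set operations into anticommuting operators.\<close>

definition fsign :: "nat \<Rightarrow> nat fset \<Rightarrow> complex" where
  "fsign a S = (- 1) ^ card {s. s |\<in>| S \<and> s < a}"

definition create :: "nat \<Rightarrow> fock \<Rightarrow> fock" where
  "create a f = (\<lambda>S. if a |\<in>| S then fsign a S * f (S |-| {|a|}) else 0)"

definition annihilate :: "nat \<Rightarrow> fock \<Rightarrow> fock" where
  "annihilate a f = (\<lambda>S. if a |\<in>| S then 0 else fsign a S * f (finsert a S))"

lemma finite_below: "finite {s. s |\<in>| S \<and> s < (a::nat)}"
  by (rule finite_subset[of _ "{..<a}"]) auto

lemma fsign_square [simp]: "fsign a S * fsign a S = 1"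
  by (simp add: fsign_def flip: power_add mult_2)

lemma fsign_square_left [simp]: "fsign a S * (fsign a S * x) = x"
  by (simp flip: mult.assoc)

lemma fsign_finsert:
  assumes "b |\<notin>| S"
  shows "fsign a (finsert b S) = (if b < a then - fsign a S else fsign a S)"
proof (cases "b < a")
  case True
  then have "{s. s |\<in>| finsert b S \<and> s < a} = insert b {s. s |\<in>| S \<and> s < a}" by auto
  then show ?thesis using True assms by (simp add: fsign_def finite_below)
next
  case False
  then have "{s. s |\<in>| finsert b S \<and> s < a} = {s. s |\<in>| S \<and> s < a}" by auto
  then show ?thesis using False by (simp add: fsign_def)
qed

lemma fsign_fminus:
  assumes "b |\<in>| S"
  shows "fsign a (S |-| {|b|}) = (if b < a then - fsign a S else fsign a S)"
proof -
  have "S = finsert b (S |-| {|b|})" using assms by auto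
  then have "fsign a S = (if b < a then - fsign a (S |-| {|b|}) else fsign a (S |-| {|b|}))"
    using fsign_finsert[of b "S |-| {|b|}" a] by simp
  then show ?thesis by auto
qed

lemma fminus_commute: "S |-| {|a|} |-| {|b|} = S |-| {|b|} |-| {|a|}"
  by auto

lemma finsert_fminus_commute: "a \<noteq> b \<Longrightarrow> finsert a (S |-| {|b|}) = finsert a S |-| {|b|}"
  by auto

text \<open>Of two distinct modes exactly one lies below the other, so exactly one of the two signs
  changes when the order is exchanged. For \<open>a = b\<close> the mode would be removed
  twice.\<close>

lemma create_create: "create a (create b f) S + create b (create a f) S = 0"
  by (cases "a = b")
     (auto simp: create_def fsign_fminus fminus_commute[of S a b] not_less_iff_gr_or_eq)

lemma annihilate_annihilate: "annihilate a (annihilate b f) S + annihilate b (annihilate a f) S = 0"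
  by (cases "a = b")
     (auto simp: annihilate_def fsign_finsert finsert_commute[of a b] not_less_iff_gr_or_eq)

lemma annihilate_create:
  "annihilate a (create b f) S + create b (annihilate a f) S = (if a = b then f S else 0)"
proof (cases "a = b")
  case True
  then show ?thesis
    by (cases "a |\<in>| S")
       (auto simp: create_def annihilate_def fsign_finsert fsign_fminus finsert_absorb)
next
  case False
  then show ?thesis
    by (auto simp: create_def annihilate_def fsign_finsert fsign_fminus
        finsert_fminus_commute not_less_iff_gr_or_eq)
qed

lemma create_linear:
  "create a (\<lambda>S. c * f S + d * g S) S = c * create a f S + d * create a g S"
  by (simp add: create_def algebra_simps)

lemma annihilate_linear:
  "annihilate a (\<lambda>S. c * f S + d * g S) S = c * annihilate a f S + d * annihilate a g S"
  by (simp add: annihilate_def algebra_simps)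

lemma create_sum: "create a (\<lambda>S. \<Sum>i\<in>A. c i * f i S) S = (\<Sum>i\<in>A. c i * create a (f i) S)"
  by (simp add: create_def sum_distrib_left mult.left_commute)

lemma annihilate_sum:
  "annihilate a (\<lambda>S. \<Sum>i\<in>A. c i * f i S) S = (\<Sum>i\<in>A. c i * annihilate a (f i) S)"
  by (simp add: annihilate_def sum_distrib_left mult.left_commute)

text \<open>All mode indices are doubled, so \<open>p = 1\<close> is the Neveu-Schwarz case of half-integer modes and
  \<open>p = 0\<close> the Ramond case of integer modes.\<close>

locale fermion =
  fixes p :: int
  assumes p: "p = 0 \<or> p = 1"
begin

text \<open>Modes of the wrong parity are set to zero, so that formulas can sum over all integers.
  The Ramond zero mode is its own partner: the division by \<open>sqrt 2\<close> gives it the square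
  1/2 demanded by \<open>anti 0 0 = 1\<close>.\<close>

definition psi :: "int \<Rightarrow> fock \<Rightarrow> fock" where
  "psi k f = (if k mod 2 \<noteq> p then (\<lambda>S. 0)
     else if k < 0 then create (nat (- k)) f
     else if k > 0 then annihilate (nat k) f
     else (\<lambda>S. (create 0 f S + annihilate 0 f S) / complex_of_real (sqrt 2)))"

definition anti :: "int \<Rightarrow> int \<Rightarrow> complex" where
  "anti j k = (if j + k = 0 \<and> k mod 2 = p then 1 else 0)"

lemma sqrt2_sq: "complex_of_real (sqrt 2) * complex_of_real (sqrt 2) = 2"
  by (simp flip: of_real_mult)

lemma psi_linear:
  "psi k (\<lambda>S. c * f S + d * g S) S = c * psi k f S + d * psi k g S"
  by (simp add: psi_def create_linear annihilate_linear add_divide_distrib algebra_simps)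

lemma psi_add: "psi k (\<lambda>S. f S + g S) S = psi k f S + psi k g S"
  using psi_linear[of k 1 f 1 g] by simp

lemma psi_scale: "psi k (\<lambda>S. c * f S) S = c * psi k f S"
  using psi_linear[of k c f 0 f] by simp

lemma psi_zero [simp]: "psi k (\<lambda>S. 0) S = 0"
  using psi_scale[of k 0 "\<lambda>_. 0" S] by simp

lemma psi_diff: "psi k (\<lambda>S. f S - g S) S = psi k f S - psi k g S"
  using psi_linear[of k 1 f "- 1" g] by simp

lemma psi_sum: "psi k (\<lambda>S. \<Sum>i\<in>A. c i * f i S) S = (\<Sum>i\<in>A. c i * psi k (f i) S)"
  by (simp add: psi_def create_sum annihilate_sum sum.distrib sum_divide_distrib algebra_simps
      add_divide_distrib)

lemma psi_psi: "psi j (psi k f) S + psi k (psi j f) S = anti j k * f S"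
proof -
  have cc: "create a (create b f) S = - create b (create a f) S" for a b f S
    using create_create[of a b f S] by (simp add: eq_neg_iff_add_eq_0)
  have aa: "annihilate a (annihilate b f) S = - annihilate b (annihilate a f) S" for a b f S
    using annihilate_annihilate[of a b f S] by (simp add: eq_neg_iff_add_eq_0)
  have ac: "annihilate a (create b f) S = (if a = b then f S else 0) - create b (annihilate a f) S"
    for a b f S using annihilate_create[of a b f S] by (simp add: algebra_simps)
  have cd: "create a (\<lambda>S. (f S + g S) / c) S = (create a f S + create a g S) / c" for a f g c S
    by (simp add: create_def add_divide_distrib algebra_simps)
  have ad: "annihilate a (\<lambda>S. (f S + g S) / c) S = (annihilate a f S + annihilate a g S) / c"
    for a f g c S by (simp add: annihilate_def add_divide_distrib algebra_simps)
  have cd': "create a (\<lambda>S. f S / c + g S / c) S = (create a f S + create a g S) / c" for a f g c S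
    using cd[of a f g c S] by (simp add: add_divide_distrib)
  have ad': "annihilate a (\<lambda>S. f S / c + g S / c) S = (annihilate a f S + annihilate a g S) / c"
    for a f g c S using ad[of a f g c S] by (simp add: add_divide_distrib)
  have c0: "create a (\<lambda>S. 0) S = 0" "annihilate a (\<lambda>S. 0) S = 0" for a S
    by (auto simp: create_def annihilate_def)
  \<comment> \<open>The squares of \<open>create 0\<close> and \<open>annihilate 0\<close> vanish
    and the two mixed products add up to \<open>f\<close>. The factor 2 accounts for both orders in
    the anticommutator of \<open>psi 0\<close> with itself.\<close>
  have z: "(create 0 (psi 0 f) S + annihilate 0 (psi 0 f) S) / complex_of_real (sqrt 2) * 2 = f S"
    if "p = 0" for f S
  proof -
    have cc0: "create 0 (create 0 f) S = 0" using cc[of 0 0 f S] by simp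
    have aa0: "annihilate 0 (annihilate 0 f) S = 0" using aa[of 0 0 f S] by simp
    have "psi 0 f = (\<lambda>S. (create 0 f S + annihilate 0 f S) / complex_of_real (sqrt 2))"
      unfolding psi_def using that by simp
    then have "create 0 (psi 0 f) S + annihilate 0 (psi 0 f) S = f S / complex_of_real (sqrt 2)"
      by (simp add: cd ad cc0 aa0 ac flip: add_divide_distrib)
    then have "(create 0 (psi 0 f) S + annihilate 0 (psi 0 f) S) / complex_of_real (sqrt 2) * 2
        = f S / (complex_of_real (sqrt 2) * complex_of_real (sqrt 2)) * 2" by simp
    then show ?thesis by (simp add: sqrt2_sq)
  qed
  consider "j mod 2 \<noteq> p \<or> k mod 2 \<noteq> p" | "j mod 2 = p" "k mod 2 = p" "j = 0" "k = 0"
    | "j mod 2 = p" "k mod 2 = p" "j \<noteq> 0 \<or> k \<noteq> 0" by blast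
  then show ?thesis
  proof cases
    case 1
    then have "anti j k = 0" unfolding anti_def by presburger
    then show ?thesis using 1 by (auto simp: psi_def c0)
  next
    case 2
    then have "psi 0 (psi 0 f) S = (create 0 (psi 0 f) S + annihilate 0 (psi 0 f) S) / complex_of_real (sqrt 2)"
      unfolding psi_def[of 0 "psi 0 f"] using 2 by simp
    moreover have "p = 0" using 2 by simp
    ultimately have "psi 0 (psi 0 f) S * 2 = f S" using z[of f S] by simp
    moreover have "anti j k = 1" unfolding anti_def using 2 by simp
    ultimately show ?thesis using 2(3,4) by (simp add: mult.commute)
  next
    case 3
    have e: "nat k = nat (- j) \<longleftrightarrow> j + k = 0" if "k > 0" "j < 0" using that by auto
    have e': "nat j = nat (- k) \<longleftrightarrow> j + k = 0" if "j > 0" "k < 0" using that by auto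
    consider "j < 0" "k < 0" | "j < 0" "k = 0" | "j < 0" "k > 0" | "j = 0" "k < 0" | "j = 0" "k > 0"
      | "j > 0" "k < 0" | "j > 0" "k = 0" | "j > 0" "k > 0" using 3(3) by linarith
    then show ?thesis
      by cases (unfold psi_def anti_def, use 3 e e' in \<open>auto simp: cd ad cd' ad' ac aa[of "nat j" "nat k"]
            cc[of "nat (- j)" "nat (- k)"] aa[of 0] cc[of 0] add_divide_distrib diff_divide_distrib\<close>)
  qed
qed

lemma psi_anticomm: "psi j (psi k f) S = anti j k * f S - psi k (psi j f) S"
  using psi_psi[of j k f S] by (simp add: algebra_simps)

lemma psi_wrong_parity: "k mod 2 \<noteq> p \<Longrightarrow> psi k f = (\<lambda>S. 0)"
  by (simp add: psi_def)

lemma fsum_ge: "a |\<in>| S \<Longrightarrow> a \<le> \<Sum>(fset S)" for a :: nat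
  using member_le_sum[of a "fset S" "\<lambda>x. x"] by simp

lemma fsum_finsert_le: "\<Sum>(fset (finsert a S)) \<le> \<Sum>(fset S) + a" for a :: nat
  by (cases "a |\<in>| S") (auto simp: insert_absorb)

lemma fsum_fminus_le: "\<Sum>(fset (S |-| {|a|})) \<le> \<Sum>(fset S)" for a :: nat
  by (intro sum_mono2) auto

text \<open>Creation looks at a smaller set, annihilation at one enlarged by the mode
  \<open>\<bar>k\<bar>\<close>. The truncation in \<open>vL\<close> depends on the point, so before
  a mode is moved through it, it is replaced by one bound valid at all these points.\<close>

lemma psi_local:
  assumes "\<And>T. \<Sum>(fset T) \<le> \<Sum>(fset S) + nat \<bar>k\<bar> \<Longrightarrow> f T = g T"
  shows "psi k f S = psi k g S"
proof -
  have f: "f (S |-| {|a|}) = g (S |-| {|a|})" for a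
    by (rule assms) (use fsum_fminus_le[of S a] in linarith)
  have g: "f (finsert a S) = g (finsert a S)" if "a \<le> nat \<bar>k\<bar>" for a
    by (rule assms) (use fsum_finsert_le[of a S] that in linarith)
  show ?thesis
    unfolding psi_def create_def annihilate_def using f g[of "nat k"] g[of 0] by auto
qed

lemma psi_cong: "(\<And>T. f T = g T) \<Longrightarrow> psi k f S = psi k g S"
  by (rule psi_local)

lemma psi_create_zero:
  assumes "k < 0" "nat (- k) |\<notin>| S"
  shows "psi k f S = 0"
  using assms by (simp add: psi_def create_def)

lemma psi_create_zero':
  assumes "k < 0" "nat (- k) > \<Sum>(fset S)"
  shows "psi k f S = 0"
  using assms fsum_ge[of "nat (- k)" S] by (intro psi_create_zero) auto

section \<open>Virasoro operators as bilinears in the modes\<close>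

definition h0 :: complex where "h0 = (if p = 0 then 1/16 else 0)"

text \<open>The normally ordered series \<open>\<Sum>i\<ge>1. i/2 psi (n - i) (psi (n + i) f)\<close>, truncated at \<open>S\<close> to the
  terms that can be nonzero there.\<close>

definition vL :: "int \<Rightarrow> fock \<Rightarrow> fock" where
  "vL n f = (\<lambda>S. (\<Sum>i = 1..nat \<bar>n\<bar> + \<Sum>(fset S).
       of_nat i / 2 * psi (n - int i) (psi (n + int i) f) S) + (if n = 0 then h0 * f S else 0))"

text \<open>For larger \<open>i\<close> the outer factor creates a mode \<open>i - n\<close> that
  exceeds the total of \<open>S\<close> and therefore cannot be occupied in
  \<open>S\<close>.\<close>

lemma vL_truncate:
  assumes "B \<ge> nat \<bar>n\<bar> + \<Sum>(fset S)"
  shows "vL n f S = (\<Sum>i = 1..B. of_nat i / 2 * psi (n - int i) (psi (n + int i) f) S)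
     + (if n = 0 then h0 * f S else 0)"
proof -
  have "(\<Sum>i = 1..nat \<bar>n\<bar> + \<Sum>(fset S). of_nat i / 2 * psi (n - int i) (psi (n + int i) f) S)
     = (\<Sum>i = 1..B. of_nat i / 2 * psi (n - int i) (psi (n + int i) f) S)"
  proof (rule sum.mono_neutral_left)
    show "\<forall>i\<in>{1..B} - {1..nat \<bar>n\<bar> + \<Sum>(fset S)}.
        of_nat i / 2 * psi (n - int i) (psi (n + int i) f) S = 0"
    proof
      fix i assume "i \<in> {1..B} - {1..nat \<bar>n\<bar> + \<Sum>(fset S)}"
      then have "i > nat \<bar>n\<bar> + \<Sum>(fset S)" by auto
      then have "psi (n - int i) (psi (n + int i) f) S = 0"
        by (intro psi_create_zero') linarith+
      then show "of_nat i / 2 * psi (n - int i) (psi (n + int i) f) S = 0" by simp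
    qed
  qed (use assms in auto)
  then show ?thesis by (simp add: vL_def)
qed

lemma vL_linear: "vL n (\<lambda>S. c * f S + d * g S) S = c * vL n f S + d * vL n g S"
proof -
  have "psi a (psi b (\<lambda>S. c * f S + d * g S)) S = c * psi a (psi b f) S + d * psi a (psi b g) S" for a b
    using psi_cong[of "psi b (\<lambda>S. c * f S + d * g S)" "\<lambda>S. c * psi b f S + d * psi b g S" a S]
    by (simp add: psi_linear)
  then show ?thesis
    unfolding vL_def by (simp add: sum_distrib_left sum.distrib algebra_simps)
qed

lemma vL_scale: "vL n (\<lambda>S. c * f S) S = c * vL n f S"
  using vL_linear[of n c f 0 f] by simp

lemma vL_zero [simp]: "vL n (\<lambda>S. 0) S = 0"
  using vL_scale[of n 0 "\<lambda>_. 0" S] by simp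

lemma vL_diff: "vL n (\<lambda>S. f S - g S) S = vL n f S - vL n g S"
  using vL_linear[of n 1 f "- 1" g] by simp

text \<open>Passing one odd operator through two others changes the sign twice, so the commutator
  consists of the two contractions alone.\<close>

lemma psi_psi_psi:
  "psi a (psi b (psi s f)) S - psi s (psi a (psi b f)) S
    = anti b s * psi a f S - anti a s * psi b f S"
proof -
  have "psi a (psi b (psi s f)) S = psi a (\<lambda>S. anti b s * f S - psi s (psi b f) S) S"
    by (rule psi_cong) (rule psi_anticomm)
  also have "\<dots> = anti b s * psi a f S - psi a (psi s (psi b f)) S"
    by (simp add: psi_diff psi_scale)
  also have "psi a (psi s (psi b f)) S = anti a s * psi b f S - psi s (psi a (psi b f)) S"
    by (rule psi_anticomm)
  finally show ?thesis by simp
qed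

text \<open>The modes form a primary field of weight 1/2; with \<open>r = s / 2\<close> the
  multiplier is the usual \<open>- (r + n / 2)\<close>. Only the contracted indices
  \<open>i = - n - s\<close> and \<open>i = n + s\<close> contribute. At most one of them is
  positive, and both lead to the same value.\<close>

lemma vL_psi: "vL n (psi s f) S = psi s (vL n f) S - of_int (s + n) / 2 * psi (s + 2 * n) f S"
proof (cases "s mod 2 = p")
  case False
  then have "psi s g = (\<lambda>S. 0)" "psi (s + 2 * n) g = (\<lambda>S. 0)" for g
    by (auto intro!: psi_wrong_parity)
  then show ?thesis by simp
next
  case True
  have A: "anti a s = (if a + s = 0 then 1 else 0)" for a using True by (simp add: anti_def)
  \<comment> \<open>Large enough at \<open>S\<close> and at every point that \<open>psi s\<close>
    looks at from \<open>S\<close>, and at least \<open>\<bar>n + s\<bar>\<close>, so that the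
    contracted index is in range.\<close>
  define B where "B = nat \<bar>n\<bar> + \<Sum>(fset S) + nat \<bar>s\<bar>"
  let ?Q = "\<lambda>i f. psi (n - int i) (psi (n + int i) f)"
  have 1: "vL n (psi s f) S = (\<Sum>i = 1..B. of_nat i / 2 * ?Q i (psi s f) S)
      + (if n = 0 then h0 * psi s f S else 0)"
    by (rule vL_truncate) (simp add: B_def)
  have "psi s (vL n f) S = psi s (\<lambda>S. 1 * (\<Sum>i = 1..B. of_nat i / 2 * ?Q i f S)
      + (if n = 0 then h0 else 0) * f S) S"
  proof (rule psi_local)
    fix T assume "\<Sum>(fset T) \<le> \<Sum>(fset S) + nat \<bar>s\<bar>"
    then show "vL n f T = 1 * (\<Sum>i = 1..B. of_nat i / 2 * ?Q i f T) + (if n = 0 then h0 else 0) * f T"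
      by (subst vL_truncate[of n T B]) (auto simp: B_def)
  qed
  also have "\<dots> = (\<Sum>i = 1..B. of_nat i / 2 * psi s (?Q i f) S) + (if n = 0 then h0 else 0) * psi s f S"
    by (subst psi_linear, subst psi_sum) simp
  finally have 2: "psi s (vL n f) S
     = (\<Sum>i = 1..B. of_nat i / 2 * psi s (?Q i f) S) + (if n = 0 then h0 else 0) * psi s f S" .
  have "vL n (psi s f) S - psi s (vL n f) S
     = (\<Sum>i = 1..B. of_nat i / 2 * (?Q i (psi s f) S - psi s (?Q i f) S))"
    unfolding 1 2 by (simp add: sum_subtractf right_diff_distrib)
  also have "\<dots> = (\<Sum>i = 1..B. of_nat i / 2 * anti (n + int i) s * psi (n - int i) f S)
      - (\<Sum>i = 1..B. of_nat i / 2 * anti (n - int i) s * psi (n + int i) f S)"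
    by (simp add: psi_psi_psi sum_subtractf right_diff_distrib mult.assoc)
  also have "(\<Sum>i = 1..B. of_nat i / 2 * anti (n + int i) s * psi (n - int i) f S)
      = (\<Sum>i = 1..B. if i = nat (- n - s) then of_int (- n - s) / 2 * psi (s + 2 * n) f S else 0)"
  proof (rule sum.cong[OF refl])
    fix i assume i: "i \<in> {1..B}"
    show "of_nat i / 2 * anti (n + int i) s * psi (n - int i) f S
       = (if i = nat (- n - s) then of_int (- n - s) / 2 * psi (s + 2 * n) f S else 0)"
    proof (cases "n + int i + s = 0")
      case True
      then have e: "int i = - n - s" by simp
      then have f: "i = nat (- n - s)" "n - int i = s + 2 * n" by auto
      have g: "(of_nat i :: complex) = of_int (- n - s)"
        using of_int_of_nat_eq[of i, where 'a = complex] unfolding e by (rule sym)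
      have "anti (n + int i) s = 1" using A[of "n + int i"] True by simp
      then show ?thesis unfolding if_P[OF f(1)] f(2) g by simp
    next
      case False
      moreover have "i \<ge> 1" using i by simp
      ultimately have "i \<noteq> nat (- n - s)" by linarith
      then show ?thesis using A[of "n + int i"] \<open>n + int i + s \<noteq> 0\<close> by simp
    qed
  qed
  also have "\<dots> = (if n + s < 0 then of_int (- n - s) / 2 * psi (s + 2 * n) f S else 0)"
    by (subst sum.delta) (auto simp: B_def)
  also have "(\<Sum>i = 1..B. of_nat i / 2 * anti (n - int i) s * psi (n + int i) f S)
      = (\<Sum>i = 1..B. if i = nat (n + s) then of_int (n + s) / 2 * psi (s + 2 * n) f S else 0)"
  proof (rule sum.cong[OF refl])
    fix i assume i: "i \<in> {1..B}"
    show "of_nat i / 2 * anti (n - int i) s * psi (n + int i) f S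
       = (if i = nat (n + s) then of_int (n + s) / 2 * psi (s + 2 * n) f S else 0)"
    proof (cases "n - int i + s = 0")
      case True
      then have e: "int i = n + s" by simp
      then have f: "i = nat (n + s)" "n + int i = s + 2 * n" by auto
      have g: "(of_nat i :: complex) = of_int (n + s)"
        using of_int_of_nat_eq[of i, where 'a = complex] unfolding e by (rule sym)
      have "anti (n - int i) s = 1" using A[of "n - int i"] True by simp
      then show ?thesis unfolding if_P[OF f(1)] f(2) g by simp
    next
      case False
      moreover have "i \<ge> 1" using i by simp
      ultimately have "i \<noteq> nat (n + s)" by linarith
      then show ?thesis using A[of "n - int i"] \<open>n - int i + s \<noteq> 0\<close> by simp
    qed
  qed
  also have "\<dots> = (if n + s > 0 then of_int (n + s) / 2 * psi (s + 2 * n) f S else 0)"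
    by (subst sum.delta) (auto simp: B_def)
  finally have D: "vL n (psi s f) S - psi s (vL n f) S
     = (if n + s < 0 then of_int (- n - s) / 2 * psi (s + 2 * n) f S else 0)
      - (if n + s > 0 then of_int (n + s) / 2 * psi (s + 2 * n) f S else 0)" .
  have e: "of_int (- n - s) = - (of_int (s + n) :: complex)" "n + s = s + n" by simp_all
  have "vL n (psi s f) S - psi s (vL n f) S = - (of_int (s + n) / 2 * psi (s + 2 * n) f S)"
  proof (cases "n + s = 0")
    case True
    then have "of_int (s + n) = (0 :: complex)" by (simp add: add.commute)
    then show ?thesis unfolding D using True by simp
  next
    case False
    then show ?thesis unfolding D e by (cases "s + n < 0") (simp_all del: of_int_add)
  qed
  then show ?thesis by (simp add: algebra_simps)
qed

end

section \<open>The Virasoro action\<close>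

text \<open>Only finite combinations are respected, while \<open>fock\<close> contains functions of
  infinite support. Values on the vectors \<open>ket S\<close> therefore determine such an operator
  only on finitely supported functions, which is where they are used later.\<close>

definition lin_op :: "(fock \<Rightarrow> fock) \<Rightarrow> bool" where
  "lin_op X \<longleftrightarrow> (\<forall>c d f g S. X (\<lambda>T. c * f T + d * g T) S = c * X f S + d * X g S)"

lemma lin_opD: "lin_op X \<Longrightarrow> X (\<lambda>T. c * f T + d * g T) S = c * X f S + d * X g S"
  unfolding lin_op_def by blast

lemma lin_op_zero: "lin_op X \<Longrightarrow> X (\<lambda>T. 0) S = 0"
  using lin_opD[of X 0 "\<lambda>_. 0" 0 "\<lambda>_. 0" S] by simp

lemma lin_op_scale: "lin_op X \<Longrightarrow> X (\<lambda>T. c * f T) S = c * X f S"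
  using lin_opD[of X c f 0 f S] by simp

lemma lin_op_add: "lin_op X \<Longrightarrow> X (\<lambda>T. f T + g T) S = X f S + X g S"
  using lin_opD[of X 1 f 1 g S] by simp

lemma lin_op_sum:
  assumes "lin_op X"
  shows "X (\<lambda>T. \<Sum>i\<in>A. c i * f i T) S = (\<Sum>i\<in>A. c i * X (f i) S)"
proof (induction A rule: infinite_finite_induct)
  case (insert a A)
  have "X (\<lambda>T. \<Sum>i\<in>insert a A. c i * f i T) S
      = X (\<lambda>T. c a * f a T + 1 * (\<Sum>i\<in>A. c i * f i T)) S"
    using insert by simp
  also have "\<dots> = c a * X (f a) S + 1 * X (\<lambda>T. \<Sum>i\<in>A. c i * f i T) S"
    by (rule lin_opD[OF assms])
  finally show ?case using insert by simp
qed (auto simp: lin_op_zero[OF assms])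

lemma lin_op_comp: "lin_op X \<Longrightarrow> lin_op Y \<Longrightarrow> lin_op (\<lambda>f. X (Y f))"
proof (unfold lin_op_def, intro allI)
  fix c d f g S
  assume X: "\<forall>c d f g S. X (\<lambda>T. c * f T + d * g T) S = c * X f S + d * X g S"
    and Y: "\<forall>c d f g S. Y (\<lambda>T. c * f T + d * g T) S = c * Y f S + d * Y g S"
  have "Y (\<lambda>T. c * f T + d * g T) = (\<lambda>T. c * Y f T + d * Y g T)" using Y by auto
  then show "X (Y (\<lambda>T. c * f T + d * g T)) S = c * X (Y f) S + d * X (Y g) S"
    using X by simp
qed

definition ket :: "nat fset \<Rightarrow> fock" where
  "ket S = (\<lambda>T. if T = S then 1 else 0)"

lemma create_ket: "a |\<notin>| S \<Longrightarrow> create a (ket S) = (\<lambda>T. fsign a S * ket (finsert a S) T)"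
proof
  fix T assume a: "a |\<notin>| S"
  show "create a (ket S) T = fsign a S * ket (finsert a S) T"
  proof (cases "T = finsert a S")
    case True
    then show ?thesis using a by (auto simp: create_def ket_def fsign_finsert)
  next
    case False
    then have "T |-| {|a|} \<noteq> S" if "a |\<in>| T" using that by auto
    then show ?thesis using False by (auto simp: create_def ket_def)
  qed
qed

lemma annihilate_ket: "a |\<notin>| S \<Longrightarrow> annihilate a (ket S) = (\<lambda>T. 0)"
  by (auto simp: annihilate_def ket_def)

context fermion
begin

definition allowed :: "nat fset \<Rightarrow> bool" where
  "allowed S \<longleftrightarrow> (\<forall>s. s |\<in>| S \<longrightarrow> int s mod 2 = p)"

text \<open>Ground states. Besides the empty set the Ramond case contains \<open>{|0|}\<close>,
  since the zero mode costs no energy.\<close>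

definition bottom :: "nat fset \<Rightarrow> bool" where
  "bottom S \<longleftrightarrow> allowed S \<and> fset S \<subseteq> {0}"

lemma allowed_fminus: "allowed S \<Longrightarrow> allowed (S |-| {|a|})"
  by (auto simp: allowed_def)

lemma allowed_fminusD: "allowed (S |-| {|a|}) \<Longrightarrow> int a mod 2 = p \<Longrightarrow> allowed S"
  by (auto simp: allowed_def)

lemma allowed_finsert [simp]: "allowed (finsert a S) \<longleftrightarrow> int a mod 2 = p \<and> allowed S"
  by (auto simp: allowed_def)

lemma lin_op_psi: "lin_op (psi k)"
  by (simp add: lin_op_def psi_linear)

lemma lin_op_vL: "lin_op (vL n)"
  by (simp add: lin_op_def vL_linear)

lemma psi_bottom_left: "bottom T \<Longrightarrow> k < 0 \<Longrightarrow> psi k f T = 0"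
  by (rule psi_create_zero) (auto simp: bottom_def)

lemma psi_bottom_right: "bottom S \<Longrightarrow> k > 0 \<Longrightarrow> psi k (ket S) = (\<lambda>T. 0)"
proof -
  assume S: "bottom S" and k: "k > 0"
  have "nat k |\<notin>| S" using S k by (auto simp: bottom_def)
  then show ?thesis using k by (simp add: psi_def annihilate_ket)
qed

lemma vL_bottom_left: "bottom T \<Longrightarrow> n \<le> 0 \<Longrightarrow> vL n f T = (if n = 0 then h0 * f T else 0)"
proof -
  assume T: "bottom T" and n: "n \<le> 0"
  have "psi (n - int i) (psi (n + int i) f) T = 0" if "i \<ge> 1" for i
    using that n by (intro psi_bottom_left[OF T]) auto
  then show ?thesis by (simp add: vL_def)
qed

lemma vL_bottom_right:
  "bottom S \<Longrightarrow> n \<ge> 0 \<Longrightarrow> vL n (ket S) = (\<lambda>T. if n = 0 then h0 * ket S T else 0)"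
proof
  fix T assume S: "bottom S" and n: "n \<ge> 0"
  have "psi (n - int i) (psi (n + int i) (ket S)) T = 0" if "i \<ge> 1" for i
    using psi_bottom_right[OF S, of "n + int i"] that n by simp
  then show "vL n (ket S) T = (if n = 0 then h0 * ket S T else 0)" by (simp add: vL_def)
qed

text \<open>An operator that commutes or anticommutes with all modes is determined by its matrix
  elements between vectors without excitations of positive energy.\<close>

lemma intertwiner_zero:
  assumes lin: "lin_op X"
    and comm: "\<And>t f S. X (psi t f) S = \<sigma> * psi t (X f) S" and \<sigma>: "\<sigma> \<noteq> 0"
    and base: "\<And>S T. bottom S \<Longrightarrow> bottom T \<Longrightarrow> X (ket S) T = 0"
    and "allowed S" "allowed T"
  shows "X (ket S) T = 0"
proof -
  \<comment> \<open>A positive mode \<open>t\<close> of \<open>T\<close> is read off by the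
    annihilator \<open>psi t\<close>; moved through \<open>X\<close>, it meets the ground state
    \<open>ket S\<close> and gives zero.\<close>
  have A: "X (ket S) T = 0" if b: "bottom S" and T: "allowed T" for S T
  proof (cases "bottom T")
    case True
    then show ?thesis using base b by blast
  next
    case False
    then obtain t where t: "t |\<in>| T" "t > 0" using T by (auto simp: bottom_def)
    let ?T = "T |-| {|t|}"
    have "finsert t ?T = T" using t by auto
    moreover have "int t mod 2 = p" using T t by (simp add: allowed_def)
    ultimately have "psi (int t) (X (ket S)) ?T = fsign t ?T * X (ket S) T"
      using t by (simp add: psi_def annihilate_def)
    moreover have "\<sigma> * psi (int t) (X (ket S)) ?T = 0"
      using comm[of "int t" "ket S" ?T] psi_bottom_right[OF b, of "int t"] t
      by (simp add: lin_op_zero[OF lin])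
    ultimately show ?thesis using \<sigma> by (auto simp: fsign_def)
  qed
  show ?thesis using assms(5,6)
  proof (induction "fcard S" arbitrary: S T rule: less_induct)
    case less
    show ?case
    proof (cases "bottom S")
      case True
      then show ?thesis using A less.prems by blast
    next
      case False
      then obtain s where s: "s |\<in>| S" "s > 0" using less.prems by (auto simp: bottom_def)
      let ?S = "S |-| {|s|}"
      have S: "finsert s ?S = S" "s |\<notin>| ?S" using s by auto
      have sp: "int s mod 2 = p" using less.prems s by (simp add: allowed_def)
      then have sp': "(- int s) mod 2 = p" using p by presburger
      \<comment> \<open>A positive mode of \<open>S\<close> is created from the smaller state. Moved
        through \<open>X\<close>, the creator either removes \<open>s\<close> from \<open>T\<close>,
        where the induction hypothesis applies, or gives zero.\<close>
      have "psi (- int s) (ket ?S) = (\<lambda>T. fsign s ?S * ket S T)"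
        using create_ket[OF S(2)] S(1) s sp' by (simp add: psi_def)
      then have "fsign s ?S * X (ket S) T = \<sigma> * psi (- int s) (X (ket ?S)) T"
        using comm[of "- int s" "ket ?S" T] by (simp add: lin_op_scale[OF lin])
      moreover have "X (ket ?S) (T |-| {|s|}) = 0"
        using less fcard_fminus1_less[OF s(1)] allowed_fminus by simp
      then have "psi (- int s) (X (ket ?S)) T = 0"
        using s sp' by (simp add: psi_def create_def)
      ultimately show ?thesis by (auto simp: fsign_def)
    qed
  qed
qed

text \<open>As \<open>a + b\<close> is nonzero the two factors anticommute. A positive index can be
  moved to the right, where it kills \<open>ket S\<close>, a negative one to the left, where it
  vanishes at \<open>T\<close>.\<close>

lemma psi_psi_bottom:
  assumes S: "bottom S" and T: "bottom T" and ab: "a + b \<noteq> 0"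
  shows "psi a (psi b (ket S)) T = 0"
proof -
  have z: "psi k (\<lambda>T. 0) T = 0" for k by simp
  have *: "psi a (psi b (ket S)) T = - psi b (psi a (ket S)) T"
    using psi_anticomm[of a b "ket S" T] ab by (simp add: anti_def)
  consider "a < 0" | "b > 0" | "a > 0" | "b < 0" using ab by linarith
  then show ?thesis
    using psi_bottom_left[OF T] psi_bottom_right[OF S] * z by cases auto
qed

lemma vL_psi_psi:
  "vL n (psi a (psi b f)) S = psi a (psi b (vL n f)) S
    - of_int (a + n) / 2 * psi (a + 2 * n) (psi b f) S
    - of_int (b + n) / 2 * psi a (psi (b + 2 * n) f) S"
proof -
  have "vL n (psi b f) = (\<lambda>S. psi b (vL n f) S - of_int (b + n) / 2 * psi (b + 2 * n) f S)"
    by (rule ext) (rule vL_psi)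
  then have "psi a (vL n (psi b f)) S = psi a (psi b (vL n f)) S
      - of_int (b + n) / 2 * psi a (psi (b + 2 * n) f) S"
    by (simp only: psi_diff psi_scale)
  then show ?thesis
    unfolding vL_psi[of n a "psi b f"] by simp
qed

lemma vL_vL_psi:
  "vL m (vL n (psi s f)) S = psi s (vL m (vL n f)) S
     - of_int (s + m) / 2 * psi (s + 2 * m) (vL n f) S
     - of_int (s + n) / 2 * psi (s + 2 * n) (vL m f) S
     + of_int (s + n) * of_int (s + 2 * n + m) / 4 * psi (s + 2 * n + 2 * m) f S"
proof -
  have "vL n (psi s f) = (\<lambda>S. psi s (vL n f) S - of_int (s + n) / 2 * psi (s + 2 * n) f S)"
    by (rule ext) (rule vL_psi)
  then have E: "vL m (vL n (psi s f)) S
      = vL m (psi s (vL n f)) S - of_int (s + n) / 2 * vL m (psi (s + 2 * n) f) S"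
    by (simp only: vL_diff vL_scale)
  show ?thesis
    unfolding E vL_psi by (simp add: field_simps)
qed

section \<open>The Virasoro relation at central charge 1/2\<close>

definition vir_defect :: "int \<Rightarrow> int \<Rightarrow> fock \<Rightarrow> fock" where
  "vir_defect m n f = (\<lambda>S. vL m (vL n f) S - vL n (vL m f) S
     - (of_int (m - n) * vL (m + n) f S + (if m = - n then of_int (m ^ 3 - m) / 24 else 0) * f S))"

lemma lin_op_vir_defect: "lin_op (vir_defect m n)"
proof -
  have "lin_op (\<lambda>f S. X f S - Y f S - (a * Z f S + b * f S))"
    if "lin_op X" "lin_op Y" "lin_op Z" for X Y Z a b
    using that by (simp add: lin_op_def algebra_simps)
  then show ?thesis
    unfolding vir_defect_def by (simp add: lin_op_comp lin_op_vL)
qed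

text \<open>Both sides of the Virasoro relation act on the modes by the same derivation. The terms
  with one factor \<open>vL\<close> cancel by antisymmetry in \<open>m\<close> and \<open>n\<close>;
  the remaining coefficients agree by a quadratic identity in \<open>s\<close>. The central term
  commutes with everything.\<close>

lemma vir_defect_psi: "vir_defect m n (psi s f) S = psi s (vir_defect m n f) S"
proof -
  have P: "psi s (vir_defect m n f) S = psi s (vL m (vL n f)) S - psi s (vL n (vL m f)) S
     - (of_int (m - n) * psi s (vL (m + n) f) S
        + (if m = - n then of_int (m ^ 3 - m) / 24 else 0) * psi s f S)"
    unfolding vir_defect_def by (simp only: psi_diff psi_linear)
  have e: "s + 2 * n + 2 * m = s + 2 * (m + n)" "s + 2 * m + 2 * n = s + 2 * (m + n)" by simp_all
  have "(of_int (s + n) * of_int (s + 2 * n + m) - of_int (s + m) * of_int (s + 2 * m + n)) / 4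
      = - (of_int (m - n) * (of_int (s + (m + n)) / 2 :: complex))"
    by (simp add: field_simps)
  then have "of_int (s + n) * of_int (s + 2 * n + m) / 4 * y
        - of_int (s + m) * of_int (s + 2 * m + n) / 4 * y
      = - (of_int (m - n) * (of_int (s + (m + n)) / 2 * y))" for y :: complex
    by (simp only: flip: left_diff_distrib diff_divide_distrib) simp
  from this[of "psi (s + 2 * (m + n)) f S"] show ?thesis
    unfolding P unfolding vir_defect_def vL_vL_psi vL_psi[of "m + n"] e
    by (simp only: right_diff_distrib) (simp only: algebra_simps add_minus_cancel)
qed

text \<open>These squares are the coefficients left over when \<open>vL N\<close> is commuted
  through the bilinear terms of \<open>vL (- N)\<close> on a ground state. The parity condition
  makes an induction in steps of two natural.\<close>

lemma gap_sum:
  "(\<Sum>i = 1..<N. if (int N - int i) mod 2 = p then (of_nat i)\<^sup>2 else 0 :: complex)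
    = (if p = 1 then of_nat N * (of_nat N - 1) * (of_nat N + 1) / 6
       else of_nat N * (of_nat N - 1) * (of_nat N - 2) / 6)"
proof (induction N rule: nat_less_induct)
  case (1 N)
  show ?case
  proof (cases "N < 2")
    case True
    then consider "N = 0" | "N = 1" by linarith
    then show ?thesis by cases auto
  next
    case False
    then obtain M where N: "N = Suc (Suc M)" by (metis add_2_eq_Suc le_Suc_ex not_less)
    have par: "(int N - int i) mod 2 = p \<longleftrightarrow> (int M - int i) mod 2 = p" for i
      unfolding N by presburger
    have "(\<Sum>i = 1..<N. if (int N - int i) mod 2 = p then (of_nat i)\<^sup>2 else 0 :: complex)
      = (\<Sum>i = 1..<M. if (int M - int i) mod 2 = p then (of_nat i)\<^sup>2 else 0)
        + (if M = 0 then 0 else if p = 0 then (of_nat M)\<^sup>2 else 0)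
        + (if p = 1 then (of_nat (Suc M))\<^sup>2 else 0)"
      unfolding par unfolding N
      using p by (cases "M = 0") auto
    also have "(\<Sum>i = 1..<M. if (int M - int i) mod 2 = p then (of_nat i)\<^sup>2 else 0 :: complex)
      = (if p = 1 then of_nat M * (of_nat M - 1) * (of_nat M + 1) / 6
         else of_nat M * (of_nat M - 1) * (of_nat M - 2) / 6)"
      using 1 N by simp
    finally show ?thesis
      unfolding N using p by (auto simp: field_simps power2_eq_square)
  qed
qed

text \<open>For \<open>i > - n\<close> the inner factor annihilates the ground state. The sum no
  longer depends on the point \<open>T\<close>, so linear operators can be moved into it.\<close>

lemma vL_lower_bottom:
  assumes "bottom S" "n < 0"
  shows "vL n (ket S) = (\<lambda>T. \<Sum>i = 1..nat (- n). of_nat i / 2 * psi (n - int i) (psi (n + int i) (ket S)) T)"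
proof
  fix T
  have "(\<Sum>i = 1..nat (- n). of_nat i / 2 * psi (n - int i) (psi (n + int i) (ket S)) T)
      = (\<Sum>i = 1..nat \<bar>n\<bar> + \<Sum>(fset T). of_nat i / 2 * psi (n - int i) (psi (n + int i) (ket S)) T)"
  proof (rule sum.mono_neutral_left)
    show "\<forall>i\<in>{1..nat \<bar>n\<bar> + \<Sum>(fset T)} - {1..nat (- n)}.
        of_nat i / 2 * psi (n - int i) (psi (n + int i) (ket S)) T = 0"
    proof
      fix i assume "i \<in> {1..nat \<bar>n\<bar> + \<Sum>(fset T)} - {1..nat (- n)}"
      then have "n + int i > 0" by auto
      then show "of_nat i / 2 * psi (n - int i) (psi (n + int i) (ket S)) T = 0"
        using psi_bottom_right[OF assms(1)] by simp
    qed
  qed (use assms in auto)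
  then show "vL n (ket S) T
      = (\<Sum>i = 1..nat (- n). of_nat i / 2 * psi (n - int i) (psi (n + int i) (ket S)) T)"
    using assms by (simp add: vL_def)
qed

text \<open>Source of the central charge and of \<open>h0\<close>. Commuting \<open>vL m\<close>
  inward leaves \<open>i^2 / 4\<close> times a pair of modes with indices \<open>m - i\<close> and
  \<open>i - m\<close>. Each admissible pair with \<open>i < m\<close> has the value 1, while
  \<open>i = m\<close> gives the square 1/2 of the Ramond zero mode. For \<open>p = 0\<close> the
  total exceeds \<open>(m^3 - m) / 24\<close> by \<open>m / 8\<close>, which is
  \<open>2 * m * h0\<close> with \<open>h0 = 1/16\<close>.\<close>

lemma vL_vL_bottom:
  assumes S: "bottom S" and T: "bottom T" and "m > 0" "n < 0"
  shows "vL m (vL n (ket S)) T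
    = (if m = - n then (of_int (2 * m) * h0 + of_int (m ^ 3 - m) / 24) * ket S T else 0)"
proof -
  have tm: "vL m (psi (n - int i) (psi (n + int i) (ket S))) T
     = (if m = - n then of_nat i / 2 * psi (m - int i) (psi (int i - m) (ket S)) T else 0)"
    if i: "i \<ge> 1" "i \<le> nat (- n)" for i
  proof -
    have "psi (n - int i) f T = 0" for f
      using that assms by (intro psi_bottom_left[OF T]) auto
    moreover have "psi (n - int i + 2 * m) (psi (n + int i) (ket S)) T = 0" if "m \<noteq> - n"
      by (rule psi_psi_bottom[OF S T]) (use that in auto)
    ultimately show ?thesis
      by (simp add: vL_psi_psi algebra_simps)
  qed
  have "vL m (vL n (ket S)) T
     = (\<Sum>i = 1..nat (- n). of_nat i / 2 * vL m (psi (n - int i) (psi (n + int i) (ket S))) T)"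
    unfolding vL_lower_bottom[OF S assms(4)] by (rule lin_op_sum[OF lin_op_vL])
  also have "\<dots> = (\<Sum>i = 1..nat (- n). of_nat i / 2 *
      (if m = - n then of_nat i / 2 * psi (m - int i) (psi (int i - m) (ket S)) T else 0))"
    by (intro sum.cong refl) (use tm in auto)
  finally have E: "vL m (vL n (ket S)) T = (\<Sum>i = 1..nat (- n). of_nat i / 2 *
      (if m = - n then of_nat i / 2 * psi (m - int i) (psi (int i - m) (ket S)) T else 0))" .
  show ?thesis
  proof (cases "m = - n")
    case False
    then show ?thesis unfolding E by simp
  next
    case True
    define N where "N = nat m"
    have N: "m = int N" "N \<ge> 1" using assms by (auto simp: N_def)
    have v: "psi (m - int i) (psi (int i - m) (ket S)) T = (if (int N - int i) mod 2 = p then ket S T else 0)"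
      if "1 \<le> i" "i < N" for i
    proof -
      have "psi (int i - m) (psi (m - int i) (ket S)) T = 0"
        using that N by (intro psi_bottom_left[OF T]) auto
      then show ?thesis
        using psi_psi[of "m - int i" "int i - m" "ket S" T] N p
        by (auto simp: anti_def)
    qed
    have v0: "psi 0 (psi 0 (ket S)) T = (if p = 0 then ket S T / 2 else 0)"
      using psi_psi[of 0 0 "ket S" T] by (auto simp: anti_def field_simps)
    have "vL m (vL n (ket S)) T
       = (\<Sum>i = 1..N. (of_nat i)\<^sup>2 / 4 * psi (m - int i) (psi (int i - m) (ket S)) T)"
      unfolding E N_def using True by (simp add: power2_eq_square mult.assoc)
    also have "{1..N} = insert N {1..<N}" using N by auto
    also have "(\<Sum>i\<in>insert N {1..<N}. (of_nat i)\<^sup>2 / 4 * psi (m - int i) (psi (int i - m) (ket S)) T)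
       = (of_nat N)\<^sup>2 / 4 * (if p = 0 then ket S T / 2 else 0)
         + (\<Sum>i = 1..<N. (of_nat i)\<^sup>2 / 4 * psi (m - int i) (psi (int i - m) (ket S)) T)"
      using N v0 by simp
    also have "(\<Sum>i = 1..<N. (of_nat i)\<^sup>2 / 4 * psi (m - int i) (psi (int i - m) (ket S)) T)
       = (\<Sum>i = 1..<N. if (int N - int i) mod 2 = p then (of_nat i)\<^sup>2 else 0) * (ket S T / 4)"
      unfolding sum_distrib_right by (intro sum.cong refl) (use v in auto)
    finally have F: "vL m (vL n (ket S)) T = (of_nat N)\<^sup>2 / 4 * (if p = 0 then ket S T / 2 else 0)
       + (\<Sum>i = 1..<N. if (int N - int i) mod 2 = p then (of_nat i)\<^sup>2 else 0) * (ket S T / 4)" .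
    have mN: "of_int m = (of_nat N :: complex)" using N(1) by simp
    show ?thesis
      unfolding F gap_sum if_P[OF True] h0_def of_int_mult of_int_diff of_int_power mN using p
      by (elim disjE) (simp_all add: field_simps power2_eq_square power3_eq_cube)
  qed
qed

text \<open>Two nonnegative indices are evaluated on the ground state to the right, two nonpositive
  ones at the ground state to the left. Only indices of opposite sign need the computation of
  \<open>vL_vL_bottom\<close>, and antisymmetry fixes which one is positive.\<close>

lemma vir_defect_bottom:
  assumes S: "bottom S" and T: "bottom T"
  shows "vir_defect m n (ket S) T = 0"
proof -
  have anti: "vir_defect m n (ket S) T = - vir_defect n m (ket S) T"
    unfolding vir_defect_def
    by (auto simp: add.commute[of n m] field_simps)
  have *: "vir_defect m n (ket S) T = 0" if "m \<ge> n" for m n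
  proof -
    consider "n \<ge> 0" | "m \<le> 0" | "m > 0" "n < 0" by linarith
    then show ?thesis
    proof cases
      case 1
      then show ?thesis using that
        unfolding vir_defect_def
        by (cases "n = 0"; cases "m = 0")
          (auto simp: vL_bottom_right[OF S] lin_op_scale[OF lin_op_vL])
    next
      case 2
      then show ?thesis using that
        unfolding vir_defect_def
        by (simp add: vL_bottom_left[OF T] lin_op_scale[OF lin_op_vL])
    next
      case 3
      have "vL n (vL m (ket S)) T = 0" using vL_bottom_right[OF S, of m] 3 by simp
      moreover have "vL (m + n) (ket S) T = (if m = - n then h0 * ket S T else 0)"
        using vL_bottom_left[OF T, of "m + n"] vL_bottom_right[OF S, of "m + n"]
        by (cases "m + n \<le> 0") auto
      ultimately show ?thesis
        unfolding vir_defect_def vL_vL_bottom[OF S T 3] by (auto simp: algebra_simps)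
    qed
  qed
  show ?thesis using * anti by (cases "m \<ge> n") auto
qed

lemma vir_defect_ket: "allowed S \<Longrightarrow> allowed T \<Longrightarrow> vir_defect m n (ket S) T = 0"
  by (rule intertwiner_zero[where \<sigma> = 1])
     (simp_all add: lin_op_vir_defect vir_defect_psi vir_defect_bottom)

end

section \<open>Finite sums behind the commutator with the weight-4 operator\<close>

lemma sum_even_steps:
  fixes h :: "nat \<Rightarrow> complex"
  assumes "\<And>i. odd i \<Longrightarrow> h i = 0"
  shows "(\<Sum>i = 1..2 * J. h i) = (\<Sum>j = 1..J. h (2 * j))"
  using assms by (induction J) auto

text \<open>The points \<open>2 * j - m\<close> are the integers of the parity of \<open>m\<close>
  between \<open>- m\<close> and \<open>m\<close>; the hypothesis removes all others from the
  right-hand side.\<close>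

lemma sum_symmetric_steps:
  fixes g :: "int \<Rightarrow> complex"
  assumes "\<And>i. i mod 2 \<noteq> int m mod 2 \<Longrightarrow> g i = 0"
  shows "(\<Sum>j\<le>m. g (2 * int j - int m)) = g 0 + (\<Sum>i = 1..m. g (int i) + g (- int i))"
  using assms
proof (induction m rule: nat_less_induct)
  case (1 m)
  show ?case
  proof (cases "m < 2")
    case True
    then consider "m = 0" | "m = 1" by linarith
    then show ?thesis using 1(2)[of 0] by cases auto
  next
    case False
    then obtain k where m: "m = Suc (Suc k)" by (metis add_2_eq_Suc le_Suc_ex not_less)
    have IH: "(\<Sum>j\<le>k. g (2 * int j - int k)) = g 0 + (\<Sum>i = 1..k. g (int i) + g (- int i))"
    proof -
      have "int m mod 2 = int k mod 2" unfolding m by presburger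
      then show ?thesis using 1 m by simp
    qed
    have "(\<Sum>j\<le>m. g (2 * int j - int m)) = g (- int m) + (\<Sum>j\<le>Suc k. g (2 * int (Suc j) - int m))"
      unfolding m by (subst sum.atMost_Suc_shift) simp
    also have "(\<Sum>j\<le>Suc k. g (2 * int (Suc j) - int m)) = (\<Sum>j\<le>k. g (2 * int j - int k)) + g (int m)"
      unfolding m by (simp add: algebra_simps)
    also have "g (1 + int k) = 0" "g (- 1 - int k) = 0"
      by (rule 1(2), unfold m, presburger)+
    ultimately show ?thesis
      unfolding IH unfolding m by (simp add: algebra_simps)
  qed
qed

lemma sum_parity_nat:
  "(\<Sum>i = 1..d. if int i mod 2 = int d mod 2 then of_nat i else 0 :: complex)
    = (if odd d then (of_nat d + 1)\<^sup>2 / 4 else of_nat d * (of_nat d + 2) / 4)"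
proof (induction d rule: nat_less_induct)
  case (1 d)
  show ?case
  proof (cases "d < 2")
    case True
    then consider "d = 0" | "d = 1" by linarith
    then show ?thesis by cases auto
  next
    case False
    then obtain k where d: "d = Suc (Suc k)" by (metis add_2_eq_Suc le_Suc_ex not_less)
    have "(\<Sum>i = 1..d. if int i mod 2 = int d mod 2 then of_nat i else 0 :: complex)
       = (\<Sum>i = 1..k. if int i mod 2 = int k mod 2 then of_nat i else 0) + of_nat d"
    proof -
      have "int i mod 2 = int d mod 2 \<longleftrightarrow> int i mod 2 = int k mod 2" for i unfolding d by presburger
      moreover have "int (Suc k) mod 2 \<noteq> int k mod 2" by presburger
      moreover have "int d mod 2 = int k mod 2" unfolding d by presburger
      ultimately show ?thesis unfolding d by simp
    qed
    then show ?thesis using 1 unfolding d by (simp add: field_simps power2_eq_square)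
  qed
qed

lemma sum_squares_reflected: "(\<Sum>j\<le>d. (of_nat d - of_nat j)\<^sup>2 :: complex) = of_nat d * (of_nat d + 1) * (2 * of_nat d + 1) / 6"
proof -
  have "(\<Sum>j\<le>d. (of_nat d - of_nat j)\<^sup>2 :: complex) = (\<Sum>j\<le>d. (of_nat j)\<^sup>2)"
    by (rule sum.reindex_bij_witness[of _ "\<lambda>j. d - j" "\<lambda>j. d - j"]) (auto simp: of_nat_diff)
  also have "\<dots> = of_nat d * (of_nat d + 1) * (2 * of_nat d + 1) / 6"
    by (induction d) (auto simp: field_simps power2_eq_square)
  finally show ?thesis .
qed

text \<open>Applied to \<open>P i = psi (n - i) (psi (n + i) f) S\<close>, where \<open>sym\<close>
  is the anticommutation relation and the left side collects all products of two modes in the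
  anticommutator of \<open>quartic_comm s\<close> with \<open>psi t\<close>, for
  \<open>s = n + d\<close> and \<open>t = n - d\<close>. Beyond \<open>d\<close> these cancel
  coefficient by coefficient. Between \<open>- d\<close> and \<open>d\<close> they cancel only after
  averaging with the reflection of the index, and the reflection produces the multiple of
  \<open>e\<close>.\<close>

lemma antisymmetric_double_sum:
  fixes P :: "int \<Rightarrow> complex" and n e :: complex and d J :: nat
  assumes sym: "\<And>i. i mod 2 = int d mod 2 \<Longrightarrow> P i + P (- i) = e"
    and zero: "\<And>i. i mod 2 \<noteq> int d mod 2 \<Longrightarrow> P i = 0"
    and van: "\<And>i. i > int J \<Longrightarrow> P i = 0"
  shows "(n\<^sup>2 - (of_nat d)\<^sup>2) / 2 * P (- int d)
     + (\<Sum>j = 1..d + J. (n\<^sup>2 - (of_nat d - of_nat j)\<^sup>2) / 2 * P (2 * int j - int d)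
         - (n\<^sup>2 - (of_nat d + of_nat j)\<^sup>2) / 2 * P (2 * int j + int d))
     - of_nat d * (\<Sum>i = 1..d + 2 * J. of_nat i / 2 * P (int i))
   = e * ((\<Sum>j\<le>d. (n\<^sup>2 - (of_nat d - of_nat j)\<^sup>2) / 4)
       - of_nat d / 4 * (\<Sum>i = 1..d. if int i mod 2 = int d mod 2 then of_nat i else 0))"
proof -
  define D where "D = (of_nat d :: complex)"
  let ?c = "\<lambda>j::nat. (n\<^sup>2 - (D - of_nat j)\<^sup>2) / 2"
  have split: "(\<Sum>i = 1..d + m. h i) = (\<Sum>i = 1..d. h i) + (\<Sum>i = 1..m. h (i + d))"
    for m and h :: "nat \<Rightarrow> complex"
    by (induction m) (auto simp: add_ac)
  have tail: "(\<Sum>j = 1..d + J. (n\<^sup>2 - (D + of_nat j)\<^sup>2) / 2 * P (2 * int j + int d))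
      = (\<Sum>j = 1..J. (n\<^sup>2 - (D + of_nat j)\<^sup>2) / 2 * P (2 * int j + int d))"
    by (rule sum.mono_neutral_right) (auto simp: van)
  \<comment> \<open>Shifting the indices above \<open>d\<close> by \<open>d\<close> turns
    \<open>(D - j)^2\<close> into \<open>j^2\<close> and aligns the arguments with those of the
    subtracted sum.\<close>
  have head: "(\<Sum>j = 1..d + J. ?c j * P (2 * int j - int d))
      = (\<Sum>j = 1..d. ?c j * P (2 * int j - int d))
       + (\<Sum>j = 1..J. (n\<^sup>2 - (of_nat j)\<^sup>2) / 2 * P (2 * int j + int d))"
    unfolding split by (simp add: D_def power2_eq_square algebra_simps)
  have lin: "(\<Sum>i = 1..d + 2 * J. of_nat i / 2 * P (int i))
      = (\<Sum>i = 1..d. of_nat i / 2 * P (int i)) + (\<Sum>j = 1..J. (2 * of_nat j + D) / 2 * P (2 * int j + int d))"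
  proof -
    have "(\<Sum>i = 1..2 * J. of_nat (i + d) / 2 * P (int (i + d)))
        = (\<Sum>j = 1..J. of_nat (2 * j + d) / 2 * P (int (2 * j + d)))"
    proof (rule sum_even_steps)
      fix i :: nat assume "odd i"
      then have "int (i + d) mod 2 \<noteq> int d mod 2" by presburger
      then show "of_nat (i + d) / 2 * P (int (i + d)) = 0" using zero by simp
    qed
    then show ?thesis unfolding split by (simp add: D_def)
  qed
  have first: "?c 0 * P (- int d) + (\<Sum>j = 1..d. ?c j * P (2 * int j - int d))
      = (\<Sum>j\<le>d. ?c j * P (2 * int j - int d))"
    by (simp add: atMost_atLeast0 sum.atLeast_Suc_atMost[of 0 d])
  have flip: "(\<Sum>j\<le>d. ?c j * P (2 * int j - int d)) = (\<Sum>j\<le>d. ?c (d - j) * P (int d - 2 * int j))"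
    by (rule sum.reindex_bij_witness[of _ "\<lambda>j. d - j" "\<lambda>j. d - j"]) (auto simp: of_nat_diff algebra_simps)
  \<comment> \<open>The reflected value is \<open>e - P x\<close> with \<open>x = 2 * j - d\<close>,
    and the coefficients differ by \<open>D * x / 2\<close>. This is the linear weight with which
    \<open>P\<close> occurs in \<open>vL n\<close>.\<close>
  have half: "?c j * P (2 * int j - int d) + ?c (d - j) * P (int d - 2 * int j)
      = D / 2 * (of_int (2 * int j - int d) * P (2 * int j - int d)) + e * ?c (d - j)"
    if "j \<le> d" for j
  proof -
    have E: "P (int d - 2 * int j) = e - P (2 * int j - int d)"
    proof -
      have "(2 * int j - int d) mod 2 = int d mod 2" by presburger
      then show ?thesis using sym[of "2 * int j - int d"] by (simp add: algebra_simps)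
    qed
    show ?thesis
      unfolding E using that by (simp add: D_def of_nat_diff field_simps power2_eq_square)
  qed
  have "2 * (\<Sum>j\<le>d. ?c j * P (2 * int j - int d))
     = (\<Sum>j\<le>d. ?c j * P (2 * int j - int d) + ?c (d - j) * P (int d - 2 * int j))"
    using flip by (simp add: sum.distrib)
  also have "\<dots> = (\<Sum>j\<le>d. D / 2 * (of_int (2 * int j - int d) * P (2 * int j - int d)) + e * ?c (d - j))"
    by (intro sum.cong refl half) auto
  also have "\<dots> = D / 2 * (\<Sum>j\<le>d. of_int (2 * int j - int d) * P (2 * int j - int d)) + e * (\<Sum>j\<le>d. ?c (d - j))"
    by (simp add: sum.distrib sum_distrib_left)
  also have "(\<Sum>j\<le>d. ?c (d - j)) = (\<Sum>j\<le>d. ?c j)"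
    by (rule sum.reindex_bij_witness[of _ "\<lambda>j. d - j" "\<lambda>j. d - j"]) auto
  also have "(\<Sum>j\<le>d. of_int (2 * int j - int d) * P (2 * int j - int d))
     = (\<Sum>i = 1..d. of_int (int i) * P (int i) + of_int (- int i) * P (- int i))"
    by (subst sum_symmetric_steps[where g = "\<lambda>i. of_int i * P i"]) (auto simp: zero)
  also have "\<dots> = (\<Sum>i = 1..d. 2 * (of_nat i * P (int i)) - e * (if int i mod 2 = int d mod 2 then of_nat i else 0))"
  proof (rule sum.cong[OF refl])
    fix i
    show "of_int (int i) * P (int i) + of_int (- int i) * P (- int i)
       = 2 * (of_nat i * P (int i)) - e * (if int i mod 2 = int d mod 2 then of_nat i else 0)"
    proof (cases "int i mod 2 = int d mod 2")
      case True
      then have E: "P (- int i) = e - P (int i)" using sym[of "int i"] by (simp add: algebra_simps)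
      show ?thesis unfolding E using True by (simp add: algebra_simps)
    next
      case False
      moreover have "(- int i) mod 2 \<noteq> int d mod 2" using False by presburger
      ultimately show ?thesis using zero by simp
    qed
  qed
  also have "\<dots> = 2 * (\<Sum>i = 1..d. of_nat i * P (int i))
      - e * (\<Sum>i = 1..d. if int i mod 2 = int d mod 2 then of_nat i else 0)"
    by (simp only: sum_subtractf sum_distrib_left)
  finally have core: "2 * (\<Sum>j\<le>d. ?c j * P (2 * int j - int d))
     = D / 2 * (2 * (\<Sum>i = 1..d. of_nat i * P (int i))
        - e * (\<Sum>i = 1..d. if int i mod 2 = int d mod 2 then of_nat i else 0)) + e * (\<Sum>j\<le>d. ?c j)" .
  \<comment> \<open>The coefficients combine by \<open>(D + j)^2 - j^2 = D * (2 * j + D)\<close>,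
    again \<open>D\<close> times the linear weight.\<close>
  have rest: "(\<Sum>j = 1..J. (n\<^sup>2 - (of_nat j)\<^sup>2) / 2 * P (2 * int j + int d))
      - (\<Sum>j = 1..J. (n\<^sup>2 - (D + of_nat j)\<^sup>2) / 2 * P (2 * int j + int d))
      = D * (\<Sum>j = 1..J. (2 * of_nat j + D) / 2 * P (2 * int j + int d))"
    unfolding sum_distrib_left sum_subtractf[symmetric]
    by (rule sum.cong) (simp_all add: field_simps power2_eq_square)
  have q: "(\<Sum>j\<le>d. (n\<^sup>2 - (D - of_nat j)\<^sup>2) / 4) = (\<Sum>j\<le>d. ?c j) / 2"
    by (simp add: sum_divide_distrib)
  have li: "(\<Sum>i = 1..d. of_nat i / 2 * P (int i)) = (\<Sum>i = 1..d. of_nat i * P (int i)) / 2"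
    by (simp add: sum_divide_distrib)
  have c0: "(n\<^sup>2 - D\<^sup>2) / 2 * P (- int d) = ?c 0 * P (- int d)" by simp
  have gen: "a0 + (s1 + t1 - t2) - D * (x / 2 + t3) = e * (z / 2 - D / 4 * y)"
    if "a0 + s1 = w" "2 * w = D / 2 * (2 * x - e * y) + e * z" "t1 - t2 = D * t3"
    for a0 s1 t1 t2 t3 w x y z :: complex
  proof -
    have "a0 + (s1 + t1 - t2) - D * (x / 2 + t3) = (a0 + s1) + (t1 - t2) - D * (x / 2 + t3)" by simp
    also have "\<dots> = 2 * w / 2 + D * t3 - D * (x / 2 + t3)" using that(1,3) by simp
    also have "\<dots> = e * (z / 2 - D / 4 * y)" unfolding that(2) by (simp add: field_simps)
    finally show ?thesis .
  qed
  show ?thesis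
    unfolding D_def[symmetric] sum_subtractf head tail lin q li c0
    by (rule gen[OF first core rest])
qed

section \<open>The weight-4 operator and its commutator with the modes\<close>

context fermion
begin

lemma anti_commute: "anti j k = anti k j"
proof -
  have "j mod 2 = k mod 2" if "j + k = 0" using that by presburger
  then show ?thesis by (auto simp: anti_def add.commute)
qed

lemma vL_neg_vanish:
  assumes "j > \<Sum>(fset S)"
  shows "vL (- int j) f S = 0"
proof -
  have "psi (- int j - int i) (psi (- int j + int i) f) S = 0" for i
    using assms by (intro psi_create_zero') auto
  then show ?thesis using assms by (simp add: vL_def)
qed

text \<open>The zero mode of a composite field of weight 4. Its commutator with \<open>psi s\<close> is \<open>psi s\<close> times
  \<open>kappa s\<close>, a cubic in \<open>s\<close>; unlike the linear multiplier of \<open>L\<^sub>0\<close>, this distinguishes the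
  bilinear terms of one \<open>L\<^sub>n\<close>.\<close>

definition quartic :: "fock \<Rightarrow> fock" where
  "quartic f = (\<lambda>S. vL 0 (vL 0 f) S + 2 * (\<Sum>j = 1..\<Sum>(fset S). vL (- int j) (vL (int j) f) S))"

lemma quartic_truncate:
  assumes "J \<ge> \<Sum>(fset S)"
  shows "quartic f S = vL 0 (vL 0 f) S + 2 * (\<Sum>j = 1..J. vL (- int j) (vL (int j) f) S)"
proof -
  have "(\<Sum>j = 1..\<Sum>(fset S). vL (- int j) (vL (int j) f) S) = (\<Sum>j = 1..J. vL (- int j) (vL (int j) f) S)"
    by (rule sum.mono_neutral_left) (use assms in \<open>auto intro!: vL_neg_vanish\<close>)
  then show ?thesis by (simp add: quartic_def)
qed

lemma lin_op_quartic: "lin_op quartic"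
  unfolding lin_op_def quartic_def
  using lin_opD[OF lin_op_comp[OF lin_op_vL lin_op_vL]]
  by (simp add: sum.distrib sum_distrib_left algebra_simps)

definition quartic_comm :: "int \<Rightarrow> fock \<Rightarrow> fock" where
  "quartic_comm s f = (\<lambda>S. quartic (psi s f) S - psi s (quartic f) S)"

lemma psi_quartic:
  assumes "J \<ge> \<Sum>(fset S) + nat \<bar>s\<bar>"
  shows "psi s (quartic f) S = psi s (vL 0 (vL 0 f)) S
    + 2 * (\<Sum>j = 1..J. psi s (vL (- int j) (vL (int j) f)) S)"
proof -
  have "psi s (quartic f) S
     = psi s (\<lambda>T. 1 * vL 0 (vL 0 f) T + 2 * (\<Sum>j = 1..J. 1 * vL (- int j) (vL (int j) f) T)) S"
  proof (rule psi_local)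
    fix T assume "\<Sum>(fset T) \<le> \<Sum>(fset S) + nat \<bar>s\<bar>"
    then show "quartic f T = 1 * vL 0 (vL 0 f) T + 2 * (\<Sum>j = 1..J. 1 * vL (- int j) (vL (int j) f) T)"
      using quartic_truncate[of T J f] assms by simp
  qed
  also have "\<dots> = 1 * psi s (vL 0 (vL 0 f)) S + 2 * (\<Sum>j = 1..J. 1 * psi s (vL (- int j) (vL (int j) f)) S)"
    by (subst psi_linear, subst psi_sum) simp
  finally show ?thesis by simp
qed

text \<open>The order of the factors is kept: the left factors \<open>psi (s - 2 * int j)\<close>
  and \<open>vL (- int j)\<close> vanish at \<open>S\<close> for large \<open>j\<close>, so the sum
  stays locally finite. Collecting everything on one side would produce infinitely many multiples of
  \<open>psi s\<close>.\<close>

lemma quartic_comm_eq: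
  assumes "J \<ge> \<Sum>(fset S) + nat \<bar>s\<bar>"
  shows "quartic_comm s f S = - of_int s / 2 * (psi s (vL 0 f) S + vL 0 (psi s f) S)
     - (\<Sum>j = 1..J. of_int (s - int j) * psi (s - 2 * int j) (vL (int j) f) S
          + of_int (s + int j) * vL (- int j) (psi (s + 2 * int j) f) S)"
proof -
  have v: "vL n (psi s f) = (\<lambda>S. psi s (vL n f) S - of_int (s + n) / 2 * psi (s + 2 * n) f S)" for n f s
    by (rule ext) (rule vL_psi)
  have 0: "vL 0 (vL 0 (psi s f)) S = psi s (vL 0 (vL 0 f)) S
     - of_int s / 2 * (psi s (vL 0 f) S + vL 0 (psi s f) S)"
  proof -
    have "vL 0 (vL 0 (psi s f)) S = vL 0 (\<lambda>S. psi s (vL 0 f) S - of_int s / 2 * psi s f S) S"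
      using v[of 0 s f] by simp
    also have "\<dots> = vL 0 (psi s (vL 0 f)) S - of_int s / 2 * vL 0 (psi s f) S"
      by (simp only: vL_diff vL_scale)
    also have "vL 0 (psi s (vL 0 f)) S = psi s (vL 0 (vL 0 f)) S - of_int s / 2 * psi s (vL 0 f) S"
      using vL_psi[of 0 s "vL 0 f" S] by simp
    finally show ?thesis by (simp add: algebra_simps)
  qed
  have j: "2 * vL (- int j) (vL (int j) (psi s f)) S = 2 * psi s (vL (- int j) (vL (int j) f)) S
     - (of_int (s - int j) * psi (s - 2 * int j) (vL (int j) f) S
        + of_int (s + int j) * vL (- int j) (psi (s + 2 * int j) f) S)" for j
  proof -
    have "vL (- int j) (vL (int j) (psi s f)) S = vL (- int j) (psi s (vL (int j) f)) S
       - of_int (s + int j) / 2 * vL (- int j) (psi (s + 2 * int j) f) S"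
      unfolding v[of "int j" s f] by (simp only: vL_diff vL_scale)
    also have "vL (- int j) (psi s (vL (int j) f)) S = psi s (vL (- int j) (vL (int j) f)) S
       - of_int (s - int j) / 2 * psi (s - 2 * int j) (vL (int j) f) S"
      using vL_psi[of "- int j" s "vL (int j) f" S] by simp
    finally have E: "vL (- int j) (vL (int j) (psi s f)) S = psi s (vL (- int j) (vL (int j) f)) S
       - of_int (s - int j) / 2 * psi (s - 2 * int j) (vL (int j) f) S
       - of_int (s + int j) / 2 * vL (- int j) (psi (s + 2 * int j) f) S" .
    show ?thesis unfolding E by (simp add: field_simps)
  qed
  have "quartic (psi s f) S = vL 0 (vL 0 (psi s f)) S
      + (\<Sum>j = 1..J. 2 * vL (- int j) (vL (int j) (psi s f)) S)"
    using quartic_truncate[of S J] assms by (simp add: sum_distrib_left)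
  also have "\<dots> = psi s (vL 0 (vL 0 f)) S - of_int s / 2 * (psi s (vL 0 f) S + vL 0 (psi s f) S)
      + (2 * (\<Sum>j = 1..J. psi s (vL (- int j) (vL (int j) f)) S)
        - (\<Sum>j = 1..J. of_int (s - int j) * psi (s - 2 * int j) (vL (int j) f) S
          + of_int (s + int j) * vL (- int j) (psi (s + 2 * int j) f) S))"
    unfolding 0 j by (simp only: sum_subtractf sum_distrib_left)
  finally show ?thesis
    unfolding quartic_comm_def psi_quartic[OF assms] by (simp add: algebra_simps)
qed

lemma lin_op_quartic_comm: "lin_op (quartic_comm s)"
proof -
  have "lin_op (\<lambda>f S. X f S - Y f S)" if "lin_op X" "lin_op Y" for X Y
    using that by (simp add: lin_op_def algebra_simps)
  then show ?thesis
    unfolding quartic_comm_def by (simp add: lin_op_comp lin_op_quartic lin_op_psi)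
qed

text \<open>The anticommutator of two modes is a scalar and commutes with \<open>quartic\<close>;
  the product rule splits the resulting zero into these two parts. It later reduces the case
  \<open>s < t\<close> to \<open>t \<le> s\<close>.\<close>

lemma quartic_comm_antisym:
  "quartic_comm s (psi t f) S + psi t (quartic_comm s f) S
    = - (quartic_comm t (psi s f) S + psi s (quartic_comm t f) S)"
proof -
  have "quartic (psi s (psi t f)) S + quartic (psi t (psi s f)) S
      = quartic (\<lambda>S. psi s (psi t f) S + psi t (psi s f) S) S"
    by (simp add: lin_op_add[OF lin_op_quartic])
  also have "\<dots> = anti s t * quartic f S"
    unfolding psi_psi by (rule lin_op_scale[OF lin_op_quartic])
  also have "\<dots> = psi s (psi t (quartic f)) S + psi t (psi s (quartic f)) S"
    by (simp add: psi_psi)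
  finally show ?thesis
    unfolding quartic_comm_def by (simp add: psi_diff algebra_simps)
qed

text \<open>Anticommuting a product of one mode and one \<open>vL\<close> with \<open>psi t\<close>
  either contracts the mode, leaving the Virasoro operator, or lets the Virasoro operator shift
  \<open>t\<close>, leaving two modes. The bound on \<open>J\<close> covers all points seen by both
  \<open>psi s\<close> and \<open>psi t\<close>.\<close>

lemma quartic_comm_psi:
  assumes J: "J \<ge> \<Sum>(fset S) + nat \<bar>s\<bar> + nat \<bar>t\<bar>"
  shows "quartic_comm s (psi t f) S + psi t (quartic_comm s f) S
    = - of_int s * (anti s t * vL 0 f S) + (of_int s)\<^sup>2 / 4 * anti s t * f S
      + of_int s * of_int t / 2 * psi s (psi t f) S
      - (\<Sum>j = 1..J. of_int (s - int j) * (anti (s - 2 * int j) t * vL (int j) f S)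
         + of_int (s + int j) * (anti (s + 2 * int j) t * vL (- int j) f S))
      + (\<Sum>j = 1..J. of_int (s - int j) * of_int (t + int j) / 2 * psi (s - 2 * int j) (psi (t + 2 * int j) f) S
         - of_int (s + int j) * of_int (t - int j) / 2 * psi (t - 2 * int j) (psi (s + 2 * int j) f) S)"
proof -
  have v: "vL n (psi s f) = (\<lambda>S. psi s (vL n f) S - of_int (s + n) / 2 * psi (s + 2 * n) f S)" for n f s
    by (rule ext) (rule vL_psi)
  have 1: "quartic_comm s (psi t f) S = - of_int s / 2 * (psi s (vL 0 (psi t f)) S + vL 0 (psi s (psi t f)) S)
     - (\<Sum>j = 1..J. of_int (s - int j) * psi (s - 2 * int j) (vL (int j) (psi t f)) S
          + of_int (s + int j) * vL (- int j) (psi (s + 2 * int j) (psi t f)) S)"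
    by (rule quartic_comm_eq) (use J in simp)
  let ?A = "\<lambda>T. psi s (vL 0 f) T + vL 0 (psi s f) T"
  let ?B = "\<lambda>j T. of_int (s - int j) * psi (s - 2 * int j) (vL (int j) f) T
            + of_int (s + int j) * vL (- int j) (psi (s + 2 * int j) f) T"
  have "psi t (quartic_comm s f) S = psi t (\<lambda>T. (- of_int s / 2) * ?A T + (- 1) * (\<Sum>j = 1..J. 1 * ?B j T)) S"
  proof (rule psi_local)
    fix T assume "\<Sum>(fset T) \<le> \<Sum>(fset S) + nat \<bar>t\<bar>"
    then have "J \<ge> \<Sum>(fset T) + nat \<bar>s\<bar>" using J by linarith
    then show "quartic_comm s f T = (- of_int s / 2) * ?A T + (- 1) * (\<Sum>j = 1..J. 1 * ?B j T)"
      using quartic_comm_eq[of T s J f] by simp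
  qed
  also have "\<dots> = (- of_int s / 2) * psi t ?A S + (- 1) * (\<Sum>j = 1..J. 1 * psi t (?B j) S)"
    by (subst psi_linear, subst psi_sum) (rule refl)
  also have "(\<Sum>j = 1..J. 1 * psi t (?B j) S)
     = (\<Sum>j = 1..J. of_int (s - int j) * psi t (psi (s - 2 * int j) (vL (int j) f)) S
            + of_int (s + int j) * psi t (vL (- int j) (psi (s + 2 * int j) f)) S)"
    by (simp only: psi_linear mult_1)
  also have "psi t ?A S = psi t (psi s (vL 0 f)) S + psi t (vL 0 (psi s f)) S"
    by (rule psi_add)
  finally have 2: "psi t (quartic_comm s f) S
     = - of_int s / 2 * (psi t (psi s (vL 0 f)) S + psi t (vL 0 (psi s f)) S)
      - (\<Sum>j = 1..J. of_int (s - int j) * psi t (psi (s - 2 * int j) (vL (int j) f)) S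
            + of_int (s + int j) * psi t (vL (- int j) (psi (s + 2 * int j) f)) S)"
    by simp
  have j1: "psi a (vL n (psi t f)) S = anti a t * vL n f S - psi t (psi a (vL n f)) S
      - of_int (t + n) / 2 * psi a (psi (t + 2 * n) f) S" for a n
  proof -
    have "psi a (vL n (psi t f)) S = psi a (psi t (vL n f)) S - of_int (t + n) / 2 * psi a (psi (t + 2 * n) f) S"
      unfolding v[of n t f] by (simp only: psi_diff psi_scale)
    then show ?thesis using psi_anticomm[of a t "vL n f" S] by simp
  qed
  have j2: "vL n (psi a (psi t f)) S = anti a t * vL n f S - psi t (vL n (psi a f)) S
      + of_int (t + n) / 2 * psi (t + 2 * n) (psi a f) S" for a n
  proof -
    have "psi a (psi t f) = (\<lambda>S. anti a t * f S - psi t (psi a f) S)"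
      by (rule ext) (rule psi_anticomm)
    then have "vL n (psi a (psi t f)) S = anti a t * vL n f S - vL n (psi t (psi a f)) S"
      by (simp only: vL_diff vL_scale)
    then show ?thesis using vL_psi[of n t "psi a f" S] by simp
  qed
  have k0: "psi s (vL 0 (psi t f)) S + vL 0 (psi s (psi t f)) S
     + (psi t (psi s (vL 0 f)) S + psi t (vL 0 (psi s f)) S)
     = 2 * (anti s t * vL 0 f S) - of_int t * psi s (psi t f) S + of_int t / 2 * anti s t * f S"
    unfolding j1 j2 by (simp add: psi_anticomm[of t s f S] anti_commute[of t s] field_simps)
  have as: "of_int t * (anti s t * x) = - of_int s * (anti s t * x)" for x
    by (simp add: anti_def add_eq_0_iff)
  have kj: "(of_int (s - int j) * psi (s - 2 * int j) (vL (int j) (psi t f)) S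
          + of_int (s + int j) * vL (- int j) (psi (s + 2 * int j) (psi t f)) S)
     + (of_int (s - int j) * psi t (psi (s - 2 * int j) (vL (int j) f)) S
            + of_int (s + int j) * psi t (vL (- int j) (psi (s + 2 * int j) f)) S)
     = (of_int (s - int j) * (anti (s - 2 * int j) t * vL (int j) f S)
         + of_int (s + int j) * (anti (s + 2 * int j) t * vL (- int j) f S))
      - (of_int (s - int j) * of_int (t + int j) / 2 * psi (s - 2 * int j) (psi (t + 2 * int j) f) S
         - of_int (s + int j) * of_int (t - int j) / 2 * psi (t - 2 * int j) (psi (s + 2 * int j) f) S)" for j
    unfolding j1 j2 by (simp add: field_simps)
  have "quartic_comm s (psi t f) S + psi t (quartic_comm s f) S
    = - of_int s / 2 * (psi s (vL 0 (psi t f)) S + vL 0 (psi s (psi t f)) S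
        + (psi t (psi s (vL 0 f)) S + psi t (vL 0 (psi s f)) S))
      - (\<Sum>j = 1..J. (of_int (s - int j) * psi (s - 2 * int j) (vL (int j) (psi t f)) S
          + of_int (s + int j) * vL (- int j) (psi (s + 2 * int j) (psi t f)) S)
         + (of_int (s - int j) * psi t (psi (s - 2 * int j) (vL (int j) f)) S
            + of_int (s + int j) * psi t (vL (- int j) (psi (s + 2 * int j) f)) S))"
    unfolding 1 2 sum.distrib by (simp add: algebra_simps)
  also have "\<dots> = - of_int s / 2 * (2 * (anti s t * vL 0 f S) - of_int t * psi s (psi t f) S + of_int t / 2 * anti s t * f S)
     - ((\<Sum>j = 1..J. of_int (s - int j) * (anti (s - 2 * int j) t * vL (int j) f S)
         + of_int (s + int j) * (anti (s + 2 * int j) t * vL (- int j) f S))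
      - (\<Sum>j = 1..J. of_int (s - int j) * of_int (t + int j) / 2 * psi (s - 2 * int j) (psi (t + 2 * int j) f) S
         - of_int (s + int j) * of_int (t - int j) / 2 * psi (t - 2 * int j) (psi (s + 2 * int j) f) S))"
    unfolding k0 kj by (simp only: sum_subtractf)
  finally show ?thesis
    using as[of "f S"] by (simp add: power2_eq_square field_simps)
qed

text \<open>In the usual index \<open>r = s / 2\<close> this is
  \<open>- (28 * r^3 + 5 * r) / 24\<close>. In the Neveu-Schwarz case, for negative odd
  \<open>s\<close>, it is the eigenvalue of \<open>quartic\<close> on the state with the single mode
  \<open>- s\<close>.\<close>

definition kappa :: "int \<Rightarrow> complex" where
  "kappa s = - (7 * (of_int s) ^ 3 + 5 * of_int s) / 48"

lemma quartic_comm_wrong_parity: "s mod 2 \<noteq> p \<Longrightarrow> quartic_comm s f = (\<lambda>S. 0)"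
  by (simp add: quartic_comm_def psi_wrong_parity lin_op_zero[OF lin_op_quartic])

text \<open>Centre the indices: \<open>s = n + d\<close>, \<open>t = n - d\<close>. All contractions
  select the same operator \<open>vL n\<close>, with coefficient \<open>d\<close>, and its bilinear
  terms cancel the products of two modes. What remains is a scalar at \<open>n = 0\<close>. The
  parity sums of the two cases, as polynomials in \<open>d\<close>, differ there by
  \<open>d / 16\<close>, which the term with \<open>h0\<close> compensates, so that one cubic serves
  both.\<close>

lemma quartic_comm_anti_aux:
  assumes "s \<ge> t" and sp: "s mod 2 = p" and tp: "t mod 2 = p"
  shows "quartic_comm s (psi t f) S + psi t (quartic_comm s f) S = kappa s * anti s t * f S"
proof -
  define n where "n = (s + t) div 2"
  define d where "d = nat ((s - t) div 2)"
  have "even (s + t)" "even (s - t)" using sp tp by presburger+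
  then have "s + t = 2 * n" "s - t = 2 * ((s - t) div 2)" unfolding n_def by simp_all
  then have st: "s = n + int d" "t = n - int d"
    using assms(1) by (simp_all add: d_def)
  have nd: "(n + int d) mod 2 = p" "(n - int d) mod 2 = p" using sp tp st by auto
  define P where "P i = psi (n - i) (psi (n + i) f) S" for i
  define e where "e = (if n = 0 then f S else 0)"
  define J where "J = nat \<bar>n\<bar> + \<Sum>(fset S) + nat \<bar>s\<bar> + nat \<bar>t\<bar>"
  have par: "i mod 2 = int d mod 2 \<longleftrightarrow> (n + i) mod 2 = p" for i
  proof -
    have "(n + int d) mod 2 = (n + i) mod 2 \<longleftrightarrow> i mod 2 = int d mod 2" by presburger
    then show ?thesis unfolding nd(1) by (simp only: eq_commute[of p])
  qed
  have sym: "P i + P (- i) = e" if "i mod 2 = int d mod 2" for i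
  proof -
    have "(n + i) mod 2 = p" using that par by blast
    then have "anti (n - i) (n + i) = (if n = 0 then 1 else 0)" unfolding anti_def by simp
    then show ?thesis using psi_psi[of "n - i" "n + i" f S] by (simp add: P_def e_def)
  qed
  have zero: "P i = 0" if "i mod 2 \<noteq> int d mod 2" for i
  proof -
    have "(n + i) mod 2 \<noteq> p" using that par by blast
    then show ?thesis unfolding P_def by (simp add: psi_wrong_parity)
  qed
  have van: "P i = 0" if "i > int J" for i
  proof -
    have "int J \<ge> \<bar>n\<bar> + int (\<Sum>(fset S))" unfolding J_def by linarith
    then show ?thesis unfolding P_def using that by (intro psi_create_zero') linarith+
  qed
  have anti: "anti s t = (if n = 0 then 1 else 0)" "anti (s - 2 * int j) t = (if n = int j then 1 else 0)"
    "anti (s + 2 * int j) t = (if n = - int j then 1 else 0)" for j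
    using nd(2) by (auto simp: anti_def st)
  have vn: "vL n f S = (\<Sum>i = 1..d + 2 * J. of_nat i / 2 * P (int i)) + h0 * e"
    using vL_truncate[of n S "d + 2 * J" f] by (simp add: P_def e_def J_def)
  have sd: "of_int (s - n) = (of_nat d :: complex)" by (simp add: st)
  \<comment> \<open>Exactly one part is nonzero, according to the sign of \<open>n\<close>: the
    separate term for \<open>n = 0\<close>, otherwise the summand \<open>j = n\<close> or
    \<open>j = - n\<close>. In each case the coefficient is \<open>s - n\<close>.\<close>
  have bilinear: "of_int s * (anti s t * vL 0 f S)
     + (\<Sum>j = 1..d + J. of_int (s - int j) * (anti (s - 2 * int j) t * vL (int j) f S)
         + of_int (s + int j) * (anti (s + 2 * int j) t * vL (- int j) f S)) = of_nat d * vL n f S"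
  proof -
    have "(\<Sum>j = 1..d + J. of_int (s - int j) * (anti (s - 2 * int j) t * vL (int j) f S))
        = (\<Sum>j = 1..d + J. if j = nat n then of_int (s - n) * vL n f S else 0)"
    proof (rule sum.cong[OF refl])
      fix j assume "j \<in> {1..d + J}"
      then have "j \<ge> 1" by simp
      show "of_int (s - int j) * (anti (s - 2 * int j) t * vL (int j) f S)
          = (if j = nat n then of_int (s - n) * vL n f S else 0)"
      proof (cases "n = int j")
        case True
        then show ?thesis unfolding anti by simp
      next
        case False
        then have "j \<noteq> nat n" using \<open>j \<ge> 1\<close> by linarith
        then show ?thesis unfolding anti using False by simp
      qed
    qed
    also have "\<dots> = (if n > 0 then of_int (s - n) * vL n f S else 0)"
      by (subst sum.delta) (auto simp: J_def)
    finally have 1: "(\<Sum>j = 1..d + J. of_int (s - int j) * (anti (s - 2 * int j) t * vL (int j) f S))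
       = (if n > 0 then of_int (s - n) * vL n f S else 0)" .
    have "(\<Sum>j = 1..d + J. of_int (s + int j) * (anti (s + 2 * int j) t * vL (- int j) f S))
        = (\<Sum>j = 1..d + J. if j = nat (- n) then of_int (s - n) * vL n f S else 0)"
    proof (rule sum.cong[OF refl])
      fix j assume "j \<in> {1..d + J}"
      then have "j \<ge> 1" by simp
      show "of_int (s + int j) * (anti (s + 2 * int j) t * vL (- int j) f S)
          = (if j = nat (- n) then of_int (s - n) * vL n f S else 0)"
      proof (cases "n = - int j")
        case True
        then show ?thesis unfolding anti by simp
      next
        case False
        then have "j \<noteq> nat (- n)" using \<open>j \<ge> 1\<close> by linarith
        then show ?thesis unfolding anti using False by simp
      qed
    qed
    also have "\<dots> = (if n < 0 then of_int (s - n) * vL n f S else 0)"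
      by (subst sum.delta) (auto simp: J_def)
    finally have 2: "(\<Sum>j = 1..d + J. of_int (s + int j) * (anti (s + 2 * int j) t * vL (- int j) f S))
       = (if n < 0 then of_int (s - n) * vL n f S else 0)" .
    have "of_int s * (anti s t * vL 0 f S) = (if n = 0 then of_int (s - n) * vL n f S else 0)"
      unfolding anti by simp
    then show ?thesis
      unfolding sum.distrib 1 2 sd by (cases n "0 :: int" rule: linorder_cases) auto
  qed
  have quad: "of_int s * of_int t / 2 * psi s (psi t f) S
     + (\<Sum>j = 1..d + J. of_int (s - int j) * of_int (t + int j) / 2 * psi (s - 2 * int j) (psi (t + 2 * int j) f) S
         - of_int (s + int j) * of_int (t - int j) / 2 * psi (t - 2 * int j) (psi (s + 2 * int j) f) S)
     = ((of_int n)\<^sup>2 - (of_nat d)\<^sup>2) / 2 * P (- int d)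
     + (\<Sum>j = 1..d + J. ((of_int n)\<^sup>2 - (of_nat d - of_nat j)\<^sup>2) / 2 * P (2 * int j - int d)
         - ((of_int n)\<^sup>2 - (of_nat d + of_nat j)\<^sup>2) / 2 * P (2 * int j + int d))"
  proof -
    have p1: "P (- int d) = psi s (psi t f) S"
      "P (2 * int j - int d) = psi (s - 2 * int j) (psi (t + 2 * int j) f) S"
      "P (2 * int j + int d) = psi (t - 2 * int j) (psi (s + 2 * int j) f) S" for j
      by (simp_all add: P_def st algebra_simps)
    have c: "of_int s * of_int t = ((of_int n)\<^sup>2 - (of_nat d)\<^sup>2 :: complex)"
      "of_int (s - int j) * of_int (t + int j) = ((of_int n)\<^sup>2 - (of_nat d - of_nat j)\<^sup>2 :: complex)"
      "of_int (s + int j) * of_int (t - int j) = ((of_int n)\<^sup>2 - (of_nat d + of_nat j)\<^sup>2 :: complex)" for j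
      by (simp_all add: st power2_eq_square algebra_simps)
    show ?thesis unfolding p1 c by (rule refl)
  qed
  have ids: "((of_int n)\<^sup>2 - (of_nat d)\<^sup>2) / 2 * P (- int d)
     + (\<Sum>j = 1..d + J. ((of_int n)\<^sup>2 - (of_nat d - of_nat j)\<^sup>2) / 2 * P (2 * int j - int d)
         - ((of_int n)\<^sup>2 - (of_nat d + of_nat j)\<^sup>2) / 2 * P (2 * int j + int d))
     - of_nat d * (\<Sum>i = 1..d + 2 * J. of_nat i / 2 * P (int i))
   = e * ((\<Sum>j\<le>d. ((of_int n)\<^sup>2 - (of_nat d - of_nat j)\<^sup>2) / 4)
       - of_nat d / 4 * (\<Sum>i = 1..d. if int i mod 2 = int d mod 2 then of_nat i else 0))"
    by (rule antisymmetric_double_sum) (use sym zero van in auto)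
  have "quartic_comm s (psi t f) S + psi t (quartic_comm s f) S
     = (of_int s)\<^sup>2 / 4 * anti s t * f S - of_nat d * vL n f S
       + (of_int s * of_int t / 2 * psi s (psi t f) S
     + (\<Sum>j = 1..d + J. of_int (s - int j) * of_int (t + int j) / 2 * psi (s - 2 * int j) (psi (t + 2 * int j) f) S
         - of_int (s + int j) * of_int (t - int j) / 2 * psi (t - 2 * int j) (psi (s + 2 * int j) f) S))"
    unfolding bilinear[symmetric]
    by (subst quartic_comm_psi[of S s t "d + J"]) (auto simp: J_def)
  also have "\<dots> = (of_int s)\<^sup>2 / 4 * anti s t * f S - of_nat d * (h0 * e)
     + e * ((\<Sum>j\<le>d. ((of_int n)\<^sup>2 - (of_nat d - of_nat j)\<^sup>2) / 4)
       - of_nat d / 4 * (\<Sum>i = 1..d. if int i mod 2 = int d mod 2 then of_nat i else 0))"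
    unfolding quad vn ids[symmetric] by (simp add: algebra_simps)
  finally have E: "quartic_comm s (psi t f) S + psi t (quartic_comm s f) S
     = (of_int s)\<^sup>2 / 4 * anti s t * f S - of_nat d * (h0 * e)
     + e * ((\<Sum>j\<le>d. ((of_int n)\<^sup>2 - (of_nat d - of_nat j)\<^sup>2) / 4)
       - of_nat d / 4 * (\<Sum>i = 1..d. if int i mod 2 = int d mod 2 then of_nat i else 0))" .
  show ?thesis
  proof (cases "n = 0")
    case False
    then show ?thesis unfolding E anti by (simp add: e_def)
  next
    case True
    have q: "(\<Sum>j\<le>d. ((of_int n)\<^sup>2 - (of_nat d - of_nat j)\<^sup>2) / 4 :: complex)
       = - (of_nat d * (of_nat d + 1) * (2 * of_nat d + 1) / 24)"
    proof -
      have "(\<Sum>j\<le>d. ((of_int n)\<^sup>2 - (of_nat d - of_nat j)\<^sup>2) / 4 :: complex)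
         = - (\<Sum>j\<le>d. (of_nat d - of_nat j)\<^sup>2) / 4"
        using True by (simp add: sum_negf flip: sum_divide_distrib)
      then show ?thesis unfolding sum_squares_reflected by simp
    qed
    have ke: "kappa s = - (7 * (of_nat d) ^ 3 + 5 * of_nat d) / 48" "(of_int s :: complex) = of_nat d"
      "e = f S"
      using True by (simp_all add: kappa_def st e_def)
    have a1: "anti s t = 1" using anti(1) True by simp
    have pd: "odd d \<longleftrightarrow> p = 1" "p = 0 \<longleftrightarrow> p \<noteq> 1" using nd(1) True p by (simp, presburger)+
    show ?thesis
      unfolding E q sum_parity_nat ke a1 h0_def pd
      by (cases "p = 1") (simp_all add: field_simps power2_eq_square power3_eq_cube)
  qed
qed

lemma quartic_comm_anti:
  "quartic_comm s (psi t f) S + psi t (quartic_comm s f) S = kappa s * anti s t * f S"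
proof -
  consider "s mod 2 \<noteq> p" | "t mod 2 \<noteq> p" | "s mod 2 = p" "t mod 2 = p" "s \<ge> t"
    | "s mod 2 = p" "t mod 2 = p" "t \<ge> s" by linarith
  then show ?thesis
  proof cases
    case 1
    then show ?thesis using anti_commute[of s t] by (simp add: quartic_comm_wrong_parity anti_def)
  next
    case 2
    then show ?thesis
      by (simp add: psi_wrong_parity anti_def lin_op_zero[OF lin_op_quartic_comm])
  next
    case 3
    then show ?thesis by (intro quartic_comm_anti_aux)
  next
    case 4
    \<comment> \<open>A nonzero contraction forces \<open>t = - s\<close>, and \<open>kappa\<close>
      is odd; this matches the sign in \<open>quartic_comm_antisym\<close>.\<close>
    have "kappa t * anti t s * f S = - (kappa s * anti s t * f S)"
    proof (cases "s + t = 0")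
      case True
      then have "t = - s" by simp
      then have "kappa t = - kappa s" by (simp add: kappa_def field_simps)
      then show ?thesis by (simp add: anti_commute[of t s])
    qed (simp add: anti_def)
    then show ?thesis
      using quartic_comm_anti_aux[OF 4(3,2,1), of f S] by (simp add: quartic_comm_antisym[of s t])
  qed
qed

lemma quartic_bottom_left: "bottom T \<Longrightarrow> quartic f T = h0\<^sup>2 * f T"
  by (simp add: quartic_def vL_bottom_left power2_eq_square)

lemma quartic_bottom_right: "bottom S \<Longrightarrow> quartic (ket S) = (\<lambda>T. h0\<^sup>2 * ket S T)"
  by (rule ext)
     (simp add: quartic_def vL_bottom_right lin_op_scale[OF lin_op_vL] power2_eq_square)

text \<open>The difference \<open>quartic_comm s f - kappa s * psi s f\<close> anticommutes with
  every mode, so \<open>intertwiner_zero\<close> applies with sign -1. On ground states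
  \<open>quartic\<close> is the scalar \<open>h0^2\<close> from either side, hence its commutator
  vanishes there, and \<open>kappa 0 = 0\<close> disposes of the zero mode.\<close>

lemma quartic_psi_ket:
  assumes "allowed S" "allowed T"
  shows "quartic (psi s (ket S)) T = psi s (quartic (ket S)) T + kappa s * psi s (ket S) T"
proof -
  let ?X = "\<lambda>f S. quartic_comm s f S - kappa s * psi s f S"
  have lin: "lin_op ?X"
    using lin_opD[OF lin_op_quartic_comm] lin_opD[OF lin_op_psi]
    by (simp add: lin_op_def algebra_simps)
  have "?X (ket S) T = 0"
  proof (rule intertwiner_zero[OF lin, where \<sigma> = "- 1"])
    fix t f S
    have E: "psi t (?X f) S = psi t (quartic_comm s f) S - kappa s * psi t (psi s f) S"
      by (simp only: psi_diff psi_scale)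
    have 1: "quartic_comm s (psi t f) S = kappa s * anti s t * f S - psi t (quartic_comm s f) S"
      using quartic_comm_anti[of s t f S] by (simp add: algebra_simps)
    have 2: "psi s (psi t f) S = anti s t * f S - psi t (psi s f) S"
      by (rule psi_anticomm)
    show "?X (psi t f) S = - 1 * psi t (?X f) S"
      unfolding E 1 2 by (simp add: algebra_simps)
  next
    fix S T assume S: "bottom S" and T: "bottom T"
    have "quartic_comm s (ket S) T = 0"
      unfolding quartic_comm_def quartic_bottom_left[OF T] quartic_bottom_right[OF S]
      by (simp add: psi_scale)
    moreover have "kappa s * psi s (ket S) T = 0"
      using psi_bottom_left[OF T, of s] psi_bottom_right[OF S, of s]
      by (cases s "0 :: int" rule: linorder_cases) (auto simp: kappa_def)
    ultimately show "?X (ket S) T = 0" by simp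
  qed (use assms in auto)
  then show ?thesis by (simp add: quartic_comm_def algebra_simps)
qed

section \<open>Irreducibility of the sectors\<close>

definition in_sector :: "nat \<Rightarrow> nat fset \<Rightarrow> bool" where
  "in_sector q S \<longleftrightarrow> allowed S \<and> fcard S mod 2 = q"

text \<open>Finite support makes this the algebraic span of occupation states, the actual Fock
  module inside the space of all coefficient functions.\<close>

definition sector :: "nat \<Rightarrow> fock set" where
  "sector q = {f. finite {S. f S \<noteq> 0} \<and> (\<forall>S. f S \<noteq> 0 \<longrightarrow> in_sector q S)}"

lemma sector_finite: "f \<in> sector q \<Longrightarrow> finite {S. f S \<noteq> 0}"
  by (simp add: sector_def)

lemma sector_zero: "(\<lambda>S. 0) \<in> sector q"
  by (simp add: sector_def)

lemma sector_linear:
  assumes "f \<in> sector q" "g \<in> sector q"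
  shows "(\<lambda>S. c * f S + d * g S) \<in> sector q"
proof -
  have "finite {S. c * f S + d * g S \<noteq> 0}"
    by (rule finite_subset[of _ "{S. f S \<noteq> 0} \<union> {S. g S \<noteq> 0}"])
       (use assms in \<open>auto simp: sector_def\<close>)
  moreover have "in_sector q S" if "c * f S + d * g S \<noteq> 0" for S
    using that assms by (cases "f S = 0") (auto simp: sector_def)
  ultimately show ?thesis by (simp add: sector_def)
qed

lemma closed_sum:
  assumes zero: "(\<lambda>S. 0) \<in> U"
    and lin: "\<And>f g c d. f \<in> U \<Longrightarrow> g \<in> U \<Longrightarrow> (\<lambda>S. c * f S + d * g S :: complex) \<in> U"
    and "\<And>i. i \<in> A \<Longrightarrow> F i \<in> U"
  shows "(\<lambda>S. \<Sum>i\<in>A. c i * F i S) \<in> U"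
  using assms(3)
proof (induction A rule: infinite_finite_induct)
  case (insert a A)
  then have "(\<lambda>S. c a * F a S + 1 * (\<Sum>i\<in>A. c i * F i S)) \<in> U"
    by (intro lin) auto
  then show ?case using insert by simp
qed (simp_all add: zero)

lemma psi_support:
  assumes "psi k f T \<noteq> 0"
  obtains S where "f S \<noteq> 0" "int (nat \<bar>k\<bar>) mod 2 = p"
    "(nat \<bar>k\<bar> |\<in>| T \<and> S = T |-| {|nat \<bar>k\<bar>|}) \<or> (nat \<bar>k\<bar> |\<notin>| T \<and> S = finsert (nat \<bar>k\<bar>) T)"
proof -
  have "k mod 2 = p"
  proof (rule ccontr)
    assume "k mod 2 \<noteq> p"
    then have "psi k f = (\<lambda>S. 0)" by (rule psi_wrong_parity)
    then show False using assms by simp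
  qed
  then have m: "int (nat \<bar>k\<bar>) mod 2 = p" 
  proof -
    have "\<bar>k\<bar> mod 2 = k mod 2" by presburger
    then show ?thesis using \<open>k mod 2 = p\<close> by simp
  qed
  have "(nat \<bar>k\<bar> |\<in>| T \<and> f (T |-| {|nat \<bar>k\<bar>|}) \<noteq> 0) \<or> (nat \<bar>k\<bar> |\<notin>| T \<and> f (finsert (nat \<bar>k\<bar>) T) \<noteq> 0)"
  proof (cases k "0 :: int" rule: linorder_cases)
    case less
    then have "psi k f T = create (nat \<bar>k\<bar>) f T" using \<open>k mod 2 = p\<close> unfolding psi_def by simp
    then show ?thesis using assms by (simp add: create_def split: if_splits)
  next
    case equal
    then have "psi k f T = (create (nat \<bar>k\<bar>) f T + annihilate (nat \<bar>k\<bar>) f T) / complex_of_real (sqrt 2)"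
      using \<open>k mod 2 = p\<close> unfolding psi_def by simp
    then show ?thesis using assms by (simp add: create_def annihilate_def split: if_splits)
  next
    case greater
    then have "psi k f T = annihilate (nat \<bar>k\<bar>) f T" using \<open>k mod 2 = p\<close> unfolding psi_def by simp
    then show ?thesis using assms by (simp add: annihilate_def split: if_splits)
  qed
  then show ?thesis using m that by blast
qed

lemma psi_sector:
  assumes "f \<in> sector q" "q < 2"
  shows "psi k f \<in> sector (1 - q)"
proof -
  let ?a = "nat \<bar>k\<bar>"
  have "{T. psi k f T \<noteq> 0} \<subseteq> finsert ?a ` {S. f S \<noteq> 0} \<union> (\<lambda>S. S |-| {|?a|}) ` {S. f S \<noteq> 0}"
  proof
    fix T assume "T \<in> {T. psi k f T \<noteq> 0}"
    then obtain S where S: "f S \<noteq> 0"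
      "(?a |\<in>| T \<and> S = T |-| {|?a|}) \<or> (?a |\<notin>| T \<and> S = finsert ?a T)"
      by (auto elim: psi_support)
    then have "T = finsert ?a S \<or> T = S |-| {|?a|}" by auto
    then show "T \<in> finsert ?a ` {S. f S \<noteq> 0} \<union> (\<lambda>S. S |-| {|?a|}) ` {S. f S \<noteq> 0}"
      using S(1) by blast
  qed
  then have "finite {T. psi k f T \<noteq> 0}"
    by (rule finite_subset) (use assms in \<open>auto simp: sector_def\<close>)
  moreover have "in_sector (1 - q) T" if T: "psi k f T \<noteq> 0" for T
  proof -
    obtain S where S: "f S \<noteq> 0" "int ?a mod 2 = p"
      "(?a |\<in>| T \<and> S = T |-| {|?a|}) \<or> (?a |\<notin>| T \<and> S = finsert ?a T)"
      using T by (rule psi_support)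
    have flip: "Suc x mod 2 = 1 - x mod 2" "1 - (1 - x mod 2) = x mod 2" for x :: nat by presburger+
    have iS: "in_sector q S" using S(1) assms by (simp add: sector_def)
    from S(3) show ?thesis
    proof
      assume a: "?a |\<in>| T \<and> S = T |-| {|?a|}"
      then have "fcard T = Suc (fcard S)" using fcard_Suc_fminus1 by metis
      moreover have "allowed T"
        by (rule allowed_fminusD[of T ?a]) (use a iS S(2) in \<open>simp_all add: in_sector_def\<close>)
      ultimately show ?thesis using iS flip[of "fcard S"] unfolding in_sector_def by simp
    next
      assume a: "?a |\<notin>| T \<and> S = finsert ?a T"
      then have "fcard S = Suc (fcard T)" by (simp add: fcard_finsert_disjoint)
      moreover have "allowed T" using a iS by (simp add: in_sector_def)
      ultimately show ?thesis using iS flip[of "fcard T"] unfolding in_sector_def by simp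
    qed
  qed
  ultimately show ?thesis by (simp add: sector_def)
qed

lemma psi_psi_sector: "f \<in> sector q \<Longrightarrow> q < 2 \<Longrightarrow> psi a (psi b f) \<in> sector q"
proof -
  assume "f \<in> sector q" "q < 2"
  then have "psi a (psi b f) \<in> sector (1 - (1 - q))" by (intro psi_sector) auto
  moreover have "1 - (1 - q) = q" using \<open>q < 2\<close> by simp
  ultimately show ?thesis by simp
qed

lemma sector_bound:
  assumes "f \<in> sector q"
  obtains M where "\<And>S. f S \<noteq> 0 \<Longrightarrow> \<Sum>(fset S) \<le> M"
proof
  fix S assume "f S \<noteq> 0"
  then show "\<Sum>(fset S) \<le> Max ((\<lambda>S. \<Sum>(fset S)) ` {S. f S \<noteq> 0})"
    using sector_finite[OF assms] by (intro Max_ge) auto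
qed

lemma psi_above_bound:
  assumes "\<And>S. f S \<noteq> 0 \<Longrightarrow> \<Sum>(fset S) \<le> M" "k > int M"
  shows "psi k f = (\<lambda>T. 0)"
proof
  fix T
  have "f (finsert (nat k) T) = 0"
  proof (rule ccontr)
    assume "f (finsert (nat k) T) \<noteq> 0"
    then have "\<Sum>(fset (finsert (nat k) T)) \<le> M" by (rule assms(1))
    moreover have "nat k \<le> \<Sum>(fset (finsert (nat k) T))" by (rule fsum_ge) simp
    ultimately show False using assms(2) by linarith
  qed
  then show "psi k f T = 0" using assms(2) by (simp add: psi_def annihilate_def)
qed

text \<open>On a finitely supported function the inner annihilator vanishes for large
  \<open>i\<close> at every point. So \<open>vL n f\<close> is one finite combination of functions,
  not merely one at each point.\<close>

lemma vL_uniform: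
  assumes M: "\<And>S. f S \<noteq> 0 \<Longrightarrow> \<Sum>(fset S) \<le> M" and B: "B \<ge> nat \<bar>n\<bar> + M"
  shows "vL n f = (\<lambda>T. (\<Sum>i = 1..B. of_nat i / 2 * psi (n - int i) (psi (n + int i) f) T)
      + (if n = 0 then h0 * f T else 0))"
proof
  fix T
  have "(\<Sum>i = 1..B. of_nat i / 2 * psi (n - int i) (psi (n + int i) f) T)
     = (\<Sum>i = 1..B + (nat \<bar>n\<bar> + \<Sum>(fset T)). of_nat i / 2 * psi (n - int i) (psi (n + int i) f) T)"
  proof (rule sum.mono_neutral_left)
    show "\<forall>i\<in>{1..B + (nat \<bar>n\<bar> + \<Sum>(fset T))} - {1..B}.
       of_nat i / 2 * psi (n - int i) (psi (n + int i) f) T = 0"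
    proof
      fix i assume "i \<in> {1..B + (nat \<bar>n\<bar> + \<Sum>(fset T))} - {1..B}"
      then have "i > B" by auto
      then have "n + int i > int M" using B by linarith
      then show "of_nat i / 2 * psi (n - int i) (psi (n + int i) f) T = 0"
        using psi_above_bound[OF M] by simp
    qed
  qed auto
  then show "vL n f T = (\<Sum>i = 1..B. of_nat i / 2 * psi (n - int i) (psi (n + int i) f) T)
      + (if n = 0 then h0 * f T else 0)"
    using vL_truncate[of n T "B + (nat \<bar>n\<bar> + \<Sum>(fset T))" f] by simp
qed

lemma vL_sector:
  assumes f: "f \<in> sector q" and q: "q < 2"
  shows "vL n f \<in> sector q"
proof -
  obtain M where M: "\<And>S. f S \<noteq> 0 \<Longrightarrow> \<Sum>(fset S) \<le> M" using sector_bound[OF f] by blast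
  have "(\<lambda>T. \<Sum>i = 1..nat \<bar>n\<bar> + M. of_nat i / 2 * psi (n - int i) (psi (n + int i) f) T) \<in> sector q"
    by (rule closed_sum) (use sector_zero sector_linear psi_psi_sector f q in auto)
  then have "(\<lambda>T. 1 * (\<Sum>i = 1..nat \<bar>n\<bar> + M. of_nat i / 2 * psi (n - int i) (psi (n + int i) f) T)
      + (if n = 0 then h0 else 0) * f T) \<in> sector q"
    using f by (rule sector_linear)
  moreover have "vL n f = (\<lambda>T. 1 * (\<Sum>i = 1..nat \<bar>n\<bar> + M. of_nat i / 2 * psi (n - int i) (psi (n + int i) f) T)
      + (if n = 0 then h0 else 0) * f T)"
    by (subst vL_uniform[OF M order.refl]) auto
  ultimately show ?thesis by simp
qed

lemma vL_above_bound:
  assumes M: "\<And>S. f S \<noteq> 0 \<Longrightarrow> \<Sum>(fset S) \<le> M" and "j > int M"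
  shows "vL j f = (\<lambda>T. 0)"
  by (subst vL_uniform[OF M order.refl]) (use assms psi_above_bound[OF M] in auto)

lemma quartic_uniform:
  assumes M: "\<And>S. f S \<noteq> 0 \<Longrightarrow> \<Sum>(fset S) \<le> M"
  shows "quartic f = (\<lambda>T. 1 * vL 0 (vL 0 f) T + 2 * (\<Sum>j = 1..M. 1 * vL (- int j) (vL (int j) f) T))"
proof
  fix T
  have "(\<Sum>j = 1..M. vL (- int j) (vL (int j) f) T) = (\<Sum>j = 1..M + \<Sum>(fset T). vL (- int j) (vL (int j) f) T)"
    by (rule sum.mono_neutral_left) (auto simp: vL_above_bound[OF M])
  then show "quartic f T = 1 * vL 0 (vL 0 f) T + 2 * (\<Sum>j = 1..M. 1 * vL (- int j) (vL (int j) f) T)"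
    using quartic_truncate[of T "M + \<Sum>(fset T)" f] by simp
qed

lemma sector_expand:
  assumes "f \<in> sector q"
  shows "f = (\<lambda>T. \<Sum>S\<in>{S. f S \<noteq> 0}. f S * ket S T)"
proof
  fix T
  have "(\<Sum>S\<in>{S. f S \<noteq> 0}. f S * ket S T) = (\<Sum>S\<in>{S. f S \<noteq> 0}. if S = T then f S else 0)"
    by (intro sum.cong) (auto simp: ket_def)
  also have "\<dots> = f T" using sector_finite[OF assms] by simp
  finally show "f T = (\<Sum>S\<in>{S. f S \<noteq> 0}. f S * ket S T)" by simp
qed

lemma lin_op_sector_zero:
  assumes "lin_op X" "f \<in> sector q" and "\<And>S. allowed S \<Longrightarrow> X (ket S) T = 0"
  shows "X f T = 0"
proof -
  have "X f T = (\<Sum>S\<in>{S. f S \<noteq> 0}. f S * X (ket S) T)"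
    using lin_op_sum[OF assms(1), of f ket "{S. f S \<noteq> 0}" T] sector_expand[OF assms(2)] by simp
  also have "\<dots> = 0"
    using assms by (intro sum.neutral) (auto simp: sector_def in_sector_def)
  finally show ?thesis .
qed

lemma sector_not_allowed: "f \<in> sector q \<Longrightarrow> \<not> allowed T \<Longrightarrow> f T = 0"
  by (auto simp: sector_def in_sector_def)

text \<open>The defect vanishes on allowed occupation states, hence on the sector by finite support.
  At a point that contains a mode of the wrong parity every term is zero by itself.\<close>

lemma virasoro_relation:
  assumes "f \<in> sector q" "q < 2"
  shows "vL m (vL n f) S - vL n (vL m f) S
    = of_int (m - n) * vL (m + n) f S + (if m = - n then of_int (m ^ 3 - m) / 24 else 0) * f S"
proof (cases "allowed S")
  case True
  then have "vir_defect m n f S = 0"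
    using lin_op_sector_zero[OF lin_op_vir_defect assms(1)] vir_defect_ket by blast
  then show ?thesis by (simp add: vir_defect_def)
next
  case False
  then show ?thesis
    using assms sector_not_allowed[of f q S] sector_not_allowed[OF vL_sector[OF vL_sector]]
      sector_not_allowed[OF vL_sector] by simp
qed

section \<open>Subspaces stable under the Virasoro operators\<close>

definition stable :: "nat \<Rightarrow> fock set \<Rightarrow> bool" where
  "stable q U \<longleftrightarrow> U \<subseteq> sector q \<and> (\<lambda>T. 0) \<in> U
     \<and> (\<forall>f\<in>U. \<forall>g\<in>U. \<forall>c d. (\<lambda>T. c * f T + d * g T) \<in> U) \<and> (\<forall>f\<in>U. \<forall>n. vL n f \<in> U)"

lemma stable_sector: "q < 2 \<Longrightarrow> stable q (sector q)"
  by (simp add: stable_def sector_zero sector_linear vL_sector)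

lemma stable_linear: "stable q U \<Longrightarrow> f \<in> U \<Longrightarrow> g \<in> U \<Longrightarrow> (\<lambda>T. c * f T + d * g T) \<in> U"
  unfolding stable_def by blast

lemma stable_scale: "stable q U \<Longrightarrow> f \<in> U \<Longrightarrow> (\<lambda>T. c * f T) \<in> U"
  using stable_linear[of q U f f c 0] by simp

lemma stable_quartic:
  assumes U: "stable q U" and f: "f \<in> U"
  shows "quartic f \<in> U"
proof -
  have "f \<in> sector q" using assms by (auto simp: stable_def)
  then obtain M where M: "\<And>S. f S \<noteq> 0 \<Longrightarrow> \<Sum>(fset S) \<le> M" using sector_bound by blast
  have v: "g \<in> U \<Longrightarrow> vL n g \<in> U" for g n using U by (simp add: stable_def)
  have 1: "(\<lambda>T. \<Sum>j = 1..M. 1 * vL (- int j) (vL (int j) f) T) \<in> U"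
    by (rule closed_sum) (use U v f in \<open>auto simp: stable_def\<close>)
  have 2: "vL 0 (vL 0 f) \<in> U" using v f by blast
  have "quartic f = (\<lambda>T. 1 * vL 0 (vL 0 f) T + 2 * (\<Sum>j = 1..M. 1 * vL (- int j) (vL (int j) f) T))"
    by (rule quartic_uniform) (rule M)
  then show ?thesis using stable_linear[OF U 2 1] by (simp only:)
qed

lemma quartic_psi:
  assumes f: "f \<in> sector q" "q < 2"
  shows "quartic (psi s f) T = psi s (quartic f) T + kappa s * psi s f T"
proof (cases "allowed T")
  case True
  let ?X = "\<lambda>f T. quartic (psi s f) T - psi s (quartic f) T - kappa s * psi s f T"
  have "lin_op ?X"
    using lin_opD[OF lin_op_comp[OF lin_op_quartic lin_op_psi]] lin_opD[OF lin_op_psi]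
      lin_opD[OF lin_op_comp[OF lin_op_psi lin_op_quartic]]
    by (simp add: lin_op_def algebra_simps)
  then have "?X f T = 0"
    by (rule lin_op_sector_zero[OF _ f(1)]) (use quartic_psi_ket True in simp)
  then show ?thesis by (simp add: algebra_simps)
next
  case False
  have ps: "g \<in> sector q \<Longrightarrow> psi s g \<in> sector (1 - q)" for g using f(2) by (intro psi_sector)
  have qu: "g \<in> sector q' \<Longrightarrow> q' < 2 \<Longrightarrow> quartic g \<in> sector q'" for g q'
    using stable_quartic[OF stable_sector] .
  show ?thesis
    using sector_not_allowed[OF qu[OF ps[OF f(1)]] False] sector_not_allowed[OF ps[OF qu[OF f]] False]
      sector_not_allowed[OF ps[OF f(1)] False] by simp
qed

lemma quartic_psi_psi:
  assumes f: "f \<in> sector q" "q < 2"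
  shows "quartic (psi a (psi b f)) T
    = psi a (psi b (quartic f)) T + (kappa a + kappa b) * psi a (psi b f) T"
proof -
  have "quartic (psi a (psi b f)) T = psi a (quartic (psi b f)) T + kappa a * psi a (psi b f) T"
    by (rule quartic_psi[where q = "1 - q"]) (use psi_sector f in auto)
  also have "quartic (psi b f) = (\<lambda>T. psi b (quartic f) T + kappa b * psi b f T)"
    by (rule ext) (rule quartic_psi[OF f])
  finally show ?thesis by (simp add: psi_add psi_scale algebra_simps)
qed

text \<open>The odd powers of \<open>i\<close> cancel, and the cubic leaves \<open>n * i^2\<close>
  as the only dependence on \<open>i\<close>. For nonzero \<open>n\<close> it is injective on
  natural numbers.\<close>

lemma kappa_pair: "kappa (n - int i) + kappa (n + int i)
    = - (14 * (of_int n) ^ 3 + 10 * of_int n) / 48 - 42 * of_int n * (of_nat i)\<^sup>2 / 48"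
proof -
  have key: "(7 * (x - y) ^ 3 + 5 * (x - y)) + (7 * (x + y) ^ 3 + 5 * (x + y))
      = (14 * x ^ 3 + 10 * x) + 42 * x * y\<^sup>2" for x y :: complex
    by (simp add: power3_eq_cube power2_eq_square algebra_simps)
  have split: "- u / 48 + - v / 48 = - (u + v) / 48" "- (u + v) / 48 = - u / 48 - v / 48" for u v :: complex
    by (simp_all add: add_divide_distrib)
  show ?thesis
    unfolding kappa_def of_int_add of_int_diff of_int_of_nat_eq
    by (simp only: split(1) key) (simp only: split(2))
qed

lemma kappa_pair_inj:
  assumes "n \<noteq> 0" "kappa (n - int i) + kappa (n + int i) = kappa (n - int j) + kappa (n + int j)"
  shows "i = j"
proof -
  have "(of_nat i :: complex)\<^sup>2 = (of_nat j)\<^sup>2" using assms by (simp add: kappa_pair)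
  then have "(of_nat (i\<^sup>2) :: complex) = of_nat (j\<^sup>2)" by simp
  then have "i\<^sup>2 = j\<^sup>2" by (simp only: of_nat_eq_iff)
  then show ?thesis by simp
qed

text \<open>Commutators with \<^term>\<open>quartic\<close> multiply the bilinear terms of \<open>L\<^sub>n\<close> by distinct numbers,
  so polynomial interpolation isolates each term.\<close>

lemma stable_psi_psi_pair:
  assumes U: "stable q U" and q: "q < 2" and f: "f \<in> U" and n: "n \<noteq> 0" and i0: "i0 \<ge> 1"
  shows "psi (n - int i0) (psi (n + int i0) f) \<in> U"
proof -
  define P where "P i f = psi (n - int i) (psi (n + int i) f)" for i f
  define \<mu> where "\<mu> i = kappa (n - int i) + kappa (n + int i)" for i
  have sec: "g \<in> U \<Longrightarrow> g \<in> sector q" for g using U by (auto simp: stable_def)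
  \<comment> \<open>Quantified over all \<open>f\<close> because the induction step also uses
    \<open>quartic f\<close>, and over all large \<open>B\<close> because these two functions come
    with different truncation bounds.\<close>
  have claim: "\<forall>f\<in>U. \<exists>B0. \<forall>B\<ge>B0. (\<lambda>T. \<Sum>i = 1..B. (of_nat i / 2 * (\<Prod>r\<in>R. \<mu> i - r)) * P i f T) \<in> U"
    if "finite R" for R
    using that
  proof (induction R)
    case empty
    show ?case
    proof
      fix f assume f: "f \<in> U"
      obtain M where M: "\<And>S. f S \<noteq> 0 \<Longrightarrow> \<Sum>(fset S) \<le> M" using sector_bound[OF sec[OF f]] by blast
      have "(\<lambda>T. \<Sum>i = 1..B. (of_nat i / 2 * (\<Prod>r\<in>{}. \<mu> i - r)) * P i f T) \<in> U"
        if "B \<ge> nat \<bar>n\<bar> + M" for B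
      proof -
        have "vL n f \<in> U" using U f by (simp add: stable_def)
        then show ?thesis using vL_uniform[OF M that] n by (simp add: P_def)
      qed
      then show "\<exists>B0. \<forall>B\<ge>B0. (\<lambda>T. \<Sum>i = 1..B. (of_nat i / 2 * (\<Prod>r\<in>{}. \<mu> i - r)) * P i f T) \<in> U"
        by blast
    qed
  next
    case (insert r R)
    let ?G = "\<lambda>B f T. \<Sum>i = 1..B. (of_nat i / 2 * (\<Prod>r\<in>R. \<mu> i - r)) * P i f T"
    show ?case
    proof
      fix f assume f: "f \<in> U"
      have qf: "quartic f \<in> U" by (rule stable_quartic[OF U f])
      obtain B1 where B1: "\<And>B. B \<ge> B1 \<Longrightarrow> ?G B f \<in> U" using insert.IH f by blast
      obtain B2 where B2: "\<And>B. B \<ge> B2 \<Longrightarrow> ?G B (quartic f) \<in> U" using insert.IH qf by blast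
      have "(\<lambda>T. \<Sum>i = 1..B. (of_nat i / 2 * (\<Prod>r\<in>insert r R. \<mu> i - r)) * P i f T) \<in> U"
        if "B \<ge> max B1 B2" for B
      proof -
        have g: "?G B f \<in> U" "?G B (quartic f) \<in> U" using B1 B2 that by auto
        have Q: "quartic (?G B f) T = (\<Sum>i = 1..B. (of_nat i / 2 * (\<Prod>r\<in>R. \<mu> i - r)) * (P i (quartic f) T + \<mu> i * P i f T))" for T
          unfolding lin_op_sum[OF lin_op_quartic] P_def \<mu>_def
          by (simp only: quartic_psi_psi[OF sec[OF f] q])
        \<comment> \<open>The commutator with \<open>quartic\<close> minus \<open>r\<close>
          multiplies the \<open>i\<close>-th summand by \<open>\<mu> i - r\<close>, which adds one
          root to the interpolation polynomial.\<close>
        have "(\<lambda>T. 1 * (1 * quartic (?G B f) T + (- 1) * ?G B (quartic f) T) + (- r) * ?G B f T) \<in> U"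
          by (intro stable_linear[OF U] stable_quartic[OF U] g)
        also have "(\<lambda>T. 1 * (1 * quartic (?G B f) T + (- 1) * ?G B (quartic f) T) + (- r) * ?G B f T)
          = (\<lambda>T. \<Sum>i = 1..B. (of_nat i / 2 * (\<Prod>r\<in>insert r R. \<mu> i - r)) * P i f T)"
        proof
          fix T
          have "(\<Sum>i = 1..B. (of_nat i / 2 * (\<Prod>r\<in>insert r R. \<mu> i - r)) * P i f T)
            = (\<Sum>i = 1..B. (of_nat i / 2 * (\<Prod>r\<in>R. \<mu> i - r)) * (P i (quartic f) T + \<mu> i * P i f T)
               - (of_nat i / 2 * (\<Prod>r\<in>R. \<mu> i - r)) * P i (quartic f) T
               - r * ((of_nat i / 2 * (\<Prod>r\<in>R. \<mu> i - r)) * P i f T))"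
            using insert.hyps by (intro sum.cong) (simp_all add: field_simps)
          also have "\<dots> = quartic (?G B f) T - ?G B (quartic f) T - r * ?G B f T"
            unfolding Q sum_subtractf sum_distrib_left by (rule refl)
          finally show "1 * (1 * quartic (?G B f) T + (- 1) * ?G B (quartic f) T) + (- r) * ?G B f T
            = (\<Sum>i = 1..B. (of_nat i / 2 * (\<Prod>r\<in>insert r R. \<mu> i - r)) * P i f T)" by simp
        qed
        finally show ?thesis .
      qed
      then show "\<exists>B0. \<forall>B\<ge>B0. (\<lambda>T. \<Sum>i = 1..B. (of_nat i / 2 * (\<Prod>r\<in>insert r R. \<mu> i - r)) * P i f T) \<in> U"
        by blast
    qed
  qed
  obtain M where M: "\<And>S. f S \<noteq> 0 \<Longrightarrow> \<Sum>(fset S) \<le> M" using sector_bound[OF sec[OF f]] by blast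
  \<comment> \<open>Roots for the finitely many indices that can contribute to \<open>f\<close>,
    apart from \<open>i0\<close>. Beyond \<open>\<bar>n\<bar> + M\<close> the inner mode annihilates
    \<open>f\<close>.\<close>
  define R where "R = \<mu> ` ({1..nat \<bar>n\<bar> + M} - {i0})"
  obtain B0 where B0: "\<And>B. B \<ge> B0 \<Longrightarrow> (\<lambda>T. \<Sum>i = 1..B. (of_nat i / 2 * (\<Prod>r\<in>R. \<mu> i - r)) * P i f T) \<in> U"
    using claim[of R] f by (auto simp: R_def)
  define B where "B = B0 + i0"
  let ?c = "of_nat i0 / 2 * (\<Prod>r\<in>R. \<mu> i0 - r)"
  have c: "?c \<noteq> 0"
    using i0 kappa_pair_inj[OF n] by (auto simp: R_def \<mu>_def)
  have eq: "(\<Sum>i = 1..B. (of_nat i / 2 * (\<Prod>r\<in>R. \<mu> i - r)) * P i f T) = ?c * P i0 f T" for T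
  proof -
    have "(\<Sum>i = 1..B. (of_nat i / 2 * (\<Prod>r\<in>R. \<mu> i - r)) * P i f T)
      = (\<Sum>i\<in>{i0}. (of_nat i / 2 * (\<Prod>r\<in>R. \<mu> i - r)) * P i f T)"
    proof (rule sum.mono_neutral_right)
      show "\<forall>i\<in>{1..B} - {i0}. (of_nat i / 2 * (\<Prod>r\<in>R. \<mu> i - r)) * P i f T = 0"
      proof
        fix i assume i: "i \<in> {1..B} - {i0}"
        show "(of_nat i / 2 * (\<Prod>r\<in>R. \<mu> i - r)) * P i f T = 0"
        proof (cases "i \<le> nat \<bar>n\<bar> + M")
          case True
          then have "\<mu> i \<in> R" "finite R" using i by (auto simp: R_def)
          then show ?thesis by (auto intro!: prod_zero)
        next
          case False
          then have "n + int i > int M" by linarith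
          then show ?thesis by (simp add: P_def psi_above_bound[OF M])
        qed
      qed
    qed (use i0 in \<open>auto simp: B_def\<close>)
    then show ?thesis by simp
  qed
  have "B \<ge> B0" by (simp add: B_def)
  from B0[OF this] have "(\<lambda>T. ?c * P i0 f T) \<in> U" unfolding eq .
  then have "(\<lambda>T. (1 / ?c) * (?c * P i0 f T)) \<in> U" by (rule stable_scale[OF U])
  then show ?thesis using c by (simp add: P_def)
qed

text \<open>Indices of equal parity have the form \<open>n - i\<close> and \<open>n + i\<close> with
  \<open>2 * n = a + b\<close>. Their order matters only up to sign, as a nonzero
  \<open>a + b\<close> rules out a contraction; for the same reason equal indices give zero.\<close>

lemma stable_psi_psi:
  assumes U: "stable q U" and q: "q < 2" and f: "f \<in> U" and ab: "a + b \<noteq> 0"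
  shows "psi a (psi b f) \<in> U"
proof -
  have z: "(\<lambda>T. 0) \<in> U" using U by (simp add: stable_def)
  have less: "psi a (psi b f) \<in> U" if "a < b" "a mod 2 = b mod 2" "a + b \<noteq> 0" for a b
  proof -
    define n i where "n = (a + b) div 2" and "i = nat ((b - a) div 2)"
    have "even (a + b)" "even (b - a)" using that(2) by presburger+
    then have "a + b = 2 * n" "b - a = 2 * ((b - a) div 2)" unfolding n_def by simp_all
    then have "a = n - int i" "b = n + int i" "n \<noteq> 0" "i \<ge> 1" using that by (auto simp: i_def)
    then show ?thesis using stable_psi_psi_pair[OF U q f] by blast
  qed
  have sw: "psi a (psi b f) = (\<lambda>T. - 1 * psi b (psi a f) T)"
    using psi_anticomm[of a b f] ab by (auto simp: anti_def)
  consider "a mod 2 \<noteq> p" | "b mod 2 \<noteq> p" | "a mod 2 = b mod 2" "a < b"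
    | "a mod 2 = b mod 2" "b < a" | "a = b" by linarith
  then show ?thesis
  proof cases
    case 1
    then show ?thesis using z by (simp add: psi_wrong_parity)
  next
    case 2
    have "psi a (\<lambda>T. 0) = (\<lambda>T. 0)" by auto
    then show ?thesis using z 2 by (simp add: psi_wrong_parity)
  next
    case 3
    then show ?thesis using less ab by blast
  next
    case 4
    have "psi b (psi a f) \<in> U" by (rule less) (use 4 ab in auto)
    then show ?thesis unfolding sw by (rule stable_scale[OF U])
  next
    case 5
    have "psi a (psi b f) T = 0" for T using psi_psi[of a b f T] ab 5 by (simp add: anti_def)
    then show ?thesis using z by (metis ext)
  qed
qed

section \<open>Moving between occupation states\<close>

lemma psi_lower_value:
  assumes "a |\<notin>| T" "int a mod 2 = p"
  obtains c where "c \<noteq> 0" "\<And>f. psi (int a) f T = c * f (finsert a T)"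
proof (cases "a = 0")
  case True
  then have "psi (int a) f T = (create 0 f T + annihilate 0 f T) / complex_of_real (sqrt 2)" for f
    unfolding psi_def using assms by simp
  then have "psi (int a) f T = fsign 0 T / complex_of_real (sqrt 2) * f (finsert a T)" for f
    using assms True by (simp add: create_def annihilate_def)
  then show ?thesis by (intro that[of "fsign 0 T / complex_of_real (sqrt 2)"]) (auto simp: fsign_def)
next
  case False
  then have "psi (int a) f T = annihilate a f T" for f
    unfolding psi_def using assms by simp
  then show ?thesis
    using assms by (intro that[of "fsign a T"]) (auto simp: annihilate_def fsign_def)
qed

text \<open>The zero mode fits the same pattern: \<open>psi 0\<close> both creates and annihilates,
  but on a state without 0 only creation survives, with a factor \<open>1 / sqrt 2\<close>.\<close>

lemma psi_raise_ket:
  assumes "a |\<notin>| S" "int a mod 2 = p"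
  obtains c where "c \<noteq> 0" "psi (- int a) (ket S) = (\<lambda>T. c * ket (finsert a S) T)"
proof (cases "a = 0")
  case True
  then have "psi (- int a) (ket S) = (\<lambda>T. (create 0 (ket S) T + annihilate 0 (ket S) T) / complex_of_real (sqrt 2))"
    unfolding psi_def using assms by simp
  then have "psi (- int a) (ket S) = (\<lambda>T. fsign 0 S / complex_of_real (sqrt 2) * ket (finsert a S) T)"
    using assms True by (simp add: create_ket annihilate_ket)
  then show ?thesis by (intro that[of "fsign 0 S / complex_of_real (sqrt 2)"]) (auto simp: fsign_def)
next
  case False
  have "(- int a) mod 2 = int a mod 2" by presburger
  then have "psi (- int a) (ket S) = create a (ket S)" using assms False unfolding psi_def by simp
  then show ?thesis
    using create_ket[OF assms(1)] by (intro that[of "fsign a S"]) (auto simp: fsign_def)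
qed

text \<open>The lowest state of the sector. The value \<open>q = 1\<close> is paired only with
  \<open>p = 1\<close>, where 1 is the smallest mode; in the Ramond case the even sector represents
  the weight 1/16.\<close>

definition base_state :: "nat \<Rightarrow> nat fset" where
  "base_state q = (if q = 0 then {||} else {|1|})"

text \<open>The condition \<open>b > 0\<close> makes \<open>a + b\<close> nonzero, so that both the
  product of the annihilators and that of the creators of \<open>a\<close> and \<open>b\<close>
  preserve stable subspaces.\<close>

lemma fcard_two:
  fixes S :: "nat fset"
  assumes "fcard S \<ge> 2"
  obtains a b S' where "a |\<notin>| finsert b S'" "b |\<notin>| S'" "b > 0" "S = finsert a (finsert b S')"
proof -
  have "\<not> fset S \<subseteq> {0}"
  proof
    assume "fset S \<subseteq> {0}"
    then have "card (fset S) \<le> 1" using card_mono[of "{0}" "fset S"] by simp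
    then show False using assms by (simp add: fcard.rep_eq)
  qed
  then obtain b where b: "b |\<in>| S" "b > 0" by auto
  have "S |-| {|b|} \<noteq> {||}"
  proof
    assume e: "S |-| {|b|} = {||}"
    show False using assms fcard_Suc_fminus1[OF b(1)] unfolding e fcard_fempty by simp
  qed
  then obtain a where a: "a |\<in>| S |-| {|b|}" by auto
  show ?thesis
    by (rule that[of a b "S |-| {|b|} |-| {|a|}"]) (use a b in auto)
qed

lemma sector_cases:
  assumes S: "in_sector q S" and q: "q = 0 \<or> q = 1 \<and> p = 1"
  obtains "S = base_state q" | a where "q = 1" "a \<noteq> 1" "S = {|a|}" "int a mod 2 = p"
  | a b S' where "a |\<notin>| finsert b S'" "b |\<notin>| S'" "b > 0" "S = finsert a (finsert b S')"
      "int a mod 2 = p" "int b mod 2 = p" "in_sector q S'"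
proof -
  have al: "allowed S" "fcard S mod 2 = q" using S by (auto simp: in_sector_def)
  consider "fcard S = 0" | "fcard S = 1" | "fcard S \<ge> 2" by linarith
  then show ?thesis
  proof cases
    case 1
    then have "q = 0" using al(2) unfolding 1 by simp
    moreover have "S = {||}" using 1 by simp
    ultimately have "S = base_state q" by (simp add: base_state_def)
    then show ?thesis using that(1) by blast
  next
    case 2
    then have "q = 1" using al(2) by simp
    have "card (fset S) = 1" using 2 by (simp add: fcard.rep_eq)
    then obtain a where "fset S = {a}" using card_1_singletonE by blast
    then have a: "S = {|a|}" by (simp add: fset_inject[symmetric])
    have "int a mod 2 = p" using al(1) a by simp
    then show ?thesis using that(1) that(2)[of a] \<open>q = 1\<close> a by (auto simp: base_state_def)
  next
    case 3
    then obtain a b S' where s: "a |\<notin>| finsert b S'" "b |\<notin>| S'" "b > 0" "S = finsert a (finsert b S')"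
      by (rule fcard_two)
    have "int a mod 2 = p" "int b mod 2 = p" "allowed S'" using al(1) s(4) by auto
    moreover have "fcard S = Suc (Suc (fcard S'))" using s by (simp add: fcard_finsert_disjoint)
    then have "fcard S' mod 2 = q" using al(2) by simp
    ultimately show ?thesis using that(3)[OF s] by (simp add: in_sector_def)
  qed
qed

text \<open>Two annihilators carry a nonzero coefficient at \<open>S\<close> to a smaller set. A
  single mode other than 1 is exchanged for 1 by \<open>psi (- 1)\<close> after
  \<open>psi a\<close>, whose indices do not cancel. Only a nonzero coefficient at the base state
  results, not the base state itself; this suffices for \<open>joint_kernel_right\<close>.\<close>

lemma psi_psi_lower:
  assumes U: "stable q U" and q2: "q < 2" and f: "f \<in> U" "f S \<noteq> 0" and q: "q = 0 \<or> q = 1 \<and> p = 1"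
  shows "\<exists>g\<in>U. g (base_state q) \<noteq> 0"
  using f
proof (induction "fcard S" arbitrary: S f rule: less_induct)
  case less
  have "in_sector q S" using less.prems U by (auto simp: stable_def sector_def)
  then show ?case using q
  proof (cases rule: sector_cases)
    case 1
    then show ?thesis using less.prems by blast
  next
    case (2 a)
    obtain c where c: "c \<noteq> 0" "\<And>f. psi (int a) f {||} = c * f {|a|}"
      using psi_lower_value[of a "{||}"] 2 by auto
    have "psi (- 1) (psi (int a) f) {|1|} = psi (int a) f {||}"
    proof -
      have e: "{s. s |\<in>| {|1|} \<and> s < 1} = ({} :: nat set)" by auto
      have "fsign 1 {|1|} = 1" unfolding fsign_def e by simp
      then have "create 1 g {|1|} = g {||}" for g by (simp add: create_def)
      moreover have "psi (- 1) g = create 1 g" for g using q 2 unfolding psi_def by simp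
      ultimately show ?thesis by simp
    qed
    then have "psi (- 1) (psi (int a) f) (base_state q) \<noteq> 0"
      using c 2 less.prems by (simp add: base_state_def)
    moreover have "psi (- 1) (psi (int a) f) \<in> U"
      by (rule stable_psi_psi[OF U q2 less.prems(1)]) (use 2 in auto)
    ultimately show ?thesis by blast
  next
    case (3 a b S')
    obtain c where c: "c \<noteq> 0" "\<And>f. psi (int a) f S' = c * f (finsert a S')"
      using psi_lower_value[of a S'] 3 by auto
    obtain d where d: "d \<noteq> 0" "\<And>f. psi (int b) f (finsert a S') = d * f (finsert b (finsert a S'))"
      using psi_lower_value[of b "finsert a S'"] 3 by auto
    have "psi (int a) (psi (int b) f) S' = c * (d * f S)"
      using c d 3 by (simp add: finsert_commute[of a b])
    then have "psi (int a) (psi (int b) f) S' \<noteq> 0" using c d less.prems by simp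
    moreover have "psi (int a) (psi (int b) f) \<in> U"
      by (rule stable_psi_psi[OF U q2 less.prems(1)]) (use 3 in auto)
    moreover have "fcard S' < fcard S" using 3 by (simp add: fcard_finsert_disjoint)
    ultimately show ?thesis using less.hyps by blast
  qed
qed

lemma ket_cong_scale:
  assumes U: "stable q U" and "(\<lambda>T. c * ket S T) \<in> U" "c \<noteq> 0"
  shows "ket S \<in> U"
  using stable_scale[OF U assms(2), of "1 / c"] assms(3) by simp

text \<open>The same moves backwards: pairs of creators build \<open>S\<close> from the base state,
  and a single mode is exchanged by annihilating 1 and creating \<open>a\<close>.\<close>

lemma psi_psi_raise:
  assumes U: "stable q U" and q2: "q < 2" and b: "ket (base_state q) \<in> U"
    and q: "q = 0 \<or> q = 1 \<and> p = 1" and S: "in_sector q S"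
  shows "ket S \<in> U"
  using S
proof (induction "fcard S" arbitrary: S rule: less_induct)
  case less
  show ?case using less.prems q
  proof (cases rule: sector_cases)
    case 1
    then show ?thesis using b by simp
  next
    case (2 a)
    have "p = 1" using q 2 by simp
    have e: "psi 1 (ket {|1|}) = (\<lambda>T. 1 * ket {||} T)"
    proof
      fix T
      have "psi 1 g = annihilate 1 g" for g using \<open>p = 1\<close> unfolding psi_def by simp
      moreover have "annihilate 1 (ket {|1|}) T = 1 * ket {||} T"
      proof (cases "T = {||}")
        case True
        then show ?thesis by (simp add: annihilate_def ket_def fsign_def)
      next
        case False
        then have "1 |\<in>| T \<or> finsert 1 T \<noteq> {|1|}" by auto
        then show ?thesis using False by (auto simp: annihilate_def ket_def)
      qed
      ultimately show "psi 1 (ket {|1|}) T = 1 * ket {||} T" by simp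
    qed
    obtain c where c: "c \<noteq> 0" "psi (- int a) (ket {||}) = (\<lambda>T. c * ket {|a|} T)"
      using psi_raise_ket[of a "{||}"] 2 by auto
    have "psi (- int a) (psi 1 (ket {|1|})) = (\<lambda>T. c * ket S T)"
      using c 2 unfolding e fcard_fempty by simp
    moreover have "psi (- int a) (psi 1 (ket {|1|})) \<in> U"
      by (rule stable_psi_psi[OF U q2]) (use b 2 in \<open>auto simp: base_state_def\<close>)
    ultimately show ?thesis using ket_cong_scale[OF U] c by simp
  next
    case (3 a b S')
    have IH: "ket S' \<in> U" using less.hyps 3 by (simp add: fcard_finsert_disjoint)
    obtain c where c: "c \<noteq> 0" "psi (- int b) (ket S') = (\<lambda>T. c * ket (finsert b S') T)"
      using psi_raise_ket[of b S'] 3 by auto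
    obtain d where d: "d \<noteq> 0" "psi (- int a) (ket (finsert b S')) = (\<lambda>T. d * ket S T)"
      using psi_raise_ket[of a "finsert b S'"] 3 by auto
    have "psi (- int a) (psi (- int b) (ket S')) = (\<lambda>T. (c * d) * ket S T)"
      unfolding c(2) using d(2) by (auto simp: psi_scale)
    moreover have "psi (- int a) (psi (- int b) (ket S')) \<in> U"
      by (rule stable_psi_psi[OF U q2 IH]) (use 3 in auto)
    ultimately show ?thesis using ket_cong_scale[OF U] c d by simp
  qed
qed

lemma vL_0_ket: "allowed S \<Longrightarrow> vL 0 (ket S) = (\<lambda>T. (h0 + of_nat (\<Sum>(fset S)) / 2) * ket S T)"
proof (induction S)
  case empty
  have "bottom {||}" by (simp add: bottom_def allowed_def)
  then show ?case using vL_bottom_right[of "{||}" 0] by simp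
next
  case (insert a S)
  then have "int a mod 2 = p" "allowed S" by auto
  then obtain c where c: "c \<noteq> 0" "psi (- int a) (ket S) = (\<lambda>T. c * ket (finsert a S) T)"
    using psi_raise_ket insert by blast
  show ?case
  proof
    fix T
    have "c * vL 0 (ket (finsert a S)) T = vL 0 (psi (- int a) (ket S)) T"
      unfolding c(2) by (simp add: vL_scale)
    also have "\<dots> = psi (- int a) (vL 0 (ket S)) T + of_nat a / 2 * psi (- int a) (ket S) T"
      using vL_psi[of 0 "- int a" "ket S" T] by simp
    also have "\<dots> = (h0 + of_nat (\<Sum>(fset S)) / 2 + of_nat a / 2) * psi (- int a) (ket S) T"
      unfolding insert.IH[OF \<open>allowed S\<close>] psi_scale by (simp only: algebra_simps)
    also have "\<dots> = c * ((h0 + of_nat (\<Sum>(fset S)) / 2 + of_nat a / 2) * ket (finsert a S) T)"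
      unfolding c(2) by simp
    finally have "vL 0 (ket (finsert a S)) T
        = (h0 + of_nat (\<Sum>(fset S)) / 2 + of_nat a / 2) * ket (finsert a S) T"
      using c(1) by simp
    also have "of_nat (\<Sum>(fset S)) / 2 + of_nat a / 2 = (of_nat (\<Sum>(fset (finsert a S))) / 2 :: complex)"
      using insert.hyps by (simp add: add_divide_distrib)
    then have "h0 + of_nat (\<Sum>(fset S)) / 2 + of_nat a / 2 = h0 + of_nat (\<Sum>(fset (finsert a S))) / 2"
      by (simp only: add.assoc)
    finally show "vL 0 (ket (finsert a S)) T
        = (h0 + of_nat (\<Sum>(fset (finsert a S))) / 2) * ket (finsert a S) T" .
  qed
qed

lemma vL_0_sector:
  assumes "f \<in> sector q"
  shows "vL 0 f T = (h0 + of_nat (\<Sum>(fset T)) / 2) * f T"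
proof -
  have "lin_op (\<lambda>f T. vL 0 f T - (h0 + of_nat (\<Sum>(fset T)) / 2) * f T)"
    by (simp add: lin_op_def vL_linear algebra_simps)
  then have "vL 0 f T - (h0 + of_nat (\<Sum>(fset T)) / 2) * f T = 0"
  proof (rule lin_op_sector_zero[OF _ assms])
    fix S assume "allowed S"
    show "vL 0 (ket S) T - (h0 + of_nat (\<Sum>(fset T)) / 2) * ket S T = 0"
      unfolding vL_0_ket[OF \<open>allowed S\<close>] by (simp add: ket_def)
  qed
  then show ?thesis by simp
qed

end

section \<open>Comparison with an irreducible module\<close>

text \<open>Weights contain halved energies. Doubling yields equations of integers, to which
  minimality of the base energy applies.\<close>

lemma half_difference:
  assumes "x + u / 2 = x + w / 2 - v"
  shows "u + 2 * v = (w :: complex)"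
proof -
  have "2 * (u / 2) = 2 * (w / 2 - v)" using assms by (simp add: algebra_simps)
  then show ?thesis by (simp add: algebra_simps)
qed

text \<open>An arbitrary irreducible module together with the Fock sector of the same lowest weight:
  \<open>h\<close> is 1/16 for \<open>p = 0\<close>, and for \<open>p = 1\<close> it is 0 or 1/2
  according to \<open>q\<close>.\<close>

locale ising_pair = fermion p + irreducible_highest_weight_module smul L C "1/2" h
  for p :: int and smul :: "complex \<Rightarrow> 'v::ab_group_add \<Rightarrow> 'v"
    and L :: "int \<Rightarrow> 'v \<Rightarrow> 'v" and C :: "'v \<Rightarrow> 'v" and h :: complex +
  fixes q :: nat and hv :: 'v
  assumes q: "q = 0 \<or> q = 1 \<and> p = 1"
    and h: "h = h0 + of_nat (\<Sum>(fset (base_state q))) / 2"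
    and hv: "highest_weight_vector h hv"
begin

lemma q2: "q < 2" using q by auto

lemma L_add: "L n (x + y) = L n x + L n y"
  using linear_L[of n] by (simp add: Vector_Spaces.linear_iff)

lemma L_scale: "L n (smul c x) = smul c (L n x)"
  using linear_L[of n] by (simp add: Vector_Spaces.linear_iff)

lemma L_zero [simp]: "L n 0 = 0"
  using L_scale[of n 0 0] by simp

lemma L_sum: "L n (\<Sum>i\<in>A. f i) = (\<Sum>i\<in>A. L n (f i))"
  by (induction A rule: infinite_finite_induct) (auto simp: L_add)

lemma L_comm: "L m (L n x) = L n (L m x)
    + smul (of_int (m - n)) (L (m + n) x)
    + smul (if m = - n then of_int (m ^ 3 - m) / 24 else 0) x"
proof -
  have "C x = smul (1/2) x" using central_charge by (simp add: has_central_charge_def)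
  then have e: "(if m = - n then smul (of_int (m ^ 3 - m) / 12) (C x) else 0)
      = smul (if m = - n then of_int (m ^ 3 - m) / 24 else 0) x" by simp
  show ?thesis using L_commutator[of m n x] unfolding e by (simp only: diff_eq_eq add_ac)
qed

lemma hv_0: "L 0 hv = smul h hv" and hv_pos: "n > 0 \<Longrightarrow> L n hv = 0" and hv_nz: "hv \<noteq> 0"
  using hv by (auto simp: highest_weight_vector_def)

lemma base_in_sector: "in_sector q (base_state q)"
  using q by (auto simp: base_state_def in_sector_def allowed_def fcard_finsert_disjoint fcard_fempty)

lemma ket_sector: "in_sector q S \<Longrightarrow> ket S \<in> sector q"
  by (auto simp: sector_def ket_def)

lemma base_minimal:
  assumes "in_sector q S"
  shows "\<Sum>(fset (base_state q)) \<le> \<Sum>(fset S)"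
proof (cases "q = 0")
  case False
  then have q1: "q = 1" "p = 1" using q by auto
  have "fcard S mod 2 = 1" using assms unfolding in_sector_def q1(1) by simp
  then have "fcard S \<noteq> 0" by presburger
  then obtain a where a: "a |\<in>| S" by auto
  have "allowed S" using assms by (simp add: in_sector_def)
  then have "int a mod 2 = p" using a unfolding allowed_def by blast
  then have "int a mod 2 = 1" unfolding q1(2) .
  then have "a \<ge> 1" by (cases a) auto
  then show ?thesis using fsum_ge[OF a] q1 by (simp add: base_state_def)
qed (simp add: base_state_def)

text \<open>For \<open>n > 0\<close> a nonzero coefficient would sit at an occupation set of energy
  below the minimum of the sector.\<close>

lemma vL_base:
  assumes "n \<ge> 0"
  shows "vL n (ket (base_state q)) = (\<lambda>T. if n = 0 then h * ket (base_state q) T else 0)"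
proof (cases "n = 0")
  case True
  then show ?thesis using vL_0_ket[of "base_state q"] base_in_sector h by (simp add: in_sector_def)
next
  case False
  then have n: "n > 0" using assms by simp
  show ?thesis
  proof
    fix T
    have kb: "ket (base_state q) \<in> sector q" by (rule ket_sector[OF base_in_sector])
    have y: "vL n (ket (base_state q)) \<in> sector q" by (rule vL_sector[OF kb q2])
    have "vL 0 (vL n (ket (base_state q))) T - vL n (vL 0 (ket (base_state q))) T
        = of_int (0 - n) * vL n (ket (base_state q)) T"
      using virasoro_relation[OF kb q2, of 0 n T] n by simp
    moreover have "vL n (vL 0 (ket (base_state q))) T = h * vL n (ket (base_state q)) T"
      using vL_0_ket[of "base_state q"] base_in_sector h by (simp add: in_sector_def vL_scale)
    ultimately have e: "(h0 + of_nat (\<Sum>(fset T)) / 2) * vL n (ket (base_state q)) T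
        = (h - of_int n) * vL n (ket (base_state q)) T"
      unfolding vL_0_sector[OF y] by (simp add: algebra_simps)
    have "vL n (ket (base_state q)) T = 0"
    proof (rule ccontr)
      assume nz: "vL n (ket (base_state q)) T \<noteq> 0"
      then have "in_sector q T" using y by (auto simp: sector_def)
      then have le: "\<Sum>(fset (base_state q)) \<le> \<Sum>(fset T)" by (rule base_minimal)
      have "h0 + of_nat (\<Sum>(fset T)) / 2 = h - of_int n" using e nz by simp
      then have "of_nat (\<Sum>(fset T)) + of_int (2 * n) = (of_nat (\<Sum>(fset (base_state q))) :: complex)"
        unfolding h by (simp only: half_difference of_int_mult of_int_numeral)
      then have "(of_int (int (\<Sum>(fset T)) + 2 * n) :: complex) = of_int (int (\<Sum>(fset (base_state q))))"
        by simp
      then have "int (\<Sum>(fset T)) + 2 * n = int (\<Sum>(fset (base_state q)))" by (simp only: of_int_eq_iff)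
      then show False using le n by linarith
    qed
    then show "vL n (ket (base_state q)) T = (if n = 0 then h * ket (base_state q) T else 0)"
      using n by simp
  qed
qed

text \<open>The operator raises the energy and cannot reach the minimal state. This keeps track of
  the base coefficient along the generation of \<open>joint\<close>.\<close>

lemma vL_neg_base:
  assumes f: "f \<in> sector q" and n: "n > 0"
  shows "vL (- n) f (base_state q) = 0"
proof (rule ccontr)
  let ?b = "base_state q"
  assume nz: "vL (- n) f ?b \<noteq> 0"
  have "lin_op (\<lambda>f T. vL (- n) f T)" by (rule lin_op_vL)
  have "vL (- n) f ?b = (\<Sum>S\<in>{S. f S \<noteq> 0}. f S * vL (- n) (ket S) ?b)"
    using lin_op_sum[OF lin_op_vL, of "- n" f ket "{S. f S \<noteq> 0}" ?b] sector_expand[OF f] by simp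
  then obtain S where S: "f S \<noteq> 0" "vL (- n) (ket S) ?b \<noteq> 0"
    using nz by (metis (mono_tags, lifting) mem_Collect_eq mult_zero_right sum.neutral)
  have iS: "in_sector q S" using S(1) f by (simp add: sector_def)
  have kS: "ket S \<in> sector q" by (rule ket_sector[OF iS])
  have y: "vL (- n) (ket S) \<in> sector q" by (rule vL_sector[OF kS q2])
  have "vL 0 (vL (- n) (ket S)) ?b - vL (- n) (vL 0 (ket S)) ?b = of_int n * vL (- n) (ket S) ?b"
    using virasoro_relation[OF kS q2, of 0 "- n" ?b] n by simp
  moreover have "vL (- n) (vL 0 (ket S)) ?b = (h0 + of_nat (\<Sum>(fset S)) / 2) * vL (- n) (ket S) ?b"
    using vL_0_ket[of S] iS by (simp add: in_sector_def vL_scale)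
  ultimately have "((h0 + of_nat (\<Sum>(fset ?b)) / 2) - (h0 + of_nat (\<Sum>(fset S)) / 2) - of_int n) * vL (- n) (ket S) ?b = 0"
    unfolding vL_0_sector[OF y] by (simp only: algebra_simps) simp
  then have "(h0 + of_nat (\<Sum>(fset ?b)) / 2) - (h0 + of_nat (\<Sum>(fset S)) / 2) - of_int n = 0"
    using S(2) by simp
  then have "h0 + of_nat (\<Sum>(fset S)) / 2 = h0 + of_nat (\<Sum>(fset ?b)) / 2 - of_int n"
    by (simp add: algebra_simps)
  then have "of_nat (\<Sum>(fset ?b)) = (of_nat (\<Sum>(fset S)) + of_int (2 * n) :: complex)"
    by (simp only: half_difference[symmetric] of_int_mult of_int_numeral)
  then have "(of_int (int (\<Sum>(fset ?b))) :: complex) = of_int (int (\<Sum>(fset S)) + 2 * n)" by simp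
  then have "int (\<Sum>(fset ?b)) = int (\<Sum>(fset S)) + 2 * n" by (simp only: of_int_eq_iff)
  then show False using base_minimal[OF iS] n by linarith
qed

section \<open>The graph of an isomorphism with the Fock sector\<close>

text \<open>The submodule of \<open>V \<times> F\<close> generated by the pair of highest weight vectors; it turns out
  to be the graph of an isomorphism.\<close>

inductive_set joint :: "('v \<times> fock) set" where
  base: "(hv, ket (base_state q)) \<in> joint"
| lower: "(x, y) \<in> joint \<Longrightarrow> n > 0 \<Longrightarrow> (L (- n) x, vL (- n) y) \<in> joint"
| lin: "(x, y) \<in> joint \<Longrightarrow> (x', y') \<in> joint
    \<Longrightarrow> (smul c x + smul d x', \<lambda>T. c * y T + d * y' T) \<in> joint"

lemma joint_sector: "(x, y) \<in> joint \<Longrightarrow> y \<in> sector q"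
  by (induction rule: joint.induct)
     (auto intro: ket_sector base_in_sector vL_sector q2 sector_linear)

lemma joint_scale: "(x, y) \<in> joint \<Longrightarrow> (smul c x, \<lambda>T. c * y T) \<in> joint"
  using joint.lin[of x y x y c 0] by simp

lemma joint_zero: "(0, \<lambda>T. 0) \<in> joint"
  using joint_scale[OF joint.base, of 0] by simp

lemma joint_add: "(x, y) \<in> joint \<Longrightarrow> (x', y') \<in> joint \<Longrightarrow> (x + x', \<lambda>T. y T + y' T) \<in> joint"
  using joint.lin[of x y x' y' 1 1] by simp

lemma joint_diff: "(x, y) \<in> joint \<Longrightarrow> (x', y') \<in> joint \<Longrightarrow> (x - x', \<lambda>T. y T - y' T) \<in> joint"
  using joint.lin[of x y x' y' 1 "- 1"] by simp

lemma joint_sum: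
  "(\<And>i. i \<in> A \<Longrightarrow> (x i, y i) \<in> joint) \<Longrightarrow> (\<Sum>i\<in>A. smul (c i) (x i), \<lambda>T. \<Sum>i\<in>A. c i * y i T) \<in> joint"
proof (induction A rule: infinite_finite_induct)
  case (insert a A)
  then show ?case
    using joint_add[OF joint_scale[of "x a" "y a" "c a"]] by auto
qed (simp_all add: joint_zero)

text \<open>The generators use lowering operators only. A raising operator is moved to the right
  past them by the Virasoro relation, which has the same central charge on both components, until it
  reaches the pair of highest weight vectors.\<close>

lemma joint_raise: "(x, y) \<in> joint \<Longrightarrow> n \<ge> 0 \<Longrightarrow> (L n x, vL n y) \<in> joint"
proof (induction arbitrary: n rule: joint.induct)
  case base
  show ?case
  proof (cases "n = 0")
    case True
    then show ?thesis using joint_scale[OF joint.base, of h] vL_base[of 0] by (simp add: hv_0)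
  next
    case False
    then show ?thesis using base joint_zero vL_base[of n] by (simp add: hv_pos)
  qed
next
  case (lower x y m)
  let ?c = "if n = m then of_int (n ^ 3 - n) / 24 else (0::complex)"
  \<comment> \<open>The commutator term may raise or lower: the first is the induction hypothesis,
    the second a generator.\<close>
  have mid: "(L (n - m) x, vL (n - m) y) \<in> joint"
  proof (cases "n - m \<ge> 0")
    case True
    then show ?thesis by (rule lower.IH)
  next
    case False
    then show ?thesis using joint.lower[OF lower.hyps(1), of "m - n"] by simp
  qed
  have 1: "(L (- m) (L n x), vL (- m) (vL n y)) \<in> joint"
    by (intro joint.lower lower)
  have "(L (- m) (L n x) + smul (of_int (n + m)) (L (n - m) x) + smul ?c x,
      \<lambda>T. vL (- m) (vL n y) T + of_int (n + m) * vL (n - m) y T + ?c * y T) \<in> joint"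
    by (intro joint_add joint_scale 1 mid lower.hyps)
  moreover have "L n (L (- m) x) = L (- m) (L n x) + smul (of_int (n + m)) (L (n - m) x) + smul ?c x"
    using L_comm[of n "- m" x] by simp
  moreover have "vL n (vL (- m) y) = (\<lambda>T. vL (- m) (vL n y) T + of_int (n + m) * vL (n - m) y T + ?c * y T)"
    using virasoro_relation[OF joint_sector[OF lower.hyps(1)] q2, of n "- m"]
    by (intro ext) (simp add: algebra_simps)
  ultimately show ?case by simp
next
  case (lin x y x' y' c d)
  have "vL n (\<lambda>T. c * y T + d * y' T) = (\<lambda>T. c * vL n y T + d * vL n y' T)"
    by (rule ext) (rule vL_linear)
  then show ?case
    using joint.lin[OF lin.IH] lin.prems by (simp add: L_add L_scale)
qed

lemma joint_L: "(x, y) \<in> joint \<Longrightarrow> (L n x, vL n y) \<in> joint"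
  using joint_raise[of x y n] joint.lower[of x y "- n"] by (cases "n \<ge> 0") auto

text \<open>Links the two components: the part of \<open>x\<close> of weight \<open>h\<close> is a
  multiple of \<open>hv\<close>, with the coefficient of \<open>y\<close> at the base state. The
  decomposition is carried along explicitly because \<open>V\<close> is not assumed to be a sum of
  weight spaces.\<close>

lemma joint_graded:
  "(x, y) \<in> joint \<Longrightarrow> \<exists>N xs. x = (\<Sum>k\<le>N. xs k) \<and> (\<forall>k. L 0 (xs k) = smul (h + of_nat k) (xs k))
     \<and> xs 0 = smul (y (base_state q)) hv \<and> (\<forall>k>N. xs k = 0)"
proof (induction rule: joint.induct)
  case base
  show ?case
    by (rule exI[of _ 0], rule exI[of _ "\<lambda>k. if k = 0 then hv else 0"]) (auto simp: hv_0 ket_def)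
next
  case (lower x y n)
  then obtain N xs where xs: "x = (\<Sum>k\<le>N. xs k)" "\<And>k. L 0 (xs k) = smul (h + of_nat k) (xs k)"
    "\<And>k. k > N \<Longrightarrow> xs k = 0" by blast
  define ys where "ys k = (if k < nat n then 0 else L (- n) (xs (k - nat n)))" for k
  have n: "nat n > 0" "of_int n = (of_nat (nat n) :: complex)" using lower.hyps by auto
  have "(\<Sum>k\<le>N + nat n. ys k) = (\<Sum>k\<in>(\<lambda>k. k + nat n) ` {..N}. ys k)"
  proof (rule sum.mono_neutral_right)
    show "\<forall>i\<in>{..N + nat n} - (\<lambda>k. k + nat n) ` {..N}. ys i = 0"
    proof
      fix i assume "i \<in> {..N + nat n} - (\<lambda>k. k + nat n) ` {..N}"
      then have "i < nat n"
        by (metis Diff_iff atMost_iff imageI le_diff_conv le_add_diff_inverse2 not_le)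
      then show "ys i = 0" by (simp add: ys_def)
    qed
  qed auto
  also have "\<dots> = (\<Sum>k\<le>N. ys (k + nat n))" by (subst sum.reindex) (auto simp: inj_on_def)
  also have "\<dots> = L (- n) x" unfolding xs(1) L_sum by (simp add: ys_def)
  finally have 1: "L (- n) x = (\<Sum>k\<le>N + nat n. ys k)" by simp
  have 2: "L 0 (ys k) = smul (h + of_nat k) (ys k)" for k
  proof (cases "k < nat n")
    case False
    have "L 0 (L (- n) (xs (k - nat n))) = L (- n) (L 0 (xs (k - nat n))) + smul (of_int n) (L (- n) (xs (k - nat n)))"
      using L_comm[of 0 "- n" "xs (k - nat n)"] lower.hyps by simp
    also have "\<dots> = smul (h + of_nat (k - nat n) + of_int n) (L (- n) (xs (k - nat n)))"
      unfolding xs(2) L_scale by (simp add: scale_left_distrib)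
    also have "h + of_nat (k - nat n) + of_int n = h + of_nat k"
      using False n by (simp add: of_nat_diff)
    finally show ?thesis using False by (simp add: ys_def)
  qed (simp add: ys_def)
  have 3: "ys 0 = smul (vL (- n) y (base_state q)) hv"
    using vL_neg_base[OF joint_sector[OF lower.hyps(1)] lower.hyps(2)] n by (simp add: ys_def)
  have 4: "ys k = 0" if "k > N + nat n" for k
    using xs(3)[of "k - nat n"] that by (simp add: ys_def)
  show ?case using 1 2 3 4 by blast
next
  case (lin x y x' y' c d)
  then obtain N xs N' xs' where
    xs: "x = (\<Sum>k\<le>N. xs k)" "\<And>k. L 0 (xs k) = smul (h + of_nat k) (xs k)"
      "xs 0 = smul (y (base_state q)) hv" "\<And>k. k > N \<Longrightarrow> xs k = 0"
    and xs': "x' = (\<Sum>k\<le>N'. xs' k)" "\<And>k. L 0 (xs' k) = smul (h + of_nat k) (xs' k)"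
      "xs' 0 = smul (y' (base_state q)) hv" "\<And>k. k > N' \<Longrightarrow> xs' k = 0" by blast
  define M where "M = max N N'"
  have "x = (\<Sum>k\<le>M. xs k)" unfolding xs(1) M_def
    by (rule sum.mono_neutral_left) (auto simp: xs(4))
  moreover have "x' = (\<Sum>k\<le>M. xs' k)" unfolding xs'(1) M_def
    by (rule sum.mono_neutral_left) (auto simp: xs'(4))
  ultimately have 1: "smul c x + smul d x' = (\<Sum>k\<le>M. smul c (xs k) + smul d (xs' k))"
    by (simp add: sum.distrib scale_sum_right)
  show ?case
    by (rule exI[of _ M], rule exI[of _ "\<lambda>k. smul c (xs k) + smul d (xs' k)"])
       (use 1 xs xs' in \<open>auto simp: L_add L_scale scale_right_distrib scale_left_distrib M_def distrib_left mult.commute\<close>)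
qed

lemma eigenvectors_independent:
  "(\<Sum>k\<le>N. xs k) = 0 \<Longrightarrow> (\<And>k. L 0 (xs k) = smul (h + of_nat k) (xs k)) \<Longrightarrow> k \<le> N \<Longrightarrow> xs k = 0"
proof (induction N arbitrary: xs k)
  case (Suc N)
  let ?c = "\<lambda>k. of_nat k - of_nat (Suc N) :: complex"
  have "(\<Sum>k\<le>Suc N. smul (?c k) (xs k)) = L 0 (\<Sum>k\<le>Suc N. xs k) - smul (h + of_nat (Suc N)) (\<Sum>k\<le>Suc N. xs k)"
    unfolding L_sum Suc.prems(2) scale_sum_right sum_subtractf[symmetric]
    by (simp only: scale_left_diff_distrib[symmetric]) (simp add: algebra_simps)
  then have "(\<Sum>k\<le>N. smul (?c k) (xs k)) = 0" unfolding Suc.prems(1) by simp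
  moreover have "L 0 (smul (?c k) (xs k)) = smul (h + of_nat k) (smul (?c k) (xs k))" for k
    by (simp add: L_scale Suc.prems(2) mult.commute)
  ultimately have "smul (?c k) (xs k) = 0" if "k \<le> N" for k
    using Suc.IH that by blast
  moreover have "?c k \<noteq> 0" if "k \<le> N" for k
    using that by (simp add: eq_iff_diff_eq_0[symmetric] flip: of_nat_Suc)
  ultimately have z: "xs k = 0" if "k \<le> N" for k using that scale_eq_0_iff by blast
  then have "xs (Suc N) = 0" using Suc.prems(1) by simp
  then show ?case using z Suc.prems(3) le_Suc_eq by blast
qed simp

text \<open>The partners of 0 form a stable subspace. Were it nonzero, some member would have a
  nonzero base coefficient, and the vector 0 would have a nonzero component of weight
  \<open>h\<close>.\<close>

lemma joint_kernel_right:
  assumes "(0, y) \<in> joint"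
  shows "y = (\<lambda>T. 0)"
proof (rule ccontr)
  assume "y \<noteq> (\<lambda>T. 0)"
  then obtain S where S: "y S \<noteq> 0" by auto
  define U where "U = {y. (0, y) \<in> joint}"
  have U: "stable q U"
    unfolding stable_def U_def
    using joint_sector joint_zero joint.lin[of 0 _ 0] joint_L[of 0] by auto
  obtain g where g: "g \<in> U" "g (base_state q) \<noteq> 0"
    using psi_psi_lower[of q U y S] U q2 S q assms by (auto simp: U_def)
  obtain N xs where xs: "0 = (\<Sum>k\<le>N. xs k)" "\<And>k. L 0 (xs k) = smul (h + of_nat k) (xs k)"
    "xs 0 = smul (g (base_state q)) hv"
    using joint_graded[of 0 g] g by (auto simp: U_def)
  have "xs 0 = 0" by (rule eigenvectors_independent[OF xs(1)[symmetric] xs(2)]) simp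
  then show False using xs(3) g hv_nz by simp
qed

lemma joint_submodule:
  assumes "0 \<in> W" "\<And>x x' c d. x \<in> W \<Longrightarrow> x' \<in> W \<Longrightarrow> smul c x + smul d x' \<in> W"
    and "\<And>x n. x \<in> W \<Longrightarrow> L n x \<in> W"
  shows "W = {0} \<or> W = UNIV"
proof -
  have a: "x + y \<in> W" if "x \<in> W" "y \<in> W" for x y using assms(2)[OF that, of 1 1] by simp
  have s: "smul c x \<in> W" if "x \<in> W" for c x using assms(2)[OF that that, of c 0] by simp
  have "subspace W" using assms(1) a s by (simp add: subspace_def)
  moreover have "C ` W \<subseteq> W"
    using central_charge s by (auto simp: has_central_charge_def)
  ultimately have "submodule W" using assms(3) by (auto simp: submodule_def)
  then show ?thesis using irreducible by (simp add: irreducible_module_def)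
qed

text \<open>The partners of the zero function form a submodule of the irreducible \<open>V\<close>.
  If it were all of \<open>V\<close>, it would contain \<open>hv\<close>, and subtracting the base
  pair would contradict \<open>joint_kernel_right\<close>.\<close>

lemma joint_kernel_left:
  assumes "(x, \<lambda>T. 0) \<in> joint"
  shows "x = 0"
proof -
  define W where "W = {x. (x, \<lambda>T. 0) \<in> joint}"
  have z: "vL n (\<lambda>T. 0) = (\<lambda>T. 0)" for n by auto
  have "W = {0} \<or> W = UNIV"
  proof (rule joint_submodule)
    show "0 \<in> W" using joint_zero by (simp add: W_def)
    show "smul c x + smul d x' \<in> W" if "x \<in> W" "x' \<in> W" for x x' c d
      using joint.lin[of x "\<lambda>T. 0" x' "\<lambda>T. 0" c d] that by (simp add: W_def)
    show "L n x \<in> W" if "x \<in> W" for x n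
      using joint_L[of x "\<lambda>T. 0" n] that z by (simp add: W_def)
  qed
  moreover have "W \<noteq> UNIV"
  proof
    assume "W = UNIV"
    then have "(hv, \<lambda>T. 0) \<in> joint" by (auto simp: W_def)
    then have "(0, \<lambda>T. ket (base_state q) T - 0) \<in> joint" using joint_diff[OF joint.base] by fastforce
    then have "ket (base_state q) = (\<lambda>T. 0)" using joint_kernel_right by simp
    then have "ket (base_state q) (base_state q) = 0" by simp
    then show False by (simp add: ket_def)
  qed
  ultimately show ?thesis using assms by (auto simp: W_def)
qed

lemma joint_left_total: "\<exists>y. (x, y) \<in> joint"
proof -
  define W where "W = {x. \<exists>y. (x, y) \<in> joint}"
  have "W = {0} \<or> W = UNIV"
  proof (rule joint_submodule)
    show "0 \<in> W" using joint_zero by (auto simp: W_def)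
    show "smul c x + smul d x' \<in> W" if "x \<in> W" "x' \<in> W" for x x' c d
      using joint.lin that by (force simp: W_def)
    show "L n x \<in> W" if "x \<in> W" for x n
      using joint_L that by (force simp: W_def)
  qed
  moreover have "hv \<in> W" using joint.base by (auto simp: W_def)
  ultimately show ?thesis using hv_nz by (auto simp: W_def)
qed

lemma joint_right_total:
  assumes "in_sector q S"
  shows "\<exists>x. (x, ket S) \<in> joint"
proof -
  define U where "U = {y. \<exists>x. (x, y) \<in> joint}"
  have "stable q U"
    unfolding stable_def
  proof (intro conjI ballI allI subsetI)
    fix f assume "f \<in> U" then show "f \<in> sector q" using joint_sector by (auto simp: U_def)
  next
    show "(\<lambda>T. 0) \<in> U" using joint_zero by (auto simp: U_def)
  next
    fix f g c d assume "f \<in> U" "g \<in> U"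
    then show "(\<lambda>T. c * f T + d * g T) \<in> U" using joint.lin by (force simp: U_def)
  next
    fix f n assume "f \<in> U"
    then show "vL n f \<in> U" using joint_L by (force simp: U_def)
  qed
  moreover have "ket (base_state q) \<in> U" using joint.base by (auto simp: U_def)
  ultimately have "ket S \<in> U" using psi_psi_raise q2 q assms by blast
  then show ?thesis by (simp add: U_def)
qed

text \<open>Since \<open>joint\<close> is the graph of a bijection that intertwines the zeroth
  operators, the partners \<open>b S\<close> of the occupation states of the right energy form a
  basis. The weight is measured from \<open>h\<close>, hence the offset by the energy of the base
  state.\<close>

lemma dim_weight_space:
  "dim (weight_space (h + of_nat n))
    = card {S. in_sector q S \<and> \<Sum>(fset S) = \<Sum>(fset (base_state q)) + 2 * n}"
proof -
  define A where "A = {S. in_sector q S \<and> \<Sum>(fset S) = \<Sum>(fset (base_state q)) + 2 * n}"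
  obtain b where b: "\<And>S. in_sector q S \<Longrightarrow> (b S, ket S) \<in> joint"
    using joint_right_total by metis
  have finA: "finite A"
  proof (rule finite_subset)
    show "A \<subseteq> {S. fset S \<subseteq> {..\<Sum>(fset (base_state q)) + 2 * n}}"
    proof
      fix S assume "S \<in> A"
      then show "S \<in> {S. fset S \<subseteq> {..\<Sum>(fset (base_state q)) + 2 * n}}"
        using fsum_ge[of _ S] by (auto simp: A_def)
    qed
    have "{S. fset S \<subseteq> {..\<Sum>(fset (base_state q)) + 2 * n}} \<subseteq> fset -` Pow {..\<Sum>(fset (base_state q)) + 2 * n}"
      by auto
    moreover have "finite (fset -` Pow {..\<Sum>(fset (base_state q)) + 2 * n})"
      by (rule finite_vimageI) (auto simp: inj_on_def fset_inject)
    ultimately show "finite {S. fset S \<subseteq> {..\<Sum>(fset (base_state q)) + 2 * n}}"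
      by (rule finite_subset)
  qed
  have right: "y = (\<lambda>T. 0)" if "(x, y) \<in> joint" "x = 0" for x y
    using that joint_kernel_right by simp
  have left: "x = 0" if "(x, y) \<in> joint" "\<And>T. y T = 0" for x y
  proof -
    have "y = (\<lambda>T. 0)" using that(2) by (rule ext)
    then show ?thesis using that(1) joint_kernel_left by simp
  qed
  have indep: "\<forall>S\<in>A. u S = 0" if "(\<Sum>S\<in>A. smul (u S) (b S)) = 0" for u
  proof
    fix T assume T: "T \<in> A"
    have "(\<Sum>S\<in>A. smul (u S) (b S), \<lambda>T. \<Sum>S\<in>A. u S * ket S T) \<in> joint"
      by (rule joint_sum) (use b in \<open>auto simp: A_def\<close>)
    from fun_cong[OF right[OF this that], of T] have "(\<Sum>S\<in>A. u S * ket S T) = 0" .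
    moreover have "(\<Sum>S\<in>A. u S * ket S T) = (\<Sum>S\<in>A. if S = T then u S else 0)"
      by (intro sum.cong) (auto simp: ket_def)
    ultimately show "u T = 0" using finA T by simp
  qed
  have inj: "inj_on b A"
  proof (rule inj_onI)
    fix S T assume ST: "S \<in> A" "T \<in> A" "b S = b T"
    show "S = T"
    proof (rule ccontr)
      assume "S \<noteq> T"
      have "(\<Sum>R\<in>A. smul (if R = S then 1 else if R = T then - 1 else 0) (b R))
         = (\<Sum>R\<in>{S, T}. smul (if R = S then 1 else if R = T then - 1 else 0) (b R))"
        by (rule sum.mono_neutral_right) (use ST finA in auto)
      also have "\<dots> = 0" using \<open>S \<noteq> T\<close> ST by simp
      finally show False using indep[of "\<lambda>R. if R = S then 1 else if R = T then - 1 else 0"] ST by auto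
    qed
  qed
  have ind: "independent (b ` A)"
  proof
    assume "dependent (b ` A)"
    then obtain u where u: "\<exists>v\<in>b ` A. u v \<noteq> 0" "(\<Sum>v\<in>b ` A. smul (u v) v) = 0"
      using finA by (auto simp: dependent_finite)
    have "(\<Sum>S\<in>A. smul (u (b S)) (b S)) = 0" using u(2) by (simp add: sum.reindex[OF inj])
    then show False using indep[of "\<lambda>S. u (b S)"] u(1) by auto
  qed
  have sub: "b ` A \<subseteq> weight_space (h + of_nat n)"
  proof
    fix x assume "x \<in> b ` A"
    then obtain S where S: "S \<in> A" "x = b S" by blast
    have j: "(b S, ket S) \<in> joint" using S b by (simp add: A_def)
    have J: "(L 0 (b S) - smul (h + of_nat n) (b S), \<lambda>T. vL 0 (ket S) T - (h + of_nat n) * ket S T) \<in> joint"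
      by (intro joint_diff joint_L joint_scale j)
    have "allowed S" "\<Sum>(fset S) = \<Sum>(fset (base_state q)) + 2 * n"
      using S by (simp_all add: A_def in_sector_def)
    then have "h0 + of_nat (\<Sum>(fset S)) / 2 = h + of_nat n"
      unfolding h by (simp add: add_divide_distrib)
    with vL_0_ket[OF \<open>allowed S\<close>] have "vL 0 (ket S) T - (h + of_nat n) * ket S T = 0" for T
      by simp
    from left[OF J this] have "L 0 (b S) - smul (h + of_nat n) (b S) = 0" .
    then show "x \<in> weight_space (h + of_nat n)" using S by (simp add: weight_space_def)
  qed
  have "weight_space (h + of_nat n) \<subseteq> span (b ` A)"
  proof
    fix x assume "x \<in> weight_space (h + of_nat n)"
    then have x: "L 0 x - smul (h + of_nat n) x = 0" by (simp add: weight_space_def)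
    obtain y where y: "(x, y) \<in> joint" using joint_left_total by blast
    have ys: "y \<in> sector q" by (rule joint_sector[OF y])
    have "(L 0 x - smul (h + of_nat n) x, \<lambda>T. vL 0 y T - (h + of_nat n) * y T) \<in> joint"
      by (intro joint_diff joint_L joint_scale y)
    from fun_cong[OF right[OF this x]] have e: "vL 0 y T = (h + of_nat n) * y T" for T by simp
    \<comment> \<open>On the Fock side the zeroth operator is diagonal, so the partner of a weight
      vector is supported on a single energy.\<close>
    have supp: "T \<in> A" if "y T \<noteq> 0" for T
    proof -
      have "h0 + of_nat (\<Sum>(fset T)) / 2 = h + of_nat n"
        using e[of T] that unfolding vL_0_sector[OF ys] by simp
      then have "h0 + of_nat (\<Sum>(fset T)) / 2 = h0 + of_nat (\<Sum>(fset (base_state q))) / 2 - (- of_nat n)"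
        unfolding h by simp
      from half_difference[OF this]
      have "(of_nat (\<Sum>(fset T)) :: complex) = of_nat (\<Sum>(fset (base_state q)) + 2 * n)"
        by (simp add: algebra_simps)
      then have "\<Sum>(fset T) = \<Sum>(fset (base_state q)) + 2 * n" by (simp only: of_nat_eq_iff)
      then show ?thesis using that ys by (simp add: A_def sector_def)
    qed
    have "(\<Sum>S\<in>A. smul (y S) (b S), \<lambda>T. \<Sum>S\<in>A. y S * ket S T) \<in> joint"
      by (rule joint_sum) (use b in \<open>auto simp: A_def\<close>)
    moreover have "(\<Sum>S\<in>A. y S * ket S T) = y T" for T
    proof -
      have "(\<Sum>S\<in>A. y S * ket S T) = (\<Sum>S\<in>A. if S = T then y S else 0)"
        by (intro sum.cong) (auto simp: ket_def)
      then show ?thesis using finA supp[of T] by (cases "y T = 0") auto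
    qed
    ultimately have "(\<Sum>S\<in>A. smul (y S) (b S), y) \<in> joint" by simp
    from joint_diff[OF y this] have "x - (\<Sum>S\<in>A. smul (y S) (b S)) = 0"
      by (rule left) simp
    then have "x = (\<Sum>S\<in>A. smul (y S) (b S))" by simp
    also have "\<dots> \<in> span (b ` A)"
      by (intro span_sum span_scale span_base) auto
    finally show "x \<in> span (b ` A)" .
  qed
  moreover have "subspace (weight_space (h + of_nat n))"
    by (auto simp: subspace_def weight_space_def L_add L_scale scale_right_distrib mult.commute)
  ultimately have "span (b ` A) = span (weight_space (h + of_nat n))"
    using sub by (metis span_eq span_superset subset_trans)
  then have "dim (weight_space (h + of_nat n)) = card (b ` A)"
    using ind by (rule dim_eq_card)
  then show ?thesis using inj by (simp add: card_image A_def)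
qed

end

section \<open>Locally finite sums of power series\<close>

text \<open>Each coefficient receives finitely many contributions. This implies unconditional
  convergence of formal power series, and every rearrangement becomes one of finite sums.\<close>

definition loc_fin :: "('i \<Rightarrow> complex fps) \<Rightarrow> 'i set \<Rightarrow> bool" where
  "loc_fin f A \<longleftrightarrow> (\<forall>m. finite {i\<in>A. fps_nth (f i) m \<noteq> 0})"

definition fps_total :: "('i \<Rightarrow> complex fps) \<Rightarrow> 'i set \<Rightarrow> complex fps" where
  "fps_total f A = Abs_fps (\<lambda>m. \<Sum>i | i \<in> A \<and> fps_nth (f i) m \<noteq> 0. fps_nth (f i) m)"

lemma fps_total_nth:
  assumes "finite B" "B \<subseteq> A" "\<And>i. i \<in> A \<Longrightarrow> fps_nth (f i) m \<noteq> 0 \<Longrightarrow> i \<in> B"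
  shows "fps_nth (fps_total f A) m = (\<Sum>i\<in>B. fps_nth (f i) m)"
  unfolding fps_total_def fps_nth_Abs_fps by (rule sum.mono_neutral_left) (use assms in auto)

lemma has_sum_total:
  assumes "loc_fin f A"
  shows "(f has_sum fps_total f A) A"
  unfolding has_sum_def
proof (rule tendsto_fpsI)
  fix m
  let ?B = "{i\<in>A. fps_nth (f i) m \<noteq> 0}"
  have B: "finite ?B" "?B \<subseteq> A" using assms by (auto simp: loc_fin_def)
  have "fps_nth (sum f F) m = fps_nth (fps_total f A) m" if "finite F" "?B \<subseteq> F" "F \<subseteq> A" for F
  proof -
    have "fps_nth (fps_total f A) m = (\<Sum>i\<in>F. fps_nth (f i) m)"
      by (rule fps_total_nth) (use that in auto)
    then show ?thesis by (simp add: fps_sum_nth)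
  qed
  then show "\<forall>\<^sub>F F in finite_subsets_at_top A. fps_nth (sum f F) m = fps_nth (fps_total f A) m"
    unfolding eventually_finite_subsets_at_top using B by blast
qed

lemma fps_total_cong: "(\<And>i. i \<in> A \<Longrightarrow> f i = g i) \<Longrightarrow> fps_total f A = fps_total g A"
  unfolding fps_total_def by (rule arg_cong[where f = Abs_fps], rule ext, rule sum.cong) auto

lemma loc_fin_add: "loc_fin f A \<Longrightarrow> loc_fin g A \<Longrightarrow> loc_fin (\<lambda>i. f i + g i) A"
  and loc_fin_diff: "loc_fin f A \<Longrightarrow> loc_fin g A \<Longrightarrow> loc_fin (\<lambda>i. f i - g i) A"
proof -
  assume fg: "loc_fin f A" "loc_fin g A"
  then have "finite ({i\<in>A. fps_nth (f i) m \<noteq> 0} \<union> {i\<in>A. fps_nth (g i) m \<noteq> 0})" for m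
    by (simp add: loc_fin_def)
  note U = this
  have "finite {i\<in>A. fps_nth (f i + g i) m \<noteq> 0}" for m by (rule finite_subset[OF _ U[of m]]) auto
  then show "loc_fin (\<lambda>i. f i + g i) A" by (simp add: loc_fin_def)
  have "finite {i\<in>A. fps_nth (f i - g i) m \<noteq> 0}" for m by (rule finite_subset[OF _ U[of m]]) auto
  then show "loc_fin (\<lambda>i. f i - g i) A" by (simp add: loc_fin_def)
qed

lemma fps_total_add: "loc_fin f A \<Longrightarrow> loc_fin g A \<Longrightarrow> fps_total (\<lambda>i. f i + g i) A = fps_total f A + fps_total g A"
  and fps_total_diff: "loc_fin f A \<Longrightarrow> loc_fin g A \<Longrightarrow> fps_total (\<lambda>i. f i - g i) A = fps_total f A - fps_total g A"
proof -
  assume fg: "loc_fin f A" "loc_fin g A"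
  let ?B = "\<lambda>m. {i\<in>A. fps_nth (f i) m \<noteq> 0} \<union> {i\<in>A. fps_nth (g i) m \<noteq> 0}"
  have B: "finite (?B m)" for m using fg by (simp add: loc_fin_def)
  have n: "fps_nth (fps_total f A) m = (\<Sum>i\<in>?B m. fps_nth (f i) m)"
    "fps_nth (fps_total g A) m = (\<Sum>i\<in>?B m. fps_nth (g i) m)"
    "fps_nth (fps_total (\<lambda>i. f i + g i) A) m = (\<Sum>i\<in>?B m. fps_nth (f i + g i) m)"
    "fps_nth (fps_total (\<lambda>i. f i - g i) A) m = (\<Sum>i\<in>?B m. fps_nth (f i - g i) m)" for m
    by (rule fps_total_nth[OF B]; auto)+
  show "fps_total (\<lambda>i. f i + g i) A = fps_total f A + fps_total g A"
    by (rule fps_ext) (simp only: fps_add_nth n sum.distrib)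
  show "fps_total (\<lambda>i. f i - g i) A = fps_total f A - fps_total g A"
    by (rule fps_ext) (simp only: fps_sub_nth n sum_subtractf)
qed

lemma loc_fin_cmult: "loc_fin f A \<Longrightarrow> loc_fin (\<lambda>i. c * f i) A"
  and fps_total_cmult: "loc_fin f A \<Longrightarrow> fps_total (\<lambda>i. c * f i) A = c * fps_total f A"
proof -
  assume f: "loc_fin f A"
  let ?B = "\<lambda>m. \<Union>k\<le>m. {i\<in>A. fps_nth (f i) k \<noteq> 0}"
  have B: "finite (?B m)" for m using f by (auto simp: loc_fin_def)
  have z: "i \<in> ?B m" if "i \<in> A" "fps_nth (c * f i) m \<noteq> 0" for i m
  proof (rule ccontr)
    assume "i \<notin> ?B m"
    then have "fps_nth (f i) k = 0" if "k \<le> m" for k using that \<open>i \<in> A\<close> by blast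
    then have "fps_nth (c * f i) m = 0" by (simp add: fps_mult_nth)
    then show False using that by simp
  qed
  show "loc_fin (\<lambda>i. c * f i) A"
    unfolding loc_fin_def by (intro allI, rule finite_subset[OF _ B]) (use z in blast)
  show "fps_total (\<lambda>i. c * f i) A = c * fps_total f A"
  proof (rule fps_ext)
    fix m
    have "fps_nth (fps_total (\<lambda>i. c * f i) A) m = (\<Sum>i\<in>?B m. fps_nth (c * f i) m)"
      by (rule fps_total_nth[OF B]) (use z in auto)
    also have "\<dots> = (\<Sum>k = 0..m. \<Sum>i\<in>?B m. fps_nth c k * fps_nth (f i) (m - k))"
      unfolding fps_mult_nth by (rule sum.swap)
    also have "\<dots> = (\<Sum>k = 0..m. fps_nth c k * fps_nth (fps_total f A) (m - k))"
    proof (rule sum.cong[OF refl])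
      fix k assume "k \<in> {0..m}"
      have "fps_nth (fps_total f A) (m - k) = (\<Sum>i\<in>?B m. fps_nth (f i) (m - k))"
        by (rule fps_total_nth[OF B]) auto
      then show "(\<Sum>i\<in>?B m. fps_nth c k * fps_nth (f i) (m - k)) = fps_nth c k * fps_nth (fps_total f A) (m - k)"
        by (simp add: sum_distrib_left)
    qed
    finally show "fps_nth (fps_total (\<lambda>i. c * f i) A) m = fps_nth (c * fps_total f A) m"
      by (simp add: fps_mult_nth)
  qed
qed

lemma
  assumes "bij_betw g B A"
  shows fps_total_reindex: "fps_total (\<lambda>i. f (g i)) B = fps_total f A"
    and loc_fin_reindex: "loc_fin (\<lambda>i. f (g i)) B \<longleftrightarrow> loc_fin f A"
proof -
  have inj: "inj_on g {i \<in> B. fps_nth (f (g i)) m \<noteq> 0}" for m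
    using assms by (auto simp: bij_betw_def intro: inj_on_subset)
  have im: "{i \<in> A. fps_nth (f i) m \<noteq> 0} = g ` {i \<in> B. fps_nth (f (g i)) m \<noteq> 0}" for m
    using assms by (auto simp: bij_betw_def)
  show "fps_total (\<lambda>i. f (g i)) B = fps_total f A"
    unfolding fps_total_def im using sum.reindex[OF inj, of "\<lambda>i. fps_nth (f i) _"] by (simp add: o_def)
  show "loc_fin (\<lambda>i. f (g i)) B \<longleftrightarrow> loc_fin f A"
    unfolding loc_fin_def im by (simp add: finite_image_iff[OF inj])
qed

lemma fps_total_subset:
  assumes "B \<subseteq> A" "\<And>i. i \<in> A - B \<Longrightarrow> f i = 0"
  shows "fps_total f A = fps_total f B"
proof -
  have "{i \<in> A. fps_nth (f i) m \<noteq> 0} = {i \<in> B. fps_nth (f i) m \<noteq> 0}" for m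
    using assms by auto (metis DiffI fps_zero_nth)
  then show ?thesis by (simp add: fps_total_def)
qed

lemma
  assumes "loc_fin f (Sigma I J)"
  shows fps_total_Sigma: "fps_total f (Sigma I J) = fps_total (\<lambda>i. fps_total (\<lambda>j. f (i, j)) (J i)) I"
    and loc_fin_Sigma_inner: "i \<in> I \<Longrightarrow> loc_fin (\<lambda>j. f (i, j)) (J i)"
proof -
  define B where "B m = {x \<in> Sigma I J. fps_nth (f x) m \<noteq> 0}" for m
  have B: "finite (B m)" for m using assms by (simp add: loc_fin_def B_def)
  have inner: "{j \<in> J i. fps_nth (f (i, j)) m \<noteq> 0} = {j. (i, j) \<in> B m}" if "i \<in> I" for i m
    using that by (auto simp: B_def)
  have fin: "finite {j. (i, j) \<in> B m}" for i m
    by (rule finite_subset[of _ "snd ` B m"]) (use B in \<open>force+\<close>)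
  show "i \<in> I \<Longrightarrow> loc_fin (\<lambda>j. f (i, j)) (J i)"
    unfolding loc_fin_def using inner[of i] fin[of i] by (simp only: simp_thms)
  have nth: "fps_nth (fps_total (\<lambda>j. f (i, j)) (J i)) m = (\<Sum>j | (i, j) \<in> B m. fps_nth (f (i, j)) m)"
    if "i \<in> I" for i m
    unfolding fps_total_def fps_nth_Abs_fps by (simp only: inner[OF that])
  have z: "i \<in> fst ` B m" if "i \<in> I" "fps_nth (fps_total (\<lambda>j. f (i, j)) (J i)) m \<noteq> 0" for i m
  proof (rule ccontr)
    assume "i \<notin> fst ` B m"
    then have "{j. (i, j) \<in> B m} = {}" by force
    then show False using nth[OF that(1), of m] that(2) by simp
  qed
  show "fps_total f (Sigma I J) = fps_total (\<lambda>i. fps_total (\<lambda>j. f (i, j)) (J i)) I"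
  proof (rule fps_ext)
    fix m
    have sub: "fst ` B m \<subseteq> I" by (auto simp: B_def)
    have "fps_nth (fps_total (\<lambda>i. fps_total (\<lambda>j. f (i, j)) (J i)) I) m
       = (\<Sum>i\<in>fst ` B m. fps_nth (fps_total (\<lambda>j. f (i, j)) (J i)) m)"
      by (rule fps_total_nth) (use B sub z in auto)
    also have "\<dots> = (\<Sum>i\<in>fst ` B m. \<Sum>j | (i, j) \<in> B m. fps_nth (f (i, j)) m)"
      by (rule sum.cong[OF refl]) (use nth sub in blast)
    also have "\<dots> = (\<Sum>x\<in>(SIGMA i:fst ` B m. {j. (i, j) \<in> B m}). fps_nth (f x) m)"
      by (subst sum.Sigma) (use B fin in auto)
    also have "(SIGMA i:fst ` B m. {j. (i, j) \<in> B m}) = B m" by force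
    also have "(\<Sum>x\<in>B m. fps_nth (f x) m) = fps_nth (fps_total f (Sigma I J)) m"
      by (rule fps_total_nth[symmetric]) (use B in \<open>auto simp: B_def\<close>)
    finally show "fps_nth (fps_total f (Sigma I J)) m
        = fps_nth (fps_total (\<lambda>i. fps_total (\<lambda>j. f (i, j)) (J i)) I) m" by simp
  qed
qed

lemma fps_total_finite: "finite A \<Longrightarrow> fps_total f A = sum f A"
  by (rule fps_ext) (simp add: fps_total_nth[of A] fps_sum_nth)

text \<open>The hypothesis says that \<open>G N\<close> has order at least \<open>N\<close>, so the
  boundary term disappears from each coefficient.\<close>

lemma fps_total_telescope:
  assumes "\<And>N m. m < N \<Longrightarrow> fps_nth (G N) m = 0"
  shows "fps_total (\<lambda>N. G N - G (Suc N)) UNIV = G 0"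
proof -
  have z: "fps_nth (G N - G (Suc N)) m = 0" if "m < N" for N m using assms that by simp
  show "fps_total (\<lambda>N. G N - G (Suc N)) UNIV = G 0"
  proof (rule fps_ext)
    fix m
    have "fps_nth (fps_total (\<lambda>N. G N - G (Suc N)) UNIV) m = (\<Sum>N\<le>m. fps_nth (G N - G (Suc N)) m)"
      by (rule fps_total_nth) (use z not_le in auto)
    also have "\<dots> = fps_nth (G 0) m - fps_nth (G (Suc m)) m"
      unfolding fps_sub_nth by (rule sum_telescope)
    finally show "fps_nth (fps_total (\<lambda>N. G N - G (Suc N)) UNIV) m = fps_nth (G 0) m"
      using assms by simp
  qed
qed

section \<open>The double sums\<close>

definition ipoch :: "nat \<Rightarrow> complex fps" where
  "ipoch n = inverse (qpoch n)"

lemma q_var_power: "q_var ^ e = fps_X ^ (2 * e)"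
  by (simp add: q_var_def sqrt_q_def power_mult)

lemma q_var_low: "m < 2 * e \<Longrightarrow> fps_nth (q_var ^ e * y) m = 0"
  by (simp add: q_var_power fps_X_power_mult_nth)

lemma qpoch_0 [simp]: "qpoch 0 = 1"
  by (simp add: qpoch_def)

lemma qpoch_Suc: "qpoch (Suc n) = qpoch n * (1 - q_var ^ Suc n)"
  by (simp add: qpoch_def)

lemma qpoch_nth_0: "fps_nth (qpoch n) 0 = 1"
  by (induction n) (simp_all add: qpoch_Suc q_var_power del: power_Suc)

lemma ipoch_0 [simp]: "ipoch 0 = 1"
  by (simp add: ipoch_def)

lemma ipoch_qpoch: "ipoch n * qpoch n = 1" "qpoch n * ipoch n = 1"
  using inverse_mult_eq_1[of "qpoch n"] qpoch_nth_0[of n] by (simp_all add: ipoch_def mult.commute)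

lemma ipoch_Suc: "ipoch (Suc n) * (1 - q_var ^ Suc n) = ipoch n"
proof -
  have "ipoch n = ipoch n * (qpoch (Suc n) * ipoch (Suc n))" by (simp add: ipoch_qpoch)
  also have "\<dots> = (ipoch n * qpoch n) * (ipoch (Suc n) * (1 - q_var ^ Suc n))"
    by (simp only: qpoch_Suc mult_ac)
  finally show ?thesis by (simp add: ipoch_qpoch)
qed

lemma divide_qpoch: "x / (qpoch k * qpoch l) = x * (ipoch k * ipoch l)"
  using qpoch_nth_0[of k] qpoch_nth_0[of l]
  by (simp add: fps_divide_unit ipoch_def fps_inverse_mult)

lemma loc_fin_q_var:
  assumes "\<And>M. finite {i \<in> A. e i \<le> M}"
  shows "loc_fin (\<lambda>i. q_var ^ e i * y i) A"
  unfolding loc_fin_def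
proof
  fix m
  have "{i \<in> A. fps_nth (q_var ^ e i * y i) m \<noteq> 0} \<subseteq> {i \<in> A. e i \<le> m}"
  proof
    fix i assume i: "i \<in> {i \<in> A. fps_nth (q_var ^ e i * y i) m \<noteq> 0}"
    then have "\<not> m < 2 * e i" using q_var_low by blast
    then show "i \<in> {i \<in> A. e i \<le> m}" using i by auto
  qed
  then show "finite {i \<in> A. fps_nth (q_var ^ e i * y i) m \<noteq> 0}"
    using assms by (rule finite_subset)
qed

section \<open>The q-binomial theorem and the exchange of summations\<close>

definition tri :: "nat \<Rightarrow> nat" where "tri i = i * (i - 1) div 2"

lemma tri_0 [simp]: "tri 0 = 0" by (simp add: tri_def)

lemma tri_Suc: "tri (Suc i) = tri i + i"
proof -
  have "Suc i * i = i * (i - 1) + 2 * i" by (cases i) auto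
  then show ?thesis by (simp add: tri_def)
qed

text \<open>The finite q-binomial theorem with two variables. The second one admits
  \<open>x = 1\<close>, \<open>y = q_var ^ d\<close>, where the usual form would need negative
  powers of \<open>q_var\<close>.\<close>

lemma q_binomial_homogeneous:
  "(\<Sum>i\<le>m. (- 1) ^ i * q_var ^ tri i * x ^ i * y ^ (m - i) * (ipoch i * ipoch (m - i)))
    = ipoch m * (\<Prod>k<m. y - x * q_var ^ k)"
proof (induction m)
  case (Suc m)
  let ?t = "\<lambda>m i. (- 1) ^ i * q_var ^ tri i * x ^ i * y ^ (m - i) * (ipoch i * ipoch (m - i))"
  \<comment> \<open>The q-Pascal rule: with \<open>M = Suc m\<close>, \<open>1 - q^M\<close> equals
    \<open>(1 - q^(M - i)) + q^(M - i) * (1 - q^i)\<close>, and each part cancels the last factor of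
    one of the two Pochhammer symbols.\<close>
  have pascal: "(1 - q_var ^ Suc m) * ?t (Suc m) i
     = (if i \<le> m then y * ?t m i else 0) - (if i = 0 then 0 else x * q_var ^ m * ?t m (i - 1))"
    if "i \<le> Suc m" for i
  proof -
    have "1 - q_var ^ Suc m = (1 - q_var ^ (Suc m - i)) + q_var ^ (Suc m - i) * (1 - q_var ^ i)"
      using that by (simp add: right_diff_distrib flip: power_add)
    then have e: "(1 - q_var ^ Suc m) * ?t (Suc m) i
       = (1 - q_var ^ (Suc m - i)) * ?t (Suc m) i + q_var ^ (Suc m - i) * (1 - q_var ^ i) * ?t (Suc m) i"
      by (simp only: distrib_right)
    have 1: "(1 - q_var ^ (Suc m - i)) * ?t (Suc m) i = (if i \<le> m then y * ?t m i else 0)"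
    proof (cases "i \<le> m")
      case True
      then have s: "Suc m - i = Suc (m - i)" by simp
      show ?thesis using ipoch_Suc[of "m - i"] True unfolding s by (simp add: mult_ac del: power_Suc) (simp add: mult_ac)
    next
      case False
      then show ?thesis using that by simp
    qed
    have 2: "q_var ^ (Suc m - i) * (1 - q_var ^ i) * ?t (Suc m) i
        = - (if i = 0 then 0 else x * q_var ^ m * ?t m (i - 1))"
    proof (cases i)
      case (Suc j)
      then have j: "j \<le> m" "Suc m - Suc j = m - j" using that by auto
      have qq: "q_var ^ (m - j) * q_var ^ tri (Suc j) = q_var ^ m * q_var ^ tri j"
        using j by (simp add: tri_Suc flip: power_add)
      have "q_var ^ (m - j) * (1 - q_var ^ Suc j) * ?t (Suc m) (Suc j)
         = - ((- 1) ^ j * (q_var ^ (m - j) * q_var ^ tri (Suc j)) * (x * x ^ j) * y ^ (m - j)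
             * ((ipoch (Suc j) * (1 - q_var ^ Suc j)) * ipoch (m - j)))"
        unfolding j(2) by (simp only: power_Suc[of "- 1"] power_Suc[of x] mult_minus_left mult_minus_right mult_1_left mult_ac)
      then show ?thesis unfolding Suc j(2) qq ipoch_Suc by (simp add: mult_ac)
    qed simp
    show ?thesis unfolding e 1 2 by simp
  qed
  have "(1 - q_var ^ Suc m) * (\<Sum>i\<le>Suc m. ?t (Suc m) i)
     = (\<Sum>i\<le>Suc m. (if i \<le> m then y * ?t m i else 0) - (if i = 0 then 0 else x * q_var ^ m * ?t m (i - 1)))"
    unfolding sum_distrib_left by (rule sum.cong[OF refl]) (use pascal in auto)
  also have "\<dots> = (\<Sum>i\<le>Suc m. if i \<le> m then y * ?t m i else 0) - (\<Sum>i\<le>Suc m. if i = 0 then 0 else x * q_var ^ m * ?t m (i - 1))"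
    by (rule sum_subtractf)
  also have "(\<Sum>i\<le>Suc m. if i \<le> m then y * ?t m i else 0) = y * (\<Sum>i\<le>m. ?t m i)"
    unfolding sum_distrib_left by simp
  also have "(\<Sum>i\<le>Suc m. if i = 0 then 0 else x * q_var ^ m * ?t m (i - 1)) = x * q_var ^ m * (\<Sum>i\<le>m. ?t m i)"
    unfolding sum_distrib_left by (subst sum.atMost_Suc_shift) simp
  finally have "(1 - q_var ^ Suc m) * (\<Sum>i\<le>Suc m. ?t (Suc m) i) = (y - x * q_var ^ m) * (\<Sum>i\<le>m. ?t m i)"
    by (simp only: left_diff_distrib)
  also have "\<dots> = (1 - q_var ^ Suc m) * (ipoch (Suc m) * (\<Prod>k<Suc m. y - x * q_var ^ k))"
    unfolding Suc.IH ipoch_Suc[of m, symmetric] by (simp add: mult_ac)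
  finally have c: "(1 - q_var ^ Suc m) * (\<Sum>i\<le>Suc m. ?t (Suc m) i)
     = (1 - q_var ^ Suc m) * (ipoch (Suc m) * (\<Prod>k<Suc m. y - x * q_var ^ k))" .
  have "fps_nth (1 - q_var ^ Suc m) 0 = 1" by (simp add: q_var_power del: power_Suc)
  then have "1 - q_var ^ Suc m \<noteq> 0" by (metis fps_zero_nth zero_neq_one)
  then show ?case by (rule mult_left_cancel[THEN iffD1, OF _ c])
qed simp

lemma qpoch_add: "(\<Prod>k<N. 1 - q_var ^ Suc D * q_var ^ k) = ipoch D * qpoch (D + N)"
proof (induction N)
  case (Suc N)
  have "q_var ^ Suc D * q_var ^ N = q_var ^ Suc (D + N)" by (simp flip: power_add)
  then have "(\<Prod>k<Suc N. 1 - q_var ^ Suc D * q_var ^ k) = ipoch D * qpoch (D + N) * (1 - q_var ^ Suc (D + N))"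
    unfolding prod.lessThan_Suc Suc by simp
  also have "\<dots> = ipoch D * qpoch (D + Suc N)"
    unfolding add_Suc_right qpoch_Suc by (simp only: mult.assoc)
  finally show ?case .
qed (simp add: ipoch_qpoch)

lemma finite_pair_exponent:
  fixes e :: "nat \<times> nat \<Rightarrow> nat"
  assumes "\<And>k l. k \<le> e (k, l) \<and> l \<le> e (k, l)"
  shows "finite {x \<in> UNIV. e x \<le> M}"
proof (rule finite_subset)
  show "{x \<in> UNIV. e x \<le> M} \<subseteq> {..M} \<times> {..M}" using assms by (auto intro: order.trans)
qed simp

lemma finite_triple_exponent:
  fixes e :: "nat \<times> nat \<times> nat \<Rightarrow> nat"
  assumes "\<And>i j k. i \<le> e (i, j, k) \<and> j \<le> e (i, j, k) \<and> k \<le> e (i, j, k)"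
  shows "finite {x \<in> UNIV. e x \<le> M}"
proof (rule finite_subset)
  show "{x \<in> UNIV. e x \<le> M} \<subseteq> {..M} \<times> {..M} \<times> {..M}" using assms by (auto intro: order.trans)
qed simp

lemma le_square_nat: "n \<le> n\<^sup>2" for n :: nat
  by (cases n) (auto simp: power2_eq_square)

lemma less_double: "m < N \<Longrightarrow> N \<le> e \<Longrightarrow> m < 2 * e" for m N e :: nat
  by simp

lemma loc_fin_single: "loc_fin (\<lambda>N. q_var ^ (N\<^sup>2 + a * N) * y N) UNIV"
proof (rule loc_fin_q_var)
  fix M
  have "N \<le> M" if "N\<^sup>2 + a * N \<le> M" for N by (rule order.trans[OF trans_le_add1[OF le_square_nat] that])
  then have "{N \<in> UNIV. N\<^sup>2 + a * N \<le> M} \<subseteq> {..M}" by blast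
  then show "finite {N \<in> UNIV. N\<^sup>2 + a * N \<le> M}" by (rule finite_subset) (rule finite_atMost)
qed

text \<open>Here and in the next two lemmas the left side is the exponent of the triple series in
  \<open>nahm_transform\<close>, evaluated at the indices of one grouping. The right side isolates
  \<open>tri i\<close> and the part linear in \<open>i\<close> that the q-binomial theorem
  sums.\<close>

lemma expand_first_pair:
  assumes "i \<le> m"
  shows "2 * (m - i)\<^sup>2 + 3 * i * (m - i) + i\<^sup>2 + tri i + i + (i + (m - i)) * (m + l) + i * (m + l) + (m + l)\<^sup>2
       + a * (i + (m - i)) + b * (m + l)
     = 4 * m\<^sup>2 + 3 * m * l + l\<^sup>2 + a * m + b * (m + l) + (tri i + (l + 1) * i)"
proof -
  obtain j where "m = i + j" using assms le_Suc_ex by blast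
  then show ?thesis by (simp add: algebra_simps power2_eq_square)
qed

lemma expand_second_pair:
  assumes "i \<le> m" "m = n + 1 + d"
  shows "2 * (m - i)\<^sup>2 + 3 * i * (m - i) + i\<^sup>2 + tri i + i + (i + (m - i)) * n + i * n + n\<^sup>2
       + a * (i + (m - i)) + b * n
     = m * (m + n + 1) + m * n + n\<^sup>2 + a * m + b * n + (tri i + d * (m - i))"
proof -
  obtain j where j: "m = i + j" using assms le_Suc_ex by blast
  have n: "int n = int i + int j - 1 - int d" using assms(2) j by simp
  have "int (2 * (m - i)\<^sup>2 + 3 * i * (m - i) + i\<^sup>2 + tri i + i + (i + (m - i)) * n + i * n + n\<^sup>2
       + a * (i + (m - i)) + b * n)
     = int (m * (m + n + 1) + m * n + n\<^sup>2 + a * m + b * n + (tri i + d * (m - i)))"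
    unfolding j by (simp add: n) algebra
  then show ?thesis by (simp only: of_nat_eq_iff)
qed

lemma expand_third_pair:
  assumes "i \<le> N" "a = a' + b"
  shows "2 * j\<^sup>2 + 3 * i * j + i\<^sup>2 + tri i + i + (i + j) * (N - i) + i * (N - i) + (N - i)\<^sup>2
       + a * (i + j) + b * (N - i)
     = 2 * j\<^sup>2 + a * j + (N\<^sup>2 + (j + b) * N) + (tri i + (2 * j + a' + 1) * i)"
proof -
  obtain n where "N = i + n" using assms le_Suc_ex by blast
  then show ?thesis using assms(2) by (simp add: algebra_simps power2_eq_square)
qed

lemma sum_q_binomial:
  assumes "\<And>i. i \<le> m \<Longrightarrow> u i = B * ((- 1) ^ i * q_var ^ tri i * x ^ i * y ^ (m - i) * (ipoch i * ipoch (m - i)))"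
  shows "(\<Sum>i\<le>m. u i) = B * (ipoch m * (\<Prod>k<m. y - x * q_var ^ k))"
  unfolding q_binomial_homogeneous[symmetric] sum_distrib_left by (rule sum.cong) (use assms in auto)

text \<open>
  Both sides are groupings of one triple series: \<open>ipoch (n - m)\<close>, written as
  \<open>ipoch n\<close> times a finite product, is expanded by the \<open>q\<close>-binomial theorem, and the resulting
  series is summed over a different pair of indices first. The expansion is \<open>0\<close> for \<open>n < m\<close>.
\<close>

lemma nahm_transform:
  fixes \<phi> :: "nat \<Rightarrow> complex fps"
  assumes a: "a = a' + b"
  defines "S \<equiv> \<lambda>j N. q_var ^ (N\<^sup>2 + (j + b) * N) * (\<phi> (j + N) * (ipoch N * qpoch (2 * j + a' + N)))"
  shows "fps_total (\<lambda>(k, l). q_var ^ (4 * k\<^sup>2 + 3 * k * l + l\<^sup>2 + a * k + b * (k + l))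
      * (\<phi> (2 * k + l) * (ipoch k * ipoch l))) UNIV
    = fps_total (\<lambda>j. q_var ^ (2 * j\<^sup>2 + a * j) * (ipoch j * ipoch (2 * j + a') * fps_total (S j) UNIV)) UNIV"
proof -
  \<comment> \<open>The triple \<open>(i, j, n)\<close> is summand \<open>i\<close> in the expansion
    of the term with \<open>m = i + j\<close> and \<open>n\<close>; in the double sum
    \<open>k = m\<close> and \<open>l = n - m\<close>.\<close>
  define e where "e = (\<lambda>(i, j, n). 2 * j\<^sup>2 + 3 * i * j + i\<^sup>2 + tri i + i + (i + j) * n + i * n + n\<^sup>2
    + a * (i + j) + b * n)"
  define V where "V = (\<lambda>(i, j, n). q_var ^ e (i, j, n)
    * ((- 1) ^ i * \<phi> (i + j + n) * (ipoch i * ipoch j * ipoch n)))"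
  have "V = (\<lambda>x. q_var ^ e x * (case x of (i, j, n) \<Rightarrow> (- 1) ^ i * \<phi> (i + j + n) * (ipoch i * ipoch j * ipoch n)))"
    by (auto simp: V_def)
  moreover have "i \<le> e (i, j, n) \<and> j \<le> e (i, j, n) \<and> n \<le> e (i, j, n)" for i j n
    using le_square_nat[of i] le_square_nat[of j] le_square_nat[of n] by (simp add: e_def)
  ultimately have V: "loc_fin V UNIV"
    by (simp only: loc_fin_q_var finite_triple_exponent)
  let ?g = "\<lambda>((m, n), i). (i, m - i, n :: nat) :: nat \<times> nat \<times> nat"
  let ?I = "Sigma UNIV (\<lambda>(m, n). {..m :: nat}) :: ((nat \<times> nat) \<times> nat) set"
  have g: "bij_betw ?g ?I UNIV"
    by (rule bij_betw_byWitness[where f' = "\<lambda>(i, j, n). ((i + j, n), i)"]) auto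
  have lg: "loc_fin (\<lambda>x. V (?g x)) ?I" using V by (simp only: loc_fin_reindex[OF g])
  define W where "W = (\<lambda>(m, n). \<Sum>i\<le>m. V (i, m - i, n))"
  have "fps_total V UNIV = fps_total (\<lambda>x. V (?g x)) ?I" by (rule fps_total_reindex[OF g, symmetric])
  also have "\<dots> = fps_total (\<lambda>x. fps_total (\<lambda>i. V (?g (x, i))) (case x of (m, n) \<Rightarrow> {..m})) UNIV"
    by (rule fps_total_Sigma[OF lg])
  also have "\<dots> = fps_total W UNIV"
    by (rule fps_total_cong) (auto simp: W_def fps_total_finite)
  also have "\<dots> = fps_total W {(m, n). m \<le> n}"
  proof (rule fps_total_subset)
    fix x assume "x \<in> UNIV - {(m :: nat, n). m \<le> n}"
    then obtain m n where x: "x = (m, n)" "n < m" by (cases x) auto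
    \<comment> \<open>For \<open>n < m\<close> the expansion is a product whose factor at
      \<open>k = d\<close> is zero, and \<open>d < m\<close> puts it in range. So the triple series
      may run over all pairs without adding anything.\<close>
    define d where "d = m - n - 1"
    have d: "m = n + 1 + d" "d < m" using x by (auto simp: d_def)
    have "W x = (q_var ^ (m * (m + n + 1) + m * n + n\<^sup>2 + a * m + b * n) * (\<phi> (m + n) * ipoch n))
        * (ipoch m * (\<Prod>k<m. q_var ^ d - 1 * q_var ^ k))"
      unfolding x W_def prod.case
    proof (rule sum_q_binomial)
      fix i assume i: "i \<le> m"
      have s: "i + (m - i) = m" using i by simp
      have "V (i, m - i, n) = q_var ^ (m * (m + n + 1) + m * n + n\<^sup>2 + a * m + b * n + (tri i + d * (m - i)))
         * ((- 1) ^ i * \<phi> (m + n) * (ipoch i * ipoch (m - i) * ipoch n))"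
        unfolding V_def e_def prod.case expand_second_pair[OF i d(1)] unfolding s ..
      then show "V (i, m - i, n) = (q_var ^ (m * (m + n + 1) + m * n + n\<^sup>2 + a * m + b * n) * (\<phi> (m + n) * ipoch n))
         * ((- 1) ^ i * q_var ^ tri i * 1 ^ i * (q_var ^ d) ^ (m - i) * (ipoch i * ipoch (m - i)))"
        by (simp only: power_add power_mult_distrib power_mult[symmetric] power_one add_mult_distrib add_mult_distrib2 mult_1_left mult_1_right mult_ac)
    qed
    also have "(\<Prod>k<m. q_var ^ d - 1 * q_var ^ k) = 0"
      using d by (intro prod_zero) auto
    finally show "W x = 0" by simp
  qed simp
  also have "\<dots> = fps_total (\<lambda>x. W (case x of (k, l) \<Rightarrow> (k, k + l))) UNIV"
    by (rule fps_total_reindex[symmetric], rule bij_betw_byWitness[where f' = "\<lambda>(m, n). (m, n - m)"]) auto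
  also have "\<dots> = fps_total (\<lambda>(k, l). q_var ^ (4 * k\<^sup>2 + 3 * k * l + l\<^sup>2 + a * k + b * (k + l))
      * (\<phi> (2 * k + l) * (ipoch k * ipoch l))) UNIV"
  proof (rule fps_total_cong)
    fix x :: "nat \<times> nat"
    obtain k l where x: "x = (k, l)" by (cases x)
    have kl: "2 * k + l = k + (k + l)" by simp
    have "W (k, k + l) = (q_var ^ (4 * k\<^sup>2 + 3 * k * l + l\<^sup>2 + a * k + b * (k + l)) * (\<phi> (2 * k + l) * ipoch (k + l)))
        * (ipoch k * (\<Prod>i<k. 1 - q_var ^ Suc l * q_var ^ i))"
      unfolding W_def prod.case
    proof (rule sum_q_binomial)
      fix i assume i: "i \<le> k"
      have s: "i + (k - i) = k" using i by simp
      have "V (i, k - i, k + l) = q_var ^ (4 * k\<^sup>2 + 3 * k * l + l\<^sup>2 + a * k + b * (k + l) + (tri i + (l + 1) * i))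
         * ((- 1) ^ i * \<phi> (k + (k + l)) * (ipoch i * ipoch (k - i) * ipoch (k + l)))"
        unfolding V_def e_def prod.case expand_first_pair[OF i] unfolding s ..
      then show "V (i, k - i, k + l) = (q_var ^ (4 * k\<^sup>2 + 3 * k * l + l\<^sup>2 + a * k + b * (k + l)) * (\<phi> (2 * k + l) * ipoch (k + l)))
         * ((- 1) ^ i * q_var ^ tri i * (q_var ^ Suc l) ^ i * 1 ^ (k - i) * (ipoch i * ipoch (k - i)))"
        unfolding kl Suc_eq_plus1 by (simp only: power_add power_mult_distrib power_mult[symmetric] power_one add_mult_distrib add_mult_distrib2 mult_1_left mult_1_right mult_ac)
    qed
    also have "\<dots> = q_var ^ (4 * k\<^sup>2 + 3 * k * l + l\<^sup>2 + a * k + b * (k + l)) * (\<phi> (2 * k + l) * (ipoch k * ipoch l))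
        * (ipoch (k + l) * qpoch (k + l))"
      unfolding qpoch_add by (simp only: add.commute[of l k] mult_ac)
    finally show "W (case x of (k, l) \<Rightarrow> (k, k + l)) = (case x of (k, l) \<Rightarrow>
        q_var ^ (4 * k\<^sup>2 + 3 * k * l + l\<^sup>2 + a * k + b * (k + l)) * (\<phi> (2 * k + l) * (ipoch k * ipoch l)))"
      by (simp only: x prod.case ipoch_qpoch mult_1_right)
  qed
  finally have left: "fps_total V UNIV = \<dots>" .
  \<comment> \<open>The second grouping fixes \<open>j\<close> and \<open>N = i + n\<close>. The
    argument of \<open>\<phi>\<close> is \<open>j + N\<close> and does not involve \<open>i\<close>,
    so the q-binomial theorem applies again.\<close>
  let ?h = "\<lambda>(j, N, i). (i, j, N - i :: nat) :: nat \<times> nat \<times> nat"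
  let ?J = "Sigma UNIV (\<lambda>j. Sigma UNIV (\<lambda>N. {..N :: nat})) :: (nat \<times> nat \<times> nat) set"
  have h: "bij_betw ?h ?J UNIV"
    by (rule bij_betw_byWitness[where f' = "\<lambda>(i, j, n). (j, i + n, i)"]) auto
  have lh: "loc_fin (\<lambda>x. V (?h x)) ?J" using V by (simp only: loc_fin_reindex[OF h])
  have lh': "loc_fin (\<lambda>y. V (?h (j, y))) (Sigma UNIV (\<lambda>N. {..N}))" for j
    by (rule loc_fin_Sigma_inner[OF lh]) simp
  have inner: "(\<Sum>i\<le>N. V (i, j, N - i)) = q_var ^ (2 * j\<^sup>2 + a * j) * (ipoch j * ipoch (2 * j + a')) * S j N" for j N
  proof -
    have "(\<Sum>i\<le>N. V (i, j, N - i)) = (q_var ^ (2 * j\<^sup>2 + a * j) * q_var ^ (N\<^sup>2 + (j + b) * N) * (\<phi> (j + N) * ipoch j))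
        * (ipoch N * (\<Prod>k<N. 1 - q_var ^ Suc (2 * j + a') * q_var ^ k))"
    proof (rule sum_q_binomial)
      fix i assume i: "i \<le> N"
      have s: "i + j + (N - i) = j + N" using i by simp
      have "V (i, j, N - i) = q_var ^ (2 * j\<^sup>2 + a * j + (N\<^sup>2 + (j + b) * N) + (tri i + (2 * j + a' + 1) * i))
         * ((- 1) ^ i * \<phi> (j + N) * (ipoch i * ipoch j * ipoch (N - i)))"
        unfolding V_def e_def prod.case expand_third_pair[OF i a] unfolding s ..
      then show "V (i, j, N - i) = (q_var ^ (2 * j\<^sup>2 + a * j) * q_var ^ (N\<^sup>2 + (j + b) * N) * (\<phi> (j + N) * ipoch j))
         * ((- 1) ^ i * q_var ^ tri i * (q_var ^ Suc (2 * j + a')) ^ i * 1 ^ (N - i) * (ipoch i * ipoch (N - i)))"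
        unfolding Suc_eq_plus1 by (simp only: power_add power_mult_distrib power_mult[symmetric] power_one add_mult_distrib add_mult_distrib2 mult_1_left mult_1_right mult_ac)
    qed
    then show ?thesis unfolding qpoch_add S_def by (simp only: mult_ac)
  qed
  have LS: "loc_fin (S j) UNIV" for j
    unfolding S_def by (rule loc_fin_single)
  have "fps_total V UNIV = fps_total (\<lambda>x. V (?h x)) ?J" by (rule fps_total_reindex[OF h, symmetric])
  also have "\<dots> = fps_total (\<lambda>j. fps_total (\<lambda>y. V (?h (j, y))) (Sigma UNIV (\<lambda>N. {..N}))) UNIV"
    by (rule fps_total_Sigma[OF lh])
  also have "\<dots> = fps_total (\<lambda>j. fps_total (\<lambda>N. fps_total (\<lambda>i. V (?h (j, N, i))) {..N}) UNIV) UNIV"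
    by (rule fps_total_cong, rule fps_total_Sigma[OF lh'])
  also have "\<dots> = fps_total (\<lambda>j. fps_total (\<lambda>N. q_var ^ (2 * j\<^sup>2 + a * j) * (ipoch j * ipoch (2 * j + a')) * S j N) UNIV) UNIV"
    by (intro fps_total_cong) (simp only: fps_total_finite finite_atMost prod.case inner)
  also have "\<dots> = fps_total (\<lambda>j. q_var ^ (2 * j\<^sup>2 + a * j) * (ipoch j * ipoch (2 * j + a')) * fps_total (S j) UNIV) UNIV"
    by (intro fps_total_cong fps_total_cmult LS)
  finally show ?thesis unfolding left by (simp only: mult.assoc)
qed

section \<open>Evaluation of the inner sums by telescoping\<close>

lemma K_certificate:
  fixes c q z :: "'a::comm_ring_1"
  shows "(1 - z) * ((1 - c * q) - c * q * z + c ^ 3 * q\<^sup>2 * z\<^sup>2)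
    - c * q * z\<^sup>2 * (1 - c\<^sup>2 * q * z) * ((1 - c * q) - c * q * (q * z) + c ^ 3 * q\<^sup>2 * (q * z)\<^sup>2)
    = (1 - c * q) * (1 - c\<^sup>2 * q * z\<^sup>2) - z * (1 - c\<^sup>2 * q * z) * (1 - c\<^sup>2 * q\<^sup>2 * z) * (1 - c\<^sup>2 * q ^ 3 * z\<^sup>2)"
  by (simp add: algebra_simps eval_nat_numeral)

lemma S_certificate:
  fixes c q z :: "'a::comm_ring_1"
  shows "(1 - z) * (1 - c * q * z) - c * q * z\<^sup>2 * (1 - c\<^sup>2 * q ^ 3 * z) * (1 - c * q * (q * z))
    = (1 - c ^ 4 * q ^ 6 * z ^ 4) - (1 + c * q) * z * (1 - c\<^sup>2 * q ^ 3 * z\<^sup>2)"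
  by (simp add: algebra_simps eval_nat_numeral)

text \<open>The ratio of consecutive terms is rational in \<open>q_var ^ n\<close>. After clearing
  its denominator, a telescoping relation becomes a polynomial identity in
  \<open>z = q_var ^ n\<close> and \<open>c = q_var ^ a\<close>.\<close>

lemma pochhammer_ratio_Suc:
  defines "t \<equiv> \<lambda>a d n. q_var ^ (n\<^sup>2 + a * n) * (ipoch n * qpoch (d + n))"
  shows "t a d (Suc n) * (1 - q_var * q_var ^ n)
    = t a d n * (q_var ^ a * q_var * (q_var ^ n)\<^sup>2 * (1 - q_var ^ d * q_var * q_var ^ n))"
proof -
  have e: "(Suc n)\<^sup>2 + a * Suc n = (n\<^sup>2 + a * n) + (a + 1 + n * 2)"
    by (simp add: power2_eq_square)
  have s: "q_var ^ Suc (d + n) = q_var ^ d * q_var * q_var ^ n" by (simp add: power_add mult_ac)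
  have "t a d (Suc n) * (1 - q_var * q_var ^ n) = q_var ^ (n\<^sup>2 + a * n) * q_var ^ (a + 1 + n * 2)
      * ((ipoch (Suc n) * (1 - q_var ^ Suc n)) * (qpoch (d + n) * (1 - q_var ^ Suc (d + n))))"
    unfolding t_def e add_Suc_right qpoch_Suc[of "d + n"] power_add[of _ "n\<^sup>2 + a * n"] power_Suc[of _ n]
    by (simp only: mult_ac)
  also have "\<dots> = t a d n * (q_var ^ a * q_var * (q_var ^ n)\<^sup>2 * (1 - q_var ^ d * q_var * q_var ^ n))"
    unfolding ipoch_Suc s t_def by (simp only: power_add power_one_right power_mult mult_ac)
  finally show ?thesis .
qed

text \<open>The sum for \<open>Suc a\<close> is \<open>1 - q_var ^ Suc a\<close> times the sum for
  \<open>a\<close>, because the termwise difference telescopes to zero. At \<open>a = 0\<close> the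
  summand itself is a difference of consecutive \<open>q_var ^ (N^2)\<close>.\<close>

lemma fps_total_K:
  "fps_total (\<lambda>N. q_var ^ (N\<^sup>2 + a * N) * ((1 - q_var ^ (2 * a + 2 * N + 1)) * (ipoch N * qpoch (2 * a + N)))) UNIV = qpoch a"
proof (induction a)
  case 0
  have "fps_total (\<lambda>N. q_var ^ (N\<^sup>2 + 0 * N) * ((1 - q_var ^ (2 * 0 + 2 * N + 1)) * (ipoch N * qpoch (2 * 0 + N)))) UNIV
     = fps_total (\<lambda>N. q_var ^ (N\<^sup>2) - q_var ^ ((Suc N)\<^sup>2)) UNIV"
  proof (rule fps_total_cong)
    fix N
    have e: "(Suc N)\<^sup>2 = N\<^sup>2 + (2 * N + 1)" by (simp add: power2_eq_square)
    show "q_var ^ (N\<^sup>2 + 0 * N) * ((1 - q_var ^ (2 * 0 + 2 * N + 1)) * (ipoch N * qpoch (2 * 0 + N)))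
      = q_var ^ (N\<^sup>2) - q_var ^ ((Suc N)\<^sup>2)"
      unfolding e power_add[of _ "N\<^sup>2" "2 * N + 1"] by (simp add: ipoch_qpoch algebra_simps)
  qed
  also have "\<dots> = q_var ^ (0\<^sup>2)"
  proof (rule fps_total_telescope)
    fix N m :: nat assume "m < N"
    then have "m < 2 * N\<^sup>2" using le_square_nat[of N] by linarith
    then show "fps_nth (q_var ^ N\<^sup>2) m = 0" using q_var_low[of m "N\<^sup>2" 1] by simp
  qed
  finally show ?case by simp
next
  case (Suc a)
  define t where "t n = q_var ^ (n\<^sup>2 + a * n) * (ipoch n * qpoch (2 * a + n))" for n
  define c z where "c = q_var ^ a" and "z n = q_var ^ n" for n :: nat
  \<comment> \<open>Polynomial factor of the antidifference; \<open>K_certificate\<close> is the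
    telescoping relation with \<open>t n\<close> divided out. The factor \<open>1 - z n\<close> of
    \<open>?G n\<close> makes \<open>?G 0\<close> vanish and, at \<open>Suc n\<close>, supplies the
    denominator of the ratio of consecutive terms.\<close>
  define \<rho> where "\<rho> n = (1 - c * q_var) - c * q_var * z n + c ^ 3 * q_var\<^sup>2 * (z n)\<^sup>2" for n
  let ?K = "\<lambda>a N. q_var ^ (N\<^sup>2 + a * N) * ((1 - q_var ^ (2 * a + 2 * N + 1)) * (ipoch N * qpoch (2 * a + N)))"
  let ?G = "\<lambda>n. t n * ((1 - z n) * \<rho> n)"
  have K1: "?K a n = t n * (1 - c\<^sup>2 * q_var * (z n)\<^sup>2)" for n
    unfolding t_def c_def z_def
    by (simp add: power_add power_mult mult_ac power2_eq_square power_mult_distrib)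
  have K2: "?K (Suc a) n = t n * (z n * (1 - c\<^sup>2 * q_var * z n) * (1 - c\<^sup>2 * q_var\<^sup>2 * z n) * (1 - c\<^sup>2 * q_var ^ 3 * (z n)\<^sup>2))" for n
  proof -
    have d: "2 * Suc a + n = Suc (Suc (2 * a + n))" "n\<^sup>2 + Suc a * n = (n\<^sup>2 + a * n) + n" by simp_all
    have p: "q_var ^ Suc (2 * a + n) = c\<^sup>2 * q_var * z n" "q_var ^ Suc (Suc (2 * a + n)) = c\<^sup>2 * q_var\<^sup>2 * z n"
      "q_var ^ (2 * Suc a + 2 * n + 1) = c\<^sup>2 * q_var ^ 3 * (z n)\<^sup>2"
      unfolding c_def z_def
      by (simp_all add: power_add power_mult mult_ac power2_eq_square power_mult_distrib power3_eq_cube)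
    show ?thesis
      unfolding d qpoch_Suc p t_def power_add[of _ "n\<^sup>2 + a * n" n] z_def[of n]
      by (simp only: mult_ac)
  qed
  have step: "(1 - c * q_var) * ?K a n - ?K (Suc a) n = ?G n - ?G (Suc n)" for n
  proof -
    have zs: "z (Suc n) = q_var * z n" by (simp add: z_def)
    have ts: "t (Suc n) * (1 - q_var * z n) = t n * (c * q_var * (z n)\<^sup>2 * (1 - c\<^sup>2 * q_var * z n))"
      using pochhammer_ratio_Suc[of n a "2 * a"]
      unfolding t_def c_def z_def by (simp only: power_mult[symmetric] mult.commute[of a 2])
    have "?G (Suc n) = (t (Suc n) * (1 - q_var * z n)) * \<rho> (Suc n)" by (simp only: zs mult_ac)
    also have "\<dots> = t n * (c * q_var * (z n)\<^sup>2 * (1 - c\<^sup>2 * q_var * z n) * \<rho> (Suc n))"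
      unfolding ts by (simp only: mult_ac)
    finally have "?G n - ?G (Suc n) = t n * ((1 - z n) * \<rho> n - c * q_var * (z n)\<^sup>2 * (1 - c\<^sup>2 * q_var * z n) * \<rho> (Suc n))"
      by (simp only: right_diff_distrib)
    also have "\<dots> = t n * ((1 - c * q_var) * (1 - c\<^sup>2 * q_var * (z n)\<^sup>2)
        - z n * (1 - c\<^sup>2 * q_var * z n) * (1 - c\<^sup>2 * q_var\<^sup>2 * z n) * (1 - c\<^sup>2 * q_var ^ 3 * (z n)\<^sup>2))"
      unfolding \<rho>_def zs K_certificate ..
    also have "\<dots> = (1 - c * q_var) * ?K a n - ?K (Suc a) n"
      unfolding K1 K2 by (simp only: right_diff_distrib mult_ac)
    finally show ?thesis by simp
  qed
  have L: "loc_fin (?K a) UNIV" for a by (rule loc_fin_single)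
  have "(1 - c * q_var) * fps_total (?K a) UNIV - fps_total (?K (Suc a)) UNIV
      = fps_total (\<lambda>n. (1 - c * q_var) * ?K a n - ?K (Suc a) n) UNIV"
    by (simp only: fps_total_diff[OF loc_fin_cmult[OF L] L] fps_total_cmult[OF L])
  also have "\<dots> = ?G 0"
    unfolding step
  proof (rule fps_total_telescope)
    fix N m :: nat assume "m < N"
    then have "m < 2 * (N\<^sup>2 + a * N)" by (intro less_double[of m N] trans_le_add1 le_square_nat)
    then show "fps_nth (?G N) m = 0" unfolding t_def mult.assoc by (rule q_var_low)
  qed
  finally have "fps_total (?K (Suc a)) UNIV = (1 - c * q_var) * fps_total (?K a) UNIV"
    by (simp add: z_def)
  then show ?case unfolding Suc.IH qpoch_Suc by (simp add: c_def mult_ac)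
qed

text \<open>Reduced to \<open>fps_total_K\<close> at \<open>Suc j\<close>: the summand minus
  \<open>1 + q_var ^ Suc j\<close> times the summand evaluated there telescopes, again with boundary
  value zero.\<close>

lemma fps_total_S:
  "fps_total (\<lambda>N. q_var ^ (N\<^sup>2 + j * N) * ((1 - q_var ^ (4 * j + 4 * N + 6)) * (ipoch N * qpoch (2 * j + 2 + N)))) UNIV
    = (1 + q_var ^ Suc j) * qpoch (Suc j)"
proof -
  define t where "t n = q_var ^ (n\<^sup>2 + j * n) * (ipoch n * qpoch (2 * j + 2 + n))" for n
  define c z where "c = q_var ^ j" and "z n = q_var ^ n" for n :: nat
  let ?S = "\<lambda>N. q_var ^ (N\<^sup>2 + j * N) * ((1 - q_var ^ (4 * j + 4 * N + 6)) * (ipoch N * qpoch (2 * j + 2 + N)))"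
  let ?K = "\<lambda>a N. q_var ^ (N\<^sup>2 + a * N) * ((1 - q_var ^ (2 * a + 2 * N + 1)) * (ipoch N * qpoch (2 * a + N)))"
  let ?G = "\<lambda>n. t n * ((1 - z n) * (1 - c * q_var * z n))"
  have S1: "?S n = t n * (1 - c ^ 4 * q_var ^ 6 * z n ^ 4)" for n
    unfolding t_def c_def z_def
    by (simp add: power_add power_mult[symmetric] mult_ac)
  have K2: "?K (Suc j) n = t n * (z n * (1 - c\<^sup>2 * q_var ^ 3 * (z n)\<^sup>2))" for n
  proof -
    have d: "2 * Suc j + n = 2 * j + 2 + n" "n\<^sup>2 + Suc j * n = (n\<^sup>2 + j * n) + n" by simp_all
    have p: "q_var ^ (2 * Suc j + 2 * n + 1) = c\<^sup>2 * q_var ^ 3 * (z n)\<^sup>2"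
      unfolding c_def z_def
      by (simp add: power_add power_mult mult_ac power2_eq_square power_mult_distrib power3_eq_cube)
    show ?thesis
      unfolding d p t_def power_add[of _ "n\<^sup>2 + j * n" n] z_def[of n] by (simp only: mult_ac)
  qed
  have step: "?S n - (1 + c * q_var) * ?K (Suc j) n = ?G n - ?G (Suc n)" for n
  proof -
    have zs: "z (Suc n) = q_var * z n" by (simp add: z_def)
    have c3: "q_var ^ (2 * j + 2) * q_var = c\<^sup>2 * q_var ^ 3"
    proof -
      have "q_var ^ (2 * j + 2) * q_var = q_var ^ (j * 2 + 3)"
        unfolding power_Suc2[symmetric] by (rule arg_cong) simp
      then show ?thesis by (simp only: c_def power_add power_mult)
    qed
    have ts: "t (Suc n) * (1 - q_var * z n) = t n * (c * q_var * (z n)\<^sup>2 * (1 - c\<^sup>2 * q_var ^ 3 * z n))"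
      using pochhammer_ratio_Suc[of n j "2 * j + 2"] unfolding c3
      unfolding t_def c_def z_def .
    have "?G (Suc n) = (t (Suc n) * (1 - q_var * z n)) * (1 - c * q_var * z (Suc n))" by (simp only: zs mult_ac)
    also have "\<dots> = t n * (c * q_var * (z n)\<^sup>2 * (1 - c\<^sup>2 * q_var ^ 3 * z n) * (1 - c * q_var * z (Suc n)))"
      unfolding ts by (simp only: mult_ac)
    finally have "?G n - ?G (Suc n) = t n * ((1 - z n) * (1 - c * q_var * z n)
        - c * q_var * (z n)\<^sup>2 * (1 - c\<^sup>2 * q_var ^ 3 * z n) * (1 - c * q_var * z (Suc n)))"
      by (simp only: right_diff_distrib)
    also have "\<dots> = t n * ((1 - c ^ 4 * q_var ^ 6 * z n ^ 4) - (1 + c * q_var) * z n * (1 - c\<^sup>2 * q_var ^ 3 * (z n)\<^sup>2))"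
      unfolding zs S_certificate ..
    also have "\<dots> = ?S n - (1 + c * q_var) * ?K (Suc j) n"
      unfolding S1 K2 by (simp only: right_diff_distrib mult_ac)
    finally show ?thesis by simp
  qed
  have L: "loc_fin (?K a) UNIV" "loc_fin ?S UNIV" for a by (rule loc_fin_single)+
  have "fps_total ?S UNIV - (1 + c * q_var) * fps_total (?K (Suc j)) UNIV
      = fps_total (\<lambda>n. ?S n - (1 + c * q_var) * ?K (Suc j) n) UNIV"
    by (simp only: fps_total_diff[OF L(2) loc_fin_cmult[OF L(1)]] fps_total_cmult[OF L(1)])
  also have "\<dots> = ?G 0"
    unfolding step
  proof (rule fps_total_telescope)
    fix N m :: nat assume "m < N"
    then have "m < 2 * (N\<^sup>2 + j * N)" by (intro less_double[of m N] trans_le_add1 le_square_nat)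
    then show "fps_nth (?G N) m = 0" unfolding t_def mult.assoc by (rule q_var_low)
  qed
  finally show ?thesis unfolding fps_total_K by (simp add: z_def c_def mult_ac)
qed

section \<open>Nahm sums with linear terms and their contiguity relations\<close>

definition pair_exponent :: "nat \<Rightarrow> nat \<Rightarrow> nat \<times> nat \<Rightarrow> nat" where
  "pair_exponent a b = (\<lambda>(k, l). 4 * k\<^sup>2 + 3 * k * l + l\<^sup>2 + a * k + b * l)"

definition nahm_term :: "nat \<Rightarrow> nat \<Rightarrow> nat \<times> nat \<Rightarrow> complex fps" where
  "nahm_term a b = (\<lambda>x. q_var ^ pair_exponent a b x * (ipoch (fst x) * ipoch (snd x)))"

abbreviation nahm_sum :: "nat \<Rightarrow> nat \<Rightarrow> complex fps" where
  "nahm_sum a b \<equiv> fps_total (nahm_term a b) UNIV"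

lemma loc_fin_pair_exponent: "loc_fin (\<lambda>x. q_var ^ pair_exponent a b x * y x) UNIV"
proof (rule loc_fin_q_var, rule finite_pair_exponent)
  fix k l
  show "k \<le> pair_exponent a b (k, l) \<and> l \<le> pair_exponent a b (k, l)"
    using le_square_nat[of k] le_square_nat[of l] by (simp add: pair_exponent_def)
qed

lemma loc_fin_nahm_term: "loc_fin (nahm_term a b) UNIV"
  unfolding nahm_term_def by (rule loc_fin_pair_exponent)

text \<open>Subtracting the sum with \<open>a + 1\<close> inserts the factor
  \<open>1 - q_var ^ k\<close>. It removes the terms with \<open>k = 0\<close> and cancels the last
  factor of the Pochhammer symbol in the others; shifting \<open>k\<close> by one adds
  \<open>8 * k + 3 * l\<close> to the exponent.\<close>

lemma nahm_sum_first: "nahm_sum a b = nahm_sum (a + 1) b + q_var ^ (4 + a) * nahm_sum (a + 8) (b + 3)"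
proof -
  let ?d = "\<lambda>x. nahm_term a b x - nahm_term (a + 1) b x"
  have d: "?d (k, l) = q_var ^ pair_exponent a b (k, l) * ((1 - q_var ^ k) * ipoch k * ipoch l)" for k l
  proof -
    have "pair_exponent (a + 1) b (k, l) = pair_exponent a b (k, l) + k" by (simp add: pair_exponent_def)
    then show ?thesis by (simp add: nahm_term_def power_add algebra_simps)
  qed
  have s: "?d (Suc k, l) = q_var ^ (4 + a) * nahm_term (a + 8) (b + 3) (k, l)" for k l
  proof -
    have "pair_exponent a b (Suc k, l) = (4 + a) + pair_exponent (a + 8) (b + 3) (k, l)"
      by (simp add: pair_exponent_def power2_eq_square algebra_simps)
    then have "?d (Suc k, l) = q_var ^ (4 + a) * q_var ^ pair_exponent (a + 8) (b + 3) (k, l)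
        * ((ipoch (Suc k) * (1 - q_var ^ Suc k)) * ipoch l)"
      unfolding d by (simp only: power_add mult_ac)
    then show ?thesis unfolding ipoch_Suc by (simp add: nahm_term_def mult.assoc)
  qed
  have "nahm_sum a b - nahm_sum (a + 1) b = fps_total ?d UNIV"
    by (rule fps_total_diff[symmetric]) (rule loc_fin_nahm_term)+
  also have "\<dots> = fps_total ?d (range (map_prod Suc id))"
  proof (rule fps_total_subset)
    fix x :: "nat \<times> nat" assume x: "x \<in> UNIV - range (map_prod Suc id)"
    obtain k l where kl: "x = (k, l)" by (cases x)
    have "k = 0"
    proof (cases k)
      case (Suc k')
      then have "x = map_prod Suc id (k', l)" using kl by simp
      then show ?thesis using x by blast
    qed
    then show "?d x = 0" unfolding kl d by simp
  qed simp
  also have "\<dots> = fps_total (\<lambda>x. ?d (map_prod Suc id x)) UNIV"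
    by (rule fps_total_reindex[symmetric]) (simp add: bij_betw_def prod.inj_map)
  also have "\<dots> = fps_total (\<lambda>x. q_var ^ (4 + a) * nahm_term (a + 8) (b + 3) x) UNIV"
    by (rule fps_total_cong) (metis s map_prod_simp id_apply surj_pair)
  also have "\<dots> = q_var ^ (4 + a) * nahm_sum (a + 8) (b + 3)"
    by (rule fps_total_cmult) (rule loc_fin_nahm_term)
  finally show ?thesis by (simp add: algebra_simps)
qed

lemma nahm_sum_second: "nahm_sum a b = nahm_sum a (b + 1) + q_var ^ (1 + b) * nahm_sum (a + 3) (b + 2)"
proof -
  let ?d = "\<lambda>x. nahm_term a b x - nahm_term a (b + 1) x"
  have d: "?d (k, l) = q_var ^ pair_exponent a b (k, l) * ((1 - q_var ^ l) * ipoch k * ipoch l)" for k l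
  proof -
    have "pair_exponent a (b + 1) (k, l) = pair_exponent a b (k, l) + l" by (simp add: pair_exponent_def)
    then show ?thesis by (simp add: nahm_term_def power_add algebra_simps)
  qed
  have s: "?d (k, Suc l) = q_var ^ (1 + b) * nahm_term (a + 3) (b + 2) (k, l)" for k l
  proof -
    have "pair_exponent a b (k, Suc l) = (1 + b) + pair_exponent (a + 3) (b + 2) (k, l)"
      by (simp add: pair_exponent_def power2_eq_square algebra_simps)
    then have "?d (k, Suc l) = q_var ^ (1 + b) * q_var ^ pair_exponent (a + 3) (b + 2) (k, l)
        * ((ipoch (Suc l) * (1 - q_var ^ Suc l)) * ipoch k)"
      unfolding d by (simp only: power_add mult_ac)
    then show ?thesis unfolding ipoch_Suc by (simp add: nahm_term_def mult_ac)
  qed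
  have "nahm_sum a b - nahm_sum a (b + 1) = fps_total ?d UNIV"
    by (rule fps_total_diff[symmetric]) (rule loc_fin_nahm_term)+
  also have "\<dots> = fps_total ?d (range (map_prod id Suc))"
  proof (rule fps_total_subset)
    fix x :: "nat \<times> nat" assume x: "x \<in> UNIV - range (map_prod id Suc)"
    obtain k l where kl: "x = (k, l)" by (cases x)
    have "l = 0"
    proof (cases l)
      case (Suc l')
      then have "x = map_prod id Suc (k, l')" using kl by simp
      then show ?thesis using x by blast
    qed
    then show "?d x = 0" unfolding kl d by simp
  qed simp
  also have "\<dots> = fps_total (\<lambda>x. ?d (map_prod id Suc x)) UNIV"
    by (rule fps_total_reindex[symmetric]) (simp add: bij_betw_def prod.inj_map)
  also have "\<dots> = fps_total (\<lambda>x. q_var ^ (1 + b) * nahm_term (a + 3) (b + 2) x) UNIV"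
    by (rule fps_total_cong) (metis s map_prod_simp id_apply surj_pair)
  also have "\<dots> = q_var ^ (1 + b) * nahm_sum (a + 3) (b + 2)"
    by (rule fps_total_cmult) (rule loc_fin_nahm_term)
  finally show ?thesis by (simp add: algebra_simps)
qed

lemma loc_fin_q_square:
  assumes "\<And>j. j \<le> e j"
  shows "loc_fin (\<lambda>j. q_var ^ e j * y j) UNIV"
proof (rule loc_fin_q_var)
  fix M
  have "{j \<in> UNIV. e j \<le> M} \<subseteq> {..M}"
    using order.trans[OF assms] by blast
  then show "finite {j \<in> UNIV. e j \<le> M}" by (rule finite_subset) (rule finite_atMost)
qed

text \<open>Instance \<open>a' = 2 * r\<close>, \<open>b = r\<close> of
  \<open>nahm_transform\<close>. The combination is chosen so that the factor depends on
  \<open>2 * k + l\<close> alone and turns the inner sum into \<open>fps_total_K\<close> at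
  \<open>j + r\<close>. The value \<open>r = 0\<close> is the vacuum; \<open>r = 1\<close> serves
  the Ramond sum.\<close>

lemma nahm_difference:
  "nahm_sum (4 * r) r - q_var ^ (2 * r + 1) * nahm_sum (4 * r + 4) (r + 2)
    = fps_total (\<lambda>j. q_var ^ (2 * j\<^sup>2 + 3 * r * j) * (ipoch j * ipoch (2 * j + 2 * r) * qpoch (j + r))) UNIV"
proof -
  let ?\<phi> = "\<lambda>n. 1 - q_var ^ (2 * n + 2 * r + 1)"
  have "nahm_sum (4 * r) r - q_var ^ (2 * r + 1) * nahm_sum (4 * r + 4) (r + 2)
      = fps_total (\<lambda>x. nahm_term (4 * r) r x - q_var ^ (2 * r + 1) * nahm_term (4 * r + 4) (r + 2) x) UNIV"
    by (simp only: fps_total_diff[OF loc_fin_nahm_term loc_fin_cmult[OF loc_fin_nahm_term]] fps_total_cmult[OF loc_fin_nahm_term])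
  also have "\<dots> = fps_total (\<lambda>(k, l). q_var ^ (4 * k\<^sup>2 + 3 * k * l + l\<^sup>2 + (3 * r) * k + r * (k + l))
      * (?\<phi> (2 * k + l) * (ipoch k * ipoch l))) UNIV"
  proof (rule fps_total_cong)
    fix x :: "nat \<times> nat"
    obtain k l where x: "x = (k, l)" by (cases x)
    have e: "pair_exponent (4 * r) r (k, l) = 4 * k\<^sup>2 + 3 * k * l + l\<^sup>2 + (3 * r) * k + r * (k + l)"
      "pair_exponent (4 * r + 4) (r + 2) (k, l) = pair_exponent (4 * r) r (k, l) + (4 * k + 2 * l)"
      by (simp_all add: pair_exponent_def algebra_simps)
    have f: "2 * (2 * k + l) + 2 * r + 1 = (2 * r + 1) + (4 * k + 2 * l)" by simp
    show "nahm_term (4 * r) r x - q_var ^ (2 * r + 1) * nahm_term (4 * r + 4) (r + 2) x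
      = (case x of (k, l) \<Rightarrow> q_var ^ (4 * k\<^sup>2 + 3 * k * l + l\<^sup>2 + (3 * r) * k + r * (k + l))
      * (?\<phi> (2 * k + l) * (ipoch k * ipoch l)))"
      unfolding x prod.case nahm_term_def e(2) fst_conv snd_conv f e(1)[symmetric]
        power_add[of _ "2 * r + 1" "4 * k + 2 * l"] power_add[of _ "pair_exponent (4 * r) r (k, l)"]
      by (simp only: left_diff_distrib right_diff_distrib mult_1_left mult_ac)
  qed
  also have "\<dots> = fps_total (\<lambda>j. q_var ^ (2 * j\<^sup>2 + 3 * r * j) * (ipoch j * ipoch (2 * j + 2 * r)
      * fps_total (\<lambda>N. q_var ^ (N\<^sup>2 + (j + r) * N) * (?\<phi> (j + N) * (ipoch N * qpoch (2 * j + 2 * r + N)))) UNIV)) UNIV"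
    by (rule nahm_transform) simp
  also have "\<dots> = fps_total (\<lambda>j. q_var ^ (2 * j\<^sup>2 + 3 * r * j) * (ipoch j * ipoch (2 * j + 2 * r) * qpoch (j + r))) UNIV"
  proof (rule fps_total_cong)
    fix j
    have "2 * (j + N) + 2 * r + 1 = 2 * (j + r) + 2 * N + 1" "2 * j + 2 * r + N = 2 * (j + r) + N" for N by simp_all
    then show "q_var ^ (2 * j\<^sup>2 + 3 * r * j) * (ipoch j * ipoch (2 * j + 2 * r)
      * fps_total (\<lambda>N. q_var ^ (N\<^sup>2 + (j + r) * N) * (?\<phi> (j + N) * (ipoch N * qpoch (2 * j + 2 * r + N)))) UNIV)
      = q_var ^ (2 * j\<^sup>2 + 3 * r * j) * (ipoch j * ipoch (2 * j + 2 * r) * qpoch (j + r))"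
      by (simp only: fps_total_K)
  qed
  finally show ?thesis .
qed

lemma nahm_difference_0:
  "nahm_sum 0 0 - q_var * nahm_sum 4 2 = fps_total (\<lambda>j. q_var ^ (2 * j\<^sup>2) * ipoch (2 * j)) UNIV"
proof -
  have "nahm_sum 0 0 - q_var * nahm_sum 4 2
      = fps_total (\<lambda>j. q_var ^ (2 * j\<^sup>2 + 3 * 0 * j) * (ipoch j * ipoch (2 * j + 2 * 0) * qpoch (j + 0))) UNIV"
    using nahm_difference[of 0] by (simp del: add_2_eq_Suc')
  also have "\<dots> = fps_total (\<lambda>j. q_var ^ (2 * j\<^sup>2) * ipoch (2 * j)) UNIV"
    by (rule fps_total_cong) (simp add: mult.commute[of "ipoch _" "ipoch _"] mult.assoc ipoch_qpoch)
  finally show ?thesis .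
qed

lemma double_sum_vacuum:
  "((\<lambda>(k1, k2). q_var ^ (4 * k1\<^sup>2 + 3 * k1 * k2 + k2\<^sup>2) / (qpoch k1 * qpoch k2) * (1 - q_var ^ (4 * k1 + 2 * k2 + 1)))
    has_sum fps_total (\<lambda>j. q_var ^ (2 * j\<^sup>2) * ipoch (2 * j)) UNIV) UNIV" (is "(?f has_sum _) _")
proof -
  have f: "?f = (\<lambda>x. nahm_term 0 0 x - q_var * nahm_term 4 2 x)"
  proof (rule ext, clarify)
    fix k l
    have "pair_exponent 4 2 (k, l) + 1 = pair_exponent 0 0 (k, l) + (4 * k + 2 * l + 1)"
      by (simp add: pair_exponent_def)
    then have qq: "q_var * q_var ^ pair_exponent 4 2 (k, l) = q_var ^ pair_exponent 0 0 (k, l) * q_var ^ (4 * k + 2 * l + 1)"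
      by (metis power_add Suc_eq_plus1 power_Suc)
    have "nahm_term 0 0 (k, l) - q_var * nahm_term 4 2 (k, l)
       = q_var ^ pair_exponent 0 0 (k, l) * (ipoch k * ipoch l) - (q_var * q_var ^ pair_exponent 4 2 (k, l)) * (ipoch k * ipoch l)"
      by (simp only: nahm_term_def fst_conv snd_conv mult.assoc)
    also have "\<dots> = q_var ^ pair_exponent 0 0 (k, l) * (ipoch k * ipoch l) * (1 - q_var ^ (4 * k + 2 * l + 1))"
      unfolding qq by (simp only: right_diff_distrib mult_1_left mult_1_right mult_ac)
    finally show "q_var ^ (4 * k\<^sup>2 + 3 * k * l + l\<^sup>2) / (qpoch k * qpoch l) * (1 - q_var ^ (4 * k + 2 * l + 1))
      = nahm_term 0 0 (k, l) - q_var * nahm_term 4 2 (k, l)"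
      unfolding divide_qpoch by (simp add: pair_exponent_def)
  qed
  have "fps_total ?f UNIV = nahm_sum 0 0 - q_var * nahm_sum 4 2"
    unfolding f fps_total_diff[OF loc_fin_nahm_term loc_fin_cmult[OF loc_fin_nahm_term]] fps_total_cmult[OF loc_fin_nahm_term] ..
  also note nahm_difference_0
  finally show ?thesis
    using has_sum_total[of ?f UNIV] f loc_fin_diff[OF loc_fin_nahm_term loc_fin_cmult[OF loc_fin_nahm_term], of 0 0 q_var 4 2]
    by simp
qed

text \<open>With \<open>n = 2 * k1 + k2\<close> the factor is
  \<open>1 - q_var ^ (4 * n + 6)\<close>, so the inner sum is \<open>fps_total_S\<close>. Its extra
  factor \<open>1 + q_var ^ Suc j\<close> joins with \<open>1 - q_var ^ Suc j\<close> to cancel the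
  top factor of \<open>qpoch (2 * j + 2)\<close>.\<close>

lemma double_sum_fermion:
  "((\<lambda>(k1, k2). q_var ^ (4 * k1\<^sup>2 + 3 * k1 * k2 + k2\<^sup>2 + 2 * k1) / (qpoch k1 * qpoch k2) * (1 - q_var ^ (8 * k1 + 4 * k2 + 6)))
    has_sum fps_total (\<lambda>j. q_var ^ (2 * j\<^sup>2 + 2 * j) * ipoch (2 * j + 1)) UNIV) UNIV" (is "(?f has_sum _) _")
proof -
  let ?\<phi> = "\<lambda>n. 1 - q_var ^ (4 * n + 6)"
  have f: "?f = (\<lambda>x. q_var ^ pair_exponent 2 0 x * ((ipoch (fst x) * ipoch (snd x)) * ?\<phi> (2 * fst x + snd x)))"
    by (rule ext) (auto simp: divide_qpoch pair_exponent_def mult.assoc)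
  have lf: "loc_fin ?f UNIV" unfolding f by (rule loc_fin_pair_exponent)
  have "fps_total ?f UNIV = fps_total (\<lambda>(k, l). q_var ^ (4 * k\<^sup>2 + 3 * k * l + l\<^sup>2 + 2 * k + 0 * (k + l))
      * (?\<phi> (2 * k + l) * (ipoch k * ipoch l))) UNIV"
    unfolding f by (rule fps_total_cong) (auto simp: pair_exponent_def mult_ac)
  also have "\<dots> = fps_total (\<lambda>j. q_var ^ (2 * j\<^sup>2 + 2 * j) * (ipoch j * ipoch (2 * j + 2)
      * fps_total (\<lambda>N. q_var ^ (N\<^sup>2 + (j + 0) * N) * (?\<phi> (j + N) * (ipoch N * qpoch (2 * j + 2 + N)))) UNIV)) UNIV"
    by (rule nahm_transform) simp
  also have "\<dots> = fps_total (\<lambda>j. q_var ^ (2 * j\<^sup>2 + 2 * j) * ipoch (2 * j + 1)) UNIV"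
  proof (rule fps_total_cong)
    fix j :: nat
    have e: "4 * (j + N) + 6 = 4 * j + 4 * N + 6" for N :: nat by simp
    have s: "2 * j + 2 = Suc (2 * j + 1)" "Suc (2 * j + 1) = Suc j + Suc j" by simp_all
    have "(1 + q_var ^ Suc j) * (1 - q_var ^ Suc j) = 1 - q_var ^ Suc (2 * j + 1)"
      unfolding s(2) power_add by (simp add: algebra_simps)
    moreover have "ipoch j * ipoch (2 * j + 2) * ((1 + q_var ^ Suc j) * qpoch (Suc j))
       = (ipoch j * qpoch j) * (ipoch (2 * j + 2) * ((1 + q_var ^ Suc j) * (1 - q_var ^ Suc j)))"
      unfolding qpoch_Suc by (simp only: mult_ac)
    ultimately have "ipoch j * ipoch (2 * j + 2) * ((1 + q_var ^ Suc j) * qpoch (Suc j)) = ipoch (2 * j + 1)"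
      by (simp only: s(1) ipoch_Suc ipoch_qpoch mult_1_left)
    then show "q_var ^ (2 * j\<^sup>2 + 2 * j) * (ipoch j * ipoch (2 * j + 2)
      * fps_total (\<lambda>N. q_var ^ (N\<^sup>2 + (j + 0) * N) * (?\<phi> (j + N) * (ipoch N * qpoch (2 * j + 2 + N)))) UNIV)
      = q_var ^ (2 * j\<^sup>2 + 2 * j) * ipoch (2 * j + 1)"
      unfolding e add_0_right fps_total_S by simp
  qed
  finally show ?thesis using has_sum_total[OF lf] by simp
qed

text \<open>The Ramond factor is not a function of \<open>2 * k1 + k2\<close>, so
  \<open>nahm_transform\<close> does not apply to it directly. The single sum is instead written as
  the vacuum sum plus \<open>q_var\<close> times the case \<open>r = 1\<close> of
  \<open>nahm_difference\<close>, and contiguity relations reduce the Nahm sums that occur to the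
  two wanted ones.\<close>

lemma nahm_ramond:
  "nahm_sum 1 1 + q_var * nahm_sum 4 1 = fps_total (\<lambda>j. q_var ^ (2 * j\<^sup>2 - j) * ipoch (2 * j)) UNIV"
proof -
  let ?b1 = "\<lambda>j. q_var ^ (2 * j\<^sup>2 + 3 * 1 * j) * (ipoch j * ipoch (2 * j + 2 * 1) * qpoch (j + 1))"
  let ?g = "\<lambda>j. q_var ^ (2 * j\<^sup>2 - j) * ipoch (2 * j)" and ?b0 = "\<lambda>j. q_var ^ (2 * j\<^sup>2) * ipoch (2 * j)"
  have le: "j \<le> 2 * j\<^sup>2 - j" "j \<le> 2 * j\<^sup>2" "j \<le> 2 * j\<^sup>2 + 3 * 1 * j" for j :: nat
    using le_square_nat[of j] by linarith+
  have L: "loc_fin ?g UNIV" "loc_fin ?b0 UNIV" "loc_fin ?b1 UNIV"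
    by (rule loc_fin_q_square, rule le)+
  \<comment> \<open>The factor \<open>1 - q_var ^ j\<close> removes \<open>j = 0\<close>. At
    \<open>Suc j\<close> it is the new factor of \<open>qpoch (j + 1)\<close>, which matches the
    summand for \<open>r = 1\<close>.\<close>
  have d: "?g j - ?b0 j = q_var ^ (2 * j\<^sup>2 - j) * ((1 - q_var ^ j) * ipoch (2 * j))" for j
  proof -
    have "2 * j\<^sup>2 = (2 * j\<^sup>2 - j) + j" using le(2)[of j] by simp
    then have "q_var ^ (2 * j\<^sup>2) = q_var ^ (2 * j\<^sup>2 - j) * q_var ^ j" by (metis power_add)
    then show ?thesis by (simp add: algebra_simps)
  qed
  have "fps_total ?g UNIV - fps_total ?b0 UNIV = fps_total (\<lambda>j. ?g j - ?b0 j) UNIV"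
    by (rule fps_total_diff[symmetric]) (fact L)+
  also have "\<dots> = fps_total (\<lambda>j. ?g j - ?b0 j) (range Suc)"
  proof (rule fps_total_subset)
    fix j assume "j \<in> UNIV - range Suc"
    then have "j = 0" by (cases j) auto
    then show "?g j - ?b0 j = 0" by simp
  qed simp
  also have "\<dots> = fps_total (\<lambda>j. ?g (Suc j) - ?b0 (Suc j)) UNIV"
    by (rule fps_total_reindex[symmetric]) (simp add: bij_betw_def)
  also have "\<dots> = fps_total (\<lambda>j. q_var * ?b1 j) UNIV"
  proof (rule fps_total_cong)
    fix j
    have e: "2 * (Suc j)\<^sup>2 - Suc j = Suc (2 * j\<^sup>2 + 3 * 1 * j)" "2 * Suc j = 2 * j + 2 * 1"
      by (simp_all add: power2_eq_square)
    have "q_var * ?b1 j = q_var ^ Suc (2 * j\<^sup>2 + 3 * 1 * j) * ((1 - q_var ^ Suc j) * ipoch (2 * j + 2 * 1)) * (ipoch j * qpoch j)"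
      unfolding Suc_eq_plus1[symmetric] qpoch_Suc power_Suc[of _ "2 * j\<^sup>2 + 3 * 1 * j"] by (simp only: mult_ac)
    then show "?g (Suc j) - ?b0 (Suc j) = q_var * ?b1 j" unfolding d[of "Suc j"] unfolding e by (simp only: ipoch_qpoch mult_1_right)
  qed
  also have "\<dots> = q_var * fps_total ?b1 UNIV" by (rule fps_total_cmult) (fact L)
  also have "fps_total ?b1 UNIV = nahm_sum 4 1 - q_var ^ 3 * nahm_sum 8 3"
    unfolding nahm_difference[of 1, symmetric] by (simp add: eval_nat_numeral)
  finally have g: "fps_total ?g UNIV = fps_total ?b0 UNIV + q_var * (nahm_sum 4 1 - q_var ^ 3 * nahm_sum 8 3)"
    by (simp add: algebra_simps)
  have b0: "fps_total ?b0 UNIV = nahm_sum 0 0 - q_var * nahm_sum 4 2" by (simp only: nahm_difference_0)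
  \<comment> \<open>With these four relations the contributions of \<open>nahm_sum 4 2\<close>,
    \<open>nahm_sum 8 4\<close> and \<open>nahm_sum 11 5\<close> cancel.\<close>
  have "nahm_sum 0 0 = nahm_sum 0 1 + q_var * nahm_sum 3 2" using nahm_sum_second[of 0 0] by (simp del: add_2_eq_Suc')
  moreover have "nahm_sum 0 1 = nahm_sum 1 1 + q_var ^ 4 * nahm_sum 8 4" using nahm_sum_first[of 0 1] by simp
  moreover have "nahm_sum 3 2 = nahm_sum 4 2 + q_var ^ 7 * nahm_sum 11 5" using nahm_sum_first[of 3 2] by simp
  moreover have "nahm_sum 8 3 = nahm_sum 8 4 + q_var ^ 4 * nahm_sum 11 5" using nahm_sum_second[of 8 3] by simp
  ultimately show ?thesis unfolding g b0 by (simp add: algebra_simps eval_nat_numeral)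
qed

lemma double_sum_ramond:
  "((\<lambda>(k1, k2). q_var ^ (4 * k1\<^sup>2 + 3 * k1 * k2 + k2\<^sup>2) / (qpoch k1 * qpoch k2) * (q_var ^ (k1 + k2) + q_var ^ (4 * k1 + k2 + 1)))
    has_sum fps_total (\<lambda>j. q_var ^ (2 * j\<^sup>2 - j) * ipoch (2 * j)) UNIV) UNIV" (is "(?f has_sum _) _")
proof -
  have f: "?f = (\<lambda>x. nahm_term 1 1 x + q_var * nahm_term 4 1 x)"
  proof (rule ext, clarify)
    fix k l
    have e: "pair_exponent 4 1 (k, l) + 1 = pair_exponent 0 0 (k, l) + (4 * k + l + 1)"
      "pair_exponent 1 1 (k, l) = pair_exponent 0 0 (k, l) + (k + l)"
      by (simp_all add: pair_exponent_def)
    have q1: "q_var * q_var ^ pair_exponent 4 1 (k, l) = q_var ^ pair_exponent 0 0 (k, l) * q_var ^ (4 * k + l + 1)"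
      using e(1) by (metis power_add Suc_eq_plus1 power_Suc)
    have q2: "q_var ^ pair_exponent 1 1 (k, l) = q_var ^ pair_exponent 0 0 (k, l) * q_var ^ (k + l)"
      unfolding e(2) by (rule power_add)
    have "nahm_term 1 1 (k, l) + q_var * nahm_term 4 1 (k, l)
       = q_var ^ pair_exponent 1 1 (k, l) * (ipoch k * ipoch l) + (q_var * q_var ^ pair_exponent 4 1 (k, l)) * (ipoch k * ipoch l)"
      by (simp only: nahm_term_def fst_conv snd_conv mult.assoc)
    also have "\<dots> = q_var ^ pair_exponent 0 0 (k, l) * (ipoch k * ipoch l) * (q_var ^ (k + l) + q_var ^ (4 * k + l + 1))"
      unfolding q1 q2 by (simp only: distrib_left mult_ac)
    finally show "q_var ^ (4 * k\<^sup>2 + 3 * k * l + l\<^sup>2) / (qpoch k * qpoch l) * (q_var ^ (k + l) + q_var ^ (4 * k + l + 1))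
      = nahm_term 1 1 (k, l) + q_var * nahm_term 4 1 (k, l)"
      unfolding divide_qpoch by (simp add: pair_exponent_def)
  qed
  have L: "loc_fin (nahm_term 1 1) UNIV" "loc_fin (\<lambda>x. q_var * nahm_term 4 1 x) UNIV"
    by (intro loc_fin_cmult loc_fin_nahm_term)+
  have "fps_total ?f UNIV = nahm_sum 1 1 + q_var * nahm_sum 4 1"
    unfolding f fps_total_add[OF L] fps_total_cmult[OF loc_fin_nahm_term] ..
  then show ?thesis
    unfolding nahm_ramond using has_sum_total[OF loc_fin_add[OF L]] unfolding f by simp
qed

section \<open>Characters as single sums\<close>

lemma fps_compose_X_square_nth:
  "fps_nth (fps_compose a (fps_X\<^sup>2)) m = (if even m then fps_nth a (m div 2) else 0)"
proof -
  have "fps_nth (fps_compose a (fps_X\<^sup>2)) m = (\<Sum>i=0..m. fps_nth a i * (if m = 2 * i then 1 else 0))"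
    unfolding fps_compose_nth power_mult[symmetric] fps_X_power_nth ..
  also have "\<dots> = (\<Sum>i=0..m. if i = m div 2 then (if even m then fps_nth a i else 0) else 0)"
    by (rule sum.cong) auto
  finally show ?thesis by simp
qed

context fermion
begin

section \<open>Generating series of occupation sets\<close>

definition fermion_states :: "nat \<Rightarrow> nat \<Rightarrow> nat fset set" where
  "fermion_states k m = {S. allowed S \<and> fcard S = k \<and> \<Sum>(fset S) = m}"

definition fermion_series :: "nat \<Rightarrow> complex fps" where
  "fermion_series k = Abs_fps (\<lambda>m. of_nat (card (fermion_states k m)))"

lemma fset_le_sum: "fset S \<subseteq> {..\<Sum>(fset S)}" for S :: "nat fset"
  using member_le_sum[of _ "fset S" "\<lambda>x. x"] by auto

text \<open>The successor allows for the mode 0, which can be occupied without energy.\<close>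

lemma fcard_le_sum: "fcard S \<le> Suc (\<Sum>(fset S))" for S :: "nat fset"
  using card_mono[OF _ fset_le_sum[of S]] by (simp add: fcard.rep_eq)

lemma finite_fermion_states: "finite (fermion_states k m)"
proof (rule finite_imageD)
  have "fset ` fermion_states k m \<subseteq> Pow {..m}"
    using fset_le_sum by (fastforce simp: fermion_states_def)
  then show "finite (fset ` fermion_states k m)" by (rule finite_subset) simp
  show "inj_on fset (fermion_states k m)" by (simp add: inj_on_def fset_inject)
qed

definition fshift :: "nat fset \<Rightarrow> nat fset" where
  "fshift S = (\<lambda>s. s + 2) |`| S"

lemma fshift_sum: "\<Sum>(fset (fshift S)) = \<Sum>(fset S) + 2 * fcard S"
  by (simp add: fshift_def sum.reindex sum.distrib fcard.rep_eq del: add_2_eq_Suc')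

lemma fcard_fshift: "fcard (fshift S) = fcard S"
  by (simp add: fshift_def fcard.rep_eq card_image del: add_2_eq_Suc')

lemma allowed_fshift: "allowed (fshift S) \<longleftrightarrow> allowed S"
  by (auto simp: allowed_def fshift_def)

lemma inj_fshift: "inj fshift"
proof (rule injI)
  fix S T assume "fshift S = fshift T"
  then have "(\<lambda>s. s + 2) ` fset S = (\<lambda>s. s + 2) ` fset T"
    unfolding fshift_def by (metis fimage.rep_eq)
  then have "fset S = fset T" by (simp add: inj_image_eq_iff del: add_2_eq_Suc')
  then show "S = T" by (simp add: fset_inject)
qed

lemma fshift_notin: "nat p |\<notin>| fshift S"
  using p by (auto simp: fshift_def)

lemma fshift_surj:
  assumes "allowed S" "nat p |\<notin>| S"
  shows "\<exists>T. S = fshift T"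
proof -
  have "s \<ge> 2" if "s |\<in>| S" for s
  proof (rule ccontr)
    assume "\<not> s \<ge> 2"
    then have "int s mod 2 = int s" by simp
    moreover have "int s mod 2 = p" using assms(1) that by (simp add: allowed_def)
    ultimately have "s = nat p" by linarith
    then show False using assms(2) that by simp
  qed
  then have "(\<lambda>s. s - 2 + 2) ` fset S = (\<lambda>s. s) ` fset S" by (intro image_cong) (auto simp del: add_2_eq_Suc')
  then have "fset S = fset (fshift ((\<lambda>s. s - 2) |`| S))"
    by (simp add: fshift_def image_image del: add_2_eq_Suc')
  then show ?thesis by (auto simp: fset_inject)
qed

text \<open>Remove the smallest mode \<open>nat p\<close> if it is occupied and shift the others down by \<open>2\<close>.\<close>

lemma fermion_states_Suc:
  "fermion_states (Suc k) m =
     fshift ` {T. allowed T \<and> fcard T = Suc k \<and> \<Sum>(fset T) + 2 * Suc k = m}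
     \<union> (\<lambda>T. finsert (nat p) (fshift T)) ` {T. allowed T \<and> fcard T = k \<and> \<Sum>(fset T) + (2 * k + nat p) = m}"
  (is "_ = fshift ` ?A \<union> ?g ` ?B")
proof (intro set_eqI iffI)
  fix S assume S: "S \<in> fermion_states (Suc k) m"
  then have al: "allowed S" by (simp add: fermion_states_def)
  show "S \<in> fshift ` ?A \<union> ?g ` ?B"
  proof (cases "nat p |\<in>| S")
    case False
    then obtain T where T: "S = fshift T" using fshift_surj[OF al] by blast
    then have "T \<in> ?A" using S by (auto simp: fermion_states_def fshift_sum fcard_fshift allowed_fshift)
    then show ?thesis using T by blast
  next
    case True
    obtain R where R: "S = finsert (nat p) R" "nat p |\<notin>| R" using True mk_disjoint_finsert by metis
    then have "allowed R" using al by (simp add: allowed_def)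
    then obtain T where T: "R = fshift T" using fshift_surj R(2) by blast
    have "\<Sum>(fset S) = nat p + \<Sum>(fset R)" "fcard S = Suc (fcard R)"
      using R by (simp_all add: fcard_finsert_disjoint)
    then have "T \<in> ?B"
      using S \<open>allowed R\<close> unfolding T by (auto simp: fermion_states_def fshift_sum fcard_fshift allowed_fshift)
    then show ?thesis using R(1) T by blast
  qed
next
  fix S assume "S \<in> fshift ` ?A \<union> ?g ` ?B"
  then consider T where "T \<in> ?A" "S = fshift T" | T where "T \<in> ?B" "S = ?g T" by blast
  then show "S \<in> fermion_states (Suc k) m"
  proof cases
    case 1
    then show ?thesis by (auto simp: fermion_states_def fshift_sum fcard_fshift allowed_fshift)
  next
    case 2
    have "int (nat p) mod 2 = p" using p by auto
    then have "allowed S" using 2 allowed_fshift[of T] by (simp add: allowed_def)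
    moreover have "\<Sum>(fset S) = nat p + \<Sum>(fset (fshift T))" "fcard S = Suc (fcard (fshift T))"
      using fshift_notin[of T] 2(2) by (simp_all add: fcard_finsert_disjoint)
    ultimately show ?thesis using 2(1) by (auto simp: fermion_states_def fshift_sum fcard_fshift)
  qed
qed

lemma fermion_series_shifted_nth:
  "fps_nth (fps_X ^ e * fermion_series k) m = of_nat (card {T. allowed T \<and> fcard T = k \<and> \<Sum>(fset T) + e = m})"
proof (cases "m < e")
  case True
  then have "{T. allowed T \<and> fcard T = k \<and> \<Sum>(fset T) + e = m} = {}" by auto
  then show ?thesis using True by (simp only: fps_X_power_mult_nth if_True card.empty of_nat_0)
next
  case False
  then have "{T. allowed T \<and> fcard T = k \<and> \<Sum>(fset T) + e = m} = fermion_states k (m - e)"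
    by (auto simp: fermion_states_def)
  then show ?thesis using False by (simp add: fps_X_power_mult_nth fermion_series_def)
qed

lemma fermion_series_Suc:
  "fermion_series (Suc k) = fps_X ^ (2 * Suc k) * fermion_series (Suc k) + fps_X ^ (2 * k + nat p) * fermion_series k"
proof (rule fps_ext)
  fix m
  let ?A = "{T. allowed T \<and> fcard T = Suc k \<and> \<Sum>(fset T) + 2 * Suc k = m}"
  let ?B = "{T. allowed T \<and> fcard T = k \<and> \<Sum>(fset T) + (2 * k + nat p) = m}"
  let ?g = "\<lambda>T. finsert (nat p) (fshift T)"
  have u: "fermion_states (Suc k) m = fshift ` ?A \<union> ?g ` ?B" by (rule fermion_states_Suc)
  have ig: "inj_on ?g ?B"
  proof (rule inj_onI)
    fix S T assume "?g S = ?g T"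
    then have "fshift S = fshift T" using fshift_notin[of S] fshift_notin[of T] by (metis fminus_finsert_absorb finsert_ident)
    then show "S = T" using inj_fshift by (simp add: inj_def)
  qed
  have "fshift ` ?A \<inter> ?g ` ?B = {}" using fshift_notin by fastforce
  moreover have "finite (fshift ` ?A)" "finite (?g ` ?B)"
    using finite_fermion_states[of "Suc k" m] unfolding u by simp_all
  ultimately have "card (fermion_states (Suc k) m) = card (fshift ` ?A) + card (?g ` ?B)"
    unfolding u by (simp only: card_Un_disjoint)
  also have "\<dots> = card ?A + card ?B"
    by (simp only: card_image[OF ig] card_image[OF inj_on_subset[OF inj_fshift subset_UNIV]])
  finally show "fps_nth (fermion_series (Suc k)) m = fps_nth (fps_X ^ (2 * Suc k) * fermion_series (Suc k)
      + fps_X ^ (2 * k + nat p) * fermion_series k) m"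
    unfolding fps_add_nth fermion_series_shifted_nth by (simp add: fermion_series_def)
qed

text \<open>The power of \<open>fps_X\<close> is the least total of \<open>k\<close> distinct modes,
  \<open>p + (p + 2) + ...\<close>, and \<open>ipoch k\<close> counts the partitions that describe
  the excess. The recurrence of \<open>fermion_series_Suc\<close> determines the next series after
  cancelling the nonzero \<open>1 - q_var ^ Suc k\<close>.\<close>

lemma fermion_series: "fermion_series k = fps_X ^ (k * (k - 1) + nat p * k) * ipoch k"
proof (induction k)
  case 0
  have "fermion_states 0 m = (if m = 0 then {{||}} else {})" for m
    by (auto simp: fermion_states_def allowed_def)
  then show ?case by (simp add: fermion_series_def fps_eq_iff)
next
  case (Suc k)
  have e: "(2 * k + nat p) + (k * (k - 1) + nat p * k) = Suc k * (Suc k - 1) + nat p * Suc k"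
    by (cases k) simp_all
  have "(1 - q_var ^ Suc k) * fermion_series (Suc k) = fps_X ^ (2 * k + nat p) * fermion_series k"
    using fermion_series_Suc[of k] unfolding q_var_power by (simp only: left_diff_distrib mult_1_left) (metis add_diff_cancel_left')
  also have "\<dots> = fps_X ^ ((2 * k + nat p) + (k * (k - 1) + nat p * k)) * ipoch k"
    unfolding Suc.IH power_add by (simp only: mult.assoc)
  also have "\<dots> = (1 - q_var ^ Suc k) * (fps_X ^ (Suc k * (Suc k - 1) + nat p * Suc k) * ipoch (Suc k))"
    unfolding e ipoch_Suc[of k, symmetric] by (simp only: mult_ac)
  finally have c: "(1 - q_var ^ Suc k) * fermion_series (Suc k)
      = (1 - q_var ^ Suc k) * (fps_X ^ (Suc k * (Suc k - 1) + nat p * Suc k) * ipoch (Suc k))" .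
  have "fps_nth (1 - q_var ^ Suc k) 0 = 1" by (simp add: q_var_power del: power_Suc)
  then have "1 - q_var ^ Suc k \<noteq> 0" by (metis fps_zero_nth zero_neq_one)
  then show ?case by (rule mult_left_cancel[THEN iffD1, OF _ c])
qed

lemma allowed_parity:
  assumes "allowed S"
  shows "even (\<Sum>(fset S)) \<longleftrightarrow> even (nat p * fcard S)"
proof -
  have "s = 2 * (s div 2) + nat p" if "s \<in> fset S" for s
  proof -
    have "int s mod 2 = p" using assms that by (simp add: allowed_def)
    then have "s mod 2 = nat p" by (metis nat_int of_nat_mod of_nat_numeral)
    then show ?thesis by (metis mult_div_mod_eq)
  qed
  then have "\<Sum>(fset S) = (\<Sum>s\<in>fset S. 2 * (s div 2) + nat p)" by (intro sum.cong) auto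
  also have "\<dots> = 2 * (\<Sum>s\<in>fset S. s div 2) + nat p * fcard S"
    by (simp add: sum.distrib sum_distrib_left fcard.rep_eq)
  finally show ?thesis by simp
qed

end

section \<open>Characters from weight multiplicities\<close>

context ising_pair
begin

lemma sector_parity:
  assumes "in_sector q S"
  shows "even (\<Sum>(fset S)) \<longleftrightarrow> even q"
proof -
  have S: "allowed S" "fcard S mod 2 = q" using assms by (auto simp: in_sector_def)
  have "even (fcard S) \<longleftrightarrow> even q" using S(2) by (metis mod_mod_trivial even_iff_mod_2_eq_zero)
  moreover have "nat p = 1 \<or> nat p = 0 \<and> q = 0" using p q by auto
  ultimately show ?thesis using allowed_parity[OF S(1)] by auto
qed

lemma sector_series:
  "fps_nth (fps_total (\<lambda>j. fermion_series (2 * j + q)) UNIV) m = of_nat (card {S. in_sector q S \<and> \<Sum>(fset S) = m})"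
proof -
  have le: "j \<le> m" if "S \<in> fermion_states (2 * j + q) m" for j S
    using that fcard_le_sum[of S] by (simp add: fermion_states_def)
  have "fps_nth (fps_total (\<lambda>j. fermion_series (2 * j + q)) UNIV) m = (\<Sum>j\<le>m. fps_nth (fermion_series (2 * j + q)) m)"
  proof (rule fps_total_nth)
    fix j assume "fps_nth (fermion_series (2 * j + q)) m \<noteq> 0"
    then have "fermion_states (2 * j + q) m \<noteq> {}" by (auto simp: fermion_series_def)
    then show "j \<in> {..m}" using le by auto
  qed simp_all
  also have "\<dots> = of_nat (\<Sum>j\<le>m. card (fermion_states (2 * j + q) m))"
    by (simp add: fermion_series_def)
  also have "(\<Sum>j\<le>m. card (fermion_states (2 * j + q) m)) = card (\<Union>j\<le>m. fermion_states (2 * j + q) m)"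
    by (rule card_UN_disjoint[symmetric]) (auto simp: finite_fermion_states, auto simp: fermion_states_def)
  also have "(\<Union>j\<le>m. fermion_states (2 * j + q) m) = {S. in_sector q S \<and> \<Sum>(fset S) = m}"
  proof (intro set_eqI iffI)
    fix S assume "S \<in> (\<Union>j\<le>m. fermion_states (2 * j + q) m)"
    then obtain j where "S \<in> fermion_states (2 * j + q) m" by blast
    then show "S \<in> {S. in_sector q S \<and> \<Sum>(fset S) = m}"
      using q2 by (simp add: fermion_states_def in_sector_def)
  next
    fix S assume S: "S \<in> {S. in_sector q S \<and> \<Sum>(fset S) = m}"
    then have "fcard S = 2 * (fcard S div 2) + q" unfolding in_sector_def by (metis (mono_tags, lifting) mem_Collect_eq mult_div_mod_eq)
    then have "S \<in> fermion_states (2 * (fcard S div 2) + q) m"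
      using S by (simp add: fermion_states_def in_sector_def)
    then show "S \<in> (\<Union>j\<le>m. fermion_states (2 * j + q) m)" using le by blast
  qed
  finally show ?thesis .
qed

text \<open>Within the locale the weight 1/2 occurs exactly for \<open>q = 1\<close>, and the
  exponent of \<open>sqrt_q\<close> is then the energy of the base state.\<close>

lemma prefactor: "(if h = 1/2 then sqrt_q else 1) = fps_X ^ q"
proof (cases "q = 0")
  case True
  then have "h = h0" using h by (simp add: base_state_def)
  then have "h \<noteq> 1/2" by (auto simp: h0_def)
  then show ?thesis using True by simp
next
  case False
  then have "h = 1/2" "q = 1" using h q by (auto simp: base_state_def h0_def)
  then show ?thesis by (simp add: sqrt_q_def)
qed

lemma graded_dimension_nth:
  "fps_nth (graded_dimension smul L h) m
    = (if even m then of_nat (card {S. in_sector q S \<and> \<Sum>(fset S) = m + q}) else 0)"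
proof -
  have b: "\<Sum>(fset (base_state q)) = q" using q by (auto simp: base_state_def)
  show ?thesis
    unfolding graded_dimension_def q_var_def sqrt_q_def dim_weight_space b
    by (auto simp: fps_compose_X_square_nth add.commute)
qed

text \<open>The factor \<open>fps_X ^ q\<close> turns the weight counted from \<open>h\<close> into
  the total of the occupied modes. The character has only exponents of the parity of
  \<open>q\<close>; by \<open>sector_parity\<close> the sector has no states at the others, so the
  even coefficients of \<open>graded_dimension\<close> lose nothing.\<close>

lemma ising_character_eq:
  "ising_character h smul L
    = fps_total (\<lambda>j. fps_X ^ ((2 * j + q) * (2 * j + q - 1) + nat p * (2 * j + q)) * ipoch (2 * j + q)) UNIV"
proof -
  have "ising_character h smul L = fps_total (\<lambda>j. fermion_series (2 * j + q)) UNIV"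
  proof (rule fps_ext)
    fix m
    have z: "card {S. in_sector q S \<and> \<Sum>(fset S) = m} = 0" if "even m \<noteq> even q"
    proof -
      have "{S. in_sector q S \<and> \<Sum>(fset S) = m} = {}" using sector_parity that by blast
      then show ?thesis by (simp only: card.empty)
    qed
    have "fps_nth (ising_character h smul L) m = of_nat (card {S. in_sector q S \<and> \<Sum>(fset S) = m})"
    proof (cases "m < q")
      case True
      then have "m = 0" "q = 1" using q2 by auto
      then have e: "even m \<noteq> even q" by simp
      then show ?thesis
        unfolding ising_character_def prefactor fps_X_power_mult_nth z[OF e] using True by simp
    next
      case False
      then have m: "m - q + q = m" by simp
      have "even (m - q) \<longleftrightarrow> even m = even q" using False by auto
      then show ?thesis
        unfolding ising_character_def prefactor fps_X_power_mult_nth graded_dimension_nth m using False z by auto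
    qed
    then show "fps_nth (ising_character h smul L) m = fps_nth (fps_total (\<lambda>j. fermion_series (2 * j + q)) UNIV) m"
      by (simp only: sector_series)
  qed
  then show ?thesis by (simp only: fermion_series)
qed

end

text \<open>Independent of the chosen highest weight vector. The pairs \<open>(p, q)\<close> equal
  to \<open>(1, 0)\<close>, \<open>(1, 1)\<close> and \<open>(0, 0)\<close> give the weights 0, 1/2
  and 1/16.\<close>

lemma (in irreducible_highest_weight_module) ising_character_sector:
  assumes c: "c = 1/2" and p: "p = 0 \<or> p = (1 :: int)" and q: "q = 0 \<or> q = (1 :: nat) \<and> p = 1"
    and h: "h = (if p = 0 then 1/16 else 0) + of_nat q / 2"
  shows "ising_character h smul L
    = fps_total (\<lambda>j. fps_X ^ ((2 * j + q) * (2 * j + q - 1) + nat p * (2 * j + q)) * ipoch (2 * j + q)) UNIV"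
proof -
  obtain hv where hv: "highest_weight_vector h hv" using highest_weight by blast
  interpret fermion p by (rule fermion.intro) (rule p)
  have b: "\<Sum>(fset (base_state q)) = q" using q by (auto simp: base_state_def)
  interpret ising_pair p smul L C h q hv
  proof (intro ising_pair.intro ising_pair_axioms.intro)
    show "irreducible_highest_weight_module smul L C (1/2) h"
      using irreducible_highest_weight_module_axioms unfolding c .
  qed (use q h hv b in \<open>simp_all add: h0_def fermion_axioms\<close>)
  show ?thesis by (rule ising_character_eq)
qed

theorem theorem4:
  fixes scale0 :: "complex \<Rightarrow> 'a::ab_group_add \<Rightarrow> 'a"
    and L0 :: "int \<Rightarrow> 'a \<Rightarrow> 'a" and C0 :: "'a \<Rightarrow> 'a"
    and scale1 :: "complex \<Rightarrow> 'b::ab_group_add \<Rightarrow> 'b"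
    and L1 :: "int \<Rightarrow> 'b \<Rightarrow> 'b" and C1 :: "'b \<Rightarrow> 'b"
    and scale2 :: "complex \<Rightarrow> 'c::ab_group_add \<Rightarrow> 'c"
    and L2 :: "int \<Rightarrow> 'c \<Rightarrow> 'c" and C2 :: "'c \<Rightarrow> 'c"
  assumes "ising_module 0 scale0 L0 C0"
    and "ising_module (1/2) scale1 L1 C1"
    and "ising_module (1/16) scale2 L2 C2"
  shows
    "((\<lambda>(k1, k2). q_var ^ (4 * k1\<^sup>2 + 3 * k1 * k2 + k2\<^sup>2) / (qpoch k1 * qpoch k2)
                   * (1 - q_var ^ (4 * k1 + 2 * k2 + 1)))
       has_sum ising_character 0 scale0 L0) UNIV \<and>
    (\<lambda>(k1, k2). q_var ^ (4 * k1\<^sup>2 + 3 * k1 * k2 + k2\<^sup>2 + 2 * k1) / (qpoch k1 * qpoch k2)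
                   * (1 - q_var ^ (8 * k1 + 4 * k2 + 6))) summable_on UNIV \<and>
    ising_character (1/2) scale1 L1 =
       sqrt_q * (\<Sum>\<^sub>\<infinity>(k1, k2)\<in>UNIV.
                   q_var ^ (4 * k1\<^sup>2 + 3 * k1 * k2 + k2\<^sup>2 + 2 * k1) / (qpoch k1 * qpoch k2)
                   * (1 - q_var ^ (8 * k1 + 4 * k2 + 6))) \<and>
    ((\<lambda>(k1, k2). q_var ^ (4 * k1\<^sup>2 + 3 * k1 * k2 + k2\<^sup>2) / (qpoch k1 * qpoch k2)
                   * (q_var ^ (k1 + k2) + q_var ^ (4 * k1 + k2 + 1)))
       has_sum ising_character (1/16) scale2 L2) UNIV"
proof -
  have V: "irreducible_highest_weight_module scale0 L0 C0 (1/2) 0"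
    "irreducible_highest_weight_module scale1 L1 C1 (1/2) (1/2)"
    "irreducible_highest_weight_module scale2 L2 C2 (1/2) (1/16)"
    using assms by (simp_all add: ising_module_def)
  have e0: "(2 * j + 0) * (2 * j + 0 - 1) + nat 1 * (2 * j + 0) = 2 * (2 * j\<^sup>2)" for j
    by (cases j) (simp_all add: power2_eq_square)
  \<comment> \<open>Exponents count powers of \<open>sqrt_q\<close>; the odd unit here is the factor
    \<open>sqrt_q\<close> in front of the character of weight 1/2.\<close>
  have e1: "(2 * j + 1) * (2 * j + 1 - 1) + nat 1 * (2 * j + 1) = 1 + 2 * (2 * j\<^sup>2 + 2 * j)" for j
    by (simp add: power2_eq_square algebra_simps)
  have x1: "fps_X ^ ((2 * j + 1) * (2 * j + 1 - 1) + nat 1 * (2 * j + 1)) = sqrt_q * q_var ^ (2 * j\<^sup>2 + 2 * j)" for j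
    unfolding e1 q_var_power sqrt_q_def power_add[of _ 1] by simp
  have e2: "(2 * j + 0) * (2 * j + 0 - 1) + nat 0 * (2 * j + 0) = 2 * (2 * j\<^sup>2 - j)" for j
    by (cases j) (simp_all add: power2_eq_square algebra_simps)
  have "ising_character 0 scale0 L0 = fps_total (\<lambda>j. q_var ^ (2 * j\<^sup>2) * ipoch (2 * j)) UNIV"
    by (subst irreducible_highest_weight_module.ising_character_sector[OF V(1), of 1 0])
      (simp_all only: e0 q_var_power, simp_all)
  moreover have "ising_character (1/16) scale2 L2 = fps_total (\<lambda>j. q_var ^ (2 * j\<^sup>2 - j) * ipoch (2 * j)) UNIV"
    by (subst irreducible_highest_weight_module.ising_character_sector[OF V(3), of 0 0])
      (simp_all only: e2 q_var_power, simp_all)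
  moreover have "ising_character (1/2) scale1 L1 = sqrt_q * fps_total (\<lambda>j. q_var ^ (2 * j\<^sup>2 + 2 * j) * ipoch (2 * j + 1)) UNIV"
  proof -
    have "ising_character (1/2) scale1 L1 = fps_total (\<lambda>j. sqrt_q * (q_var ^ (2 * j\<^sup>2 + 2 * j) * ipoch (2 * j + 1))) UNIV"
      by (subst irreducible_highest_weight_module.ising_character_sector[OF V(2), of 1 1])
        (simp_all only: x1 mult.assoc, simp_all)
    also have "\<dots> = sqrt_q * fps_total (\<lambda>j. q_var ^ (2 * j\<^sup>2 + 2 * j) * ipoch (2 * j + 1)) UNIV"
      by (rule fps_total_cmult, rule loc_fin_q_square) simp
    finally show ?thesis .
  qed
  ultimately show ?thesis
    using double_sum_vacuum double_sum_ramond double_sum_fermion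
      has_sum_imp_summable[OF double_sum_fermion] infsumI[OF double_sum_fermion] by simp
qed

end
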